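(* Let $r\approx 0.5451510421$ be the unique root in $(1/2,3/5)$ of $(7+4\sqrt3)r^4+(20+12\sqrt3)r^3+(6+4\sqrt3)r^2+(-20-4\sqrt3)r+3=0$. Let $\alpha'=\arccos\frac{1}{1+r}$ and $\beta=\pi-2\arccos\frac{r}{1+r}$, and let $P$ be the convex hexagon with all sides of length $2$ whose interior angles are alternately $2\alpha'$ and $2\alpha'+\beta$. There is a one-to-one correspondence between compact packings of the plane using discs of radius $1$ and $r$ and edge-to-edge tilings of the plane by congruent copies of $P$ and equilateral triangles with sides of length $2$ that contain at least one copy of $P$. The correspondence sends a packing to the tiling formed by the line segments joining the centres of all pairs of tangent discs of radius $1$; its inverse sends a tiling to the packing with a disc of radius $1$ centred at each vertex of the tiling and, inside each copy of $P$, three mutually tangent discs of radius $r$, each tangent to the radius-$1$ discs centred at three consecutive vertices of the hexagon, the middle one of which has interior angle $2\alpha'$.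
   Context: A packing of the plane is a collection of closed discs in $\mathbb{R}^2$ with pairwise disjoint interiors. A packing is compact if for every disc $D$ of the packing, the discs of the packing tangent to $D$, listed in cyclic order around $D$ as $D_1,\dots,D_n$ (with $D_{n+1}=D_1$), are such that $D_i$ is tangent to $D_{i+1}$ for $i=1,\dots,n$, and this chain surrounds $D$: the angles, in $(0,\pi)$, at the centre of $D$ in the triangles with vertices the centres of $D,D_i,D_{i+1}$ sum to $2\pi$. A compact packing using discs of radius $1$ and $r$ is a compact packing in which every disc has radius $1$ or $r$ and discs of both radii occur. A tiling by polygons is edge-to-edge if any two distinct tiles that intersect do so in a common vertex or a common full side. *)

theory Defs
  imports "HOL-Analysis.Analysis"
begin

text \<open>The Euclidean plane is the type \<^typ>\<open>complex\<close>.\<close>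

definition angle :: "complex \<Rightarrow> complex \<Rightarrow> real" where
  "angle u v = arccos ((u \<bullet> v) / (norm u * norm v))"

text \<open>A closed disc is given by its centre and radius; it stands for the point set
  \<open>cball (fst D) (snd D)\<close>.\<close>

type_synonym disc = "complex \<times> real"

definition packing :: "disc set \<Rightarrow> bool" where
  "packing S \<longleftrightarrow> (\<forall>D\<in>S. snd D > 0) \<and>
     pairwise (\<lambda>D E. interior (cball (fst D) (snd D)) \<inter> interior (cball (fst E) (snd E)) = {}) S"

text \<open>Between discs of a packing only external tangency can occur.\<close>

definition tangent :: "disc \<Rightarrow> disc \<Rightarrow> bool" where
  "tangent D E \<longleftrightarrow> dist (fst D) (fst E) = snd D + snd E"

text \<open>Sorting the neighbours by \<^const>\<open>Arg\<close> lists them in counterclockwise order, starting at the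
  cut of \<^const>\<open>Arg\<close>; the condition on a closed chain depends neither on the starting point nor
  on the orientation. A triangle spanned by the centres of three mutually tangent discs is
  nondegenerate, so the angles summed below lie strictly between \<open>0\<close> and \<open>pi\<close>.\<close>

definition surrounded :: "disc set \<Rightarrow> disc \<Rightarrow> bool" where
  "surrounded S D \<longleftrightarrow> (\<exists>Ds.
     set Ds = {E \<in> S. tangent D E} \<and>
     sorted_wrt (\<lambda>E F. Arg (fst E - fst D) < Arg (fst F - fst D)) Ds \<and>
     (\<forall>i<length Ds. tangent (Ds ! i) (Ds ! (Suc i mod length Ds))) \<and>
     (\<Sum>i<length Ds. angle (fst (Ds ! i) - fst D)
                         (fst (Ds ! (Suc i mod length Ds)) - fst D)) = 2 * pi)"

definition compact_packing :: "disc set \<Rightarrow> bool" where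
  "compact_packing S \<longleftrightarrow> packing S \<and> (\<forall>D\<in>S. surrounded S D)"

definition compact_packings_1 :: "real \<Rightarrow> disc set set" where
  "compact_packings_1 r = {S. compact_packing S \<and> snd ` S = {1, r}}"

text \<open>Convex polygons are closed regions; \<open>vs\<close> lists the vertices in cyclic order.\<close>

definition convex_polygon :: "complex list \<Rightarrow> complex set \<Rightarrow> bool" where
  "convex_polygon vs P \<longleftrightarrow> distinct vs \<and> P = convex hull (set vs) \<and>
     {v. v extreme_point_of P} = set vs \<and>
     (\<forall>i<length vs. closed_segment (vs ! i) (vs ! (Suc i mod length vs)) edge_of P)"

definition side_length :: "complex list \<Rightarrow> nat \<Rightarrow> real" where
  "side_length vs i = dist (vs ! i) (vs ! (Suc i mod length vs))"

definition interior_angle :: "complex list \<Rightarrow> nat \<Rightarrow> real" where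
  "interior_angle vs i =
     angle (vs ! ((i + length vs - 1) mod length vs) - vs ! i) (vs ! (Suc i mod length vs) - vs ! i)"

definition congruent_to :: "complex set \<Rightarrow> complex set \<Rightarrow> bool" where
  "congruent_to P Q \<longleftrightarrow> (\<exists>f. (\<forall>x y. dist (f x) (f y) = dist x y) \<and> Q = f ` P)"

definition equilateral_triangle :: "real \<Rightarrow> complex set \<Rightarrow> bool" where
  "equilateral_triangle s t \<longleftrightarrow>
     (\<exists>vs. length vs = 3 \<and> convex_polygon vs t \<and> (\<forall>i<3. side_length vs i = s))"

definition tiling :: "complex set set \<Rightarrow> bool" where
  "tiling T \<longleftrightarrow> \<Union>T = UNIV \<and> pairwise (\<lambda>s t. interior s \<inter> interior t = {}) T"

definition edge_to_edge :: "complex set set \<Rightarrow> bool" where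
  "edge_to_edge T \<longleftrightarrow> (\<forall>s\<in>T. \<forall>t\<in>T. s \<noteq> t \<longrightarrow> s \<inter> t \<noteq> {} \<longrightarrow>
     (\<exists>v. v extreme_point_of s \<and> v extreme_point_of t \<and> s \<inter> t = {v}) \<or>
     (\<exists>e. e edge_of s \<and> e edge_of t \<and> s \<inter> t = e))"

definition quartic :: "real \<Rightarrow> real" where
  "quartic r = (7 + 4 * sqrt 3) * r^4 + (20 + 12 * sqrt 3) * r^3 + (6 + 4 * sqrt 3) * r^2
     + (- 20 - 4 * sqrt 3) * r + 3"

definition alpha' :: "real \<Rightarrow> real" where
  "alpha' r = arccos (1 / (1 + r))"

definition beta :: "real \<Rightarrow> real" where
  "beta r = pi - 2 * arccos (r / (1 + r))"

definition is_hexagon_P :: "real \<Rightarrow> complex set \<Rightarrow> bool" where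
  "is_hexagon_P r P \<longleftrightarrow> (\<exists>vs. length vs = 6 \<and> convex_polygon vs P \<and>
     (\<forall>i<6. side_length vs i = 2 \<and>
        interior_angle vs i = (if even i then 2 * alpha' r else 2 * alpha' r + beta r)))"

definition tilings_by :: "complex set \<Rightarrow> complex set set set" where
  "tilings_by P = {T. tiling T \<and> edge_to_edge T \<and>
     (\<forall>t\<in>T. congruent_to P t \<or> equilateral_triangle 2 t) \<and> (\<exists>t\<in>T. congruent_to P t)}"

text \<open>The segments cut the plane into connected open pieces; their closures are the tiles.\<close>

definition tiling_of_packing :: "disc set \<Rightarrow> complex set set" where
  "tiling_of_packing S = closure ` components
     (UNIV - \<Union>{closed_segment c d | c d. (c, 1) \<in> S \<and> (d, 1) \<in> S \<and> tangent (c, 1) (d, 1)})"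

definition inscribed_trio :: "real \<Rightarrow> complex set \<Rightarrow> disc set \<Rightarrow> bool" where
  "inscribed_trio r H K \<longleftrightarrow> card K = 3 \<and> pairwise tangent K \<and>
     (\<forall>D\<in>K. snd D = r \<and> cball (fst D) (snd D) \<subseteq> H \<and>
        (\<exists>vs. length vs = 6 \<and> convex_polygon vs H \<and> interior_angle vs 1 = 2 * alpha' r \<and>
              (\<forall>j<3. tangent D (vs ! j, 1))))"

definition packing_of_tiling :: "real \<Rightarrow> complex set \<Rightarrow> complex set set \<Rightarrow> disc set" where
  "packing_of_tiling r P T =
     {(v, 1) | v. \<exists>t\<in>T. v extreme_point_of t} \<union>
     (\<Union>H\<in>{H \<in> T. congruent_to P H}. THE K. inscribed_trio r H K)"

end

theory Submission
  imports Defs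
begin

text \<open>
  A packing of discs of radii \<open>1\<close> and \<open>r\<close> is compact iff every directed pair of tangent discs has
  a disc on its left tangent to both. The angle sum around a small disc leaves two possible
  coronas: six small discs, impossible because some disc has radius \<open>1\<close>, or two small and three
  unit discs; hence the small discs come in triples, each filling a copy of \<open>P\<close>, whose side condition
  is the quartic equation. The interior of a tile spanned by unit centres avoids all unit
  segments, so it is a component of their complement; the tiles cover the plane because their
  union is clopen once the discrete set of centres is removed. Conversely, tiles of an
  edge-to-edge tiling contain the sectors of radius \<open>6/5\<close> at their vertices, which forces the
  distances between vertices that the packing needs.
\<close>

section \<open>The quartic and plane geometry\<close>

text \<open>The left-hand condition turns everything into forced placement: a point at prescribed
  distances from two given points, on a prescribed side of their line, is unique
  (\<open>left_unique\<close>). Coronas are followed disc by disc from explicit coordinates, and the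
  cyclic list in \<open>surrounded\<close> is unpacked only once in each direction. Coronas of unit
  discs are never enumerated: the angles that touching neighbours subtend at one disc differ by a
  factor less than two, so nothing fits between two neighbours that already touch.

  The quartic comes from the small corona. With \<open>gamma\<close> the angle at a small disc
  between a small and a unit neighbour, the five angles add up to 2 * pi exactly when 2 *
  \<open>alpha'\<close> = pi/6 + \<open>gamma\<close>; clearing the square root of 1 + 2r from this
  relation leaves the quartic.

  Neither \<open>convex_polygon\<close> nor \<open>congruent_to\<close> mentions an orientation.
  Rigidity (\<open>hexagon_rigid\<close>) and the mirror symmetry of the hexagon reduce every copy
  of P to an orientation-preserving motion of one explicit vertex list.\<close>

lemma sqrt3_bounds: "1.73205080756 < sqrt 3" "sqrt 3 < 1.73205080757"
  by (rule real_less_rsqrt real_less_lsqrt; simp add: power2_eq_square)+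

text \<open>The divided difference \<open>K\<close> has only its constant term negative; for
  arguments at least 1/2 it is bounded below by its value at x = y = 1/2, which is positive.\<close>

lemma quartic_strict_mono:
  assumes "1/2 \<le> x" "x < y"
  shows "quartic x < quartic y"
proof -
  have xy: "1/4 \<le> x*x" "1/4 \<le> x*y" "1/4 \<le> y*y"
    using assms mult_mono[of "1/2" x "1/2" x] mult_mono[of "1/2" x "1/2" y] mult_mono[of "1/2" y "1/2" y] by auto
  have c: "1/8 \<le> x*x*x" "1/8 \<le> x*x*y" "1/8 \<le> x*y*y" "1/8 \<le> y*y*y"
    using assms mult_mono[of "1/4" "x*x" "1/2" x] mult_mono[of "1/4" "x*x" "1/2" y]
      mult_mono[of "1/4" "x*y" "1/2" y] mult_mono[of "1/4" "y*y" "1/2" y] xy by auto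
  define A where "A = x*x*x + x*x*y + x*y*y + y*y*y"
  define B where "B = x*x + x*y + y*y"
  have A: "A \<ge> 1/2" and B: "B \<ge> 3/4" unfolding A_def B_def using c xy by linarith+
  define K where "K = (7 + 4 * sqrt 3) * A + (20 + 12 * sqrt 3) * B + (6 + 4 * sqrt 3) * (x+y) + (- 20 - 4 * sqrt 3)"
  have "(7 + 4 * sqrt 3) * A \<ge> (7 + 4 * sqrt 3) * (1/2)"
    "(20 + 12 * sqrt 3) * B \<ge> (20 + 12 * sqrt 3) * (3/4)"
    "(6 + 4 * sqrt 3) * (x+y) \<ge> (6 + 4 * sqrt 3) * 1"
    using A B assms by (intro mult_left_mono; simp)+
  then have "K > 0" unfolding K_def using sqrt3_bounds by argo
  moreover have "quartic y - quartic x = (y - x) * K"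
    unfolding quartic_def K_def A_def B_def by algebra
  ultimately have "quartic y - quartic x > 0" using assms by simp
  then show ?thesis by simp
qed

text \<open>Rational part and part in \<open>sqrt 3\<close>: at a rational point the sign then
  follows from linear bounds on \<open>sqrt 3\<close>.\<close>

lemma quartic_eq: "quartic x = (7*x^4 + 20*x^3 + 6*x^2 - 20*x + 3) + sqrt 3 * (4*x^4 + 12*x^3 + 4*x^2 - 4*x)"
  unfolding quartic_def by algebra

lemma quartic_sign: "quartic 0.545151042 < 0" "quartic 0.5451510422 > 0" "quartic (1/2) < 0"
  unfolding quartic_eq using sqrt3_bounds by (simp_all add: power_divide eval_nat_numeral)

lemma quartic_continuous: "continuous_on A quartic"
  unfolding quartic_def[abs_def] by (intro continuous_intros)

lemma quartic_root_ex1: "\<exists>!r. 1/2 < r \<and> r < 3/5 \<and> quartic r = 0"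
proof -
  obtain r where r: "0.545151042 \<le> r" "r \<le> 0.5451510422" "quartic r = 0"
    using IVT'[of quartic "0.545151042" 0 "0.5451510422"] quartic_sign quartic_continuous by auto
  show ?thesis
  proof (intro ex1I[of _ r] conjI)
    fix x assume x: "1/2 < x \<and> x < 3/5 \<and> quartic x = 0"
    show "x = r"
      using quartic_strict_mono[of x r] quartic_strict_mono[of r x] x r by (cases x r rule: linorder_cases) auto
  qed (use r in auto)
qed

lemma quartic_mono: "1/2 \<le> x \<Longrightarrow> x \<le> y \<Longrightarrow> quartic x \<le> quartic y"
  using quartic_strict_mono[of x y] by (cases "x = y") auto

lemma quartic_root_bounds:
  assumes "1/2 < r" "quartic r = 0"
  shows "0.545151042 < r" "r < 0.5451510422"
proof -
  show "0.545151042 < r"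
    using quartic_mono[of r "0.545151042"] quartic_sign(1) assms by (intro not_le_imp_less notI) linarith
  show "r < 0.5451510422"
  proof (rule ccontr)
    assume "\<not> r < 0.5451510422"
    then have "quartic 0.5451510422 \<le> quartic r" by (intro quartic_mono) auto
    then show False using quartic_sign(2) assms by linarith
  qed
qed

text \<open>Twice the signed area of the triangle \<open>a\<close>, \<open>b\<close>,
  \<open>x\<close>: positive iff \<open>x\<close> lies to the left of the line directed from
  \<open>a\<close> to \<open>b\<close>.\<close>

definition cross :: "complex \<Rightarrow> complex \<Rightarrow> complex \<Rightarrow> real" where
  "cross a b x = (Re b - Re a) * (Im x - Im a) - (Im b - Im a) * (Re x - Re a)"

lemma cr_rotate: "cross b c a = cross a b c" "cross c a b = cross a b c"
  unfolding cross_def by algebra+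

lemma cr_swap: "cross b a c = - cross a b c" "cross a c b = - cross a b c"
  unfolding cross_def by algebra+

lemma cr_same [simp]: "cross a a c = 0" "cross a b a = 0" "cross a b b = 0"
  unfolding cross_def by auto

lemma cr_affine: "cross a b ((1 - t) *\<^sub>R x + t *\<^sub>R y) = (1 - t) * cross a b x + t * cross a b y"
  unfolding cross_def by (simp add: algebra_simps)

lemma cr_inner: "cross a b x = (\<i> * (b - a)) \<bullet> x - (\<i> * (b - a)) \<bullet> a"
  unfolding cross_def inner_complex_def by (simp add: algebra_simps)

text \<open>Along a side of length 2, \<open>cross\<close> is twice the distance to the line; this
  is how the bounds 12/5 and 2 used below become the distances 6/5 and 1.\<close>

lemma cr_lipschitz: "\<bar>cross a b x - cross a b y\<bar> \<le> dist a b * dist x y"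
proof -
  have "cross a b x - cross a b y = (\<i> * (b - a)) \<bullet> (x - y)"
    unfolding cr_inner by (simp add: inner_diff_right)
  then show ?thesis
    using Cauchy_Schwarz_ineq2[of "\<i> * (b - a)" "x - y"] by (simp add: norm_mult dist_norm norm_minus_commute)
qed

lemma continuous_on_cr [continuous_intros]: "continuous_on A (cross a b)"
  unfolding cross_def[abs_def] by (intro continuous_intros)

lemma open_cr: "open {x. cross a b x > 0}"
  using continuous_on_cr[of UNIV a b] by (intro open_Collect_less continuous_intros)

lemma convex_cr: "convex {x. cross a b x \<ge> 0}" "convex {x. cross a b x > 0}"
  unfolding cr_inner using convex_halfspace_ge convex_halfspace_gt by auto

lemma cr_zero_line:
  assumes "cross a b x = 0" "a \<noteq> b"
  shows "\<exists>t. x = (1 - t) *\<^sub>R a + t *\<^sub>R b"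
proof -
  let ?d = "(Re b - Re a)^2 + (Im b - Im a)^2"
  have d: "?d \<noteq> 0" using assms(2) by (auto simp: complex_eq_iff sum_power2_eq_zero_iff)
  let ?t = "((Re b - Re a) * (Re x - Re a) + (Im b - Im a) * (Im x - Im a)) / ?d"
  have c: "(Re b - Re a) * (Im x - Im a) = (Im b - Im a) * (Re x - Re a)"
    using assms(1) unfolding cross_def by simp
  have t: "?t * ?d = (Re b - Re a) * (Re x - Re a) + (Im b - Im a) * (Im x - Im a)"
    using d by simp
  have "?d * (Re x - Re a - ?t * (Re b - Re a)) = 0" "?d * (Im x - Im a - ?t * (Im b - Im a)) = 0"
    using t c by algebra+
  then have "Re x = Re a + ?t * (Re b - Re a)" "Im x = Im a + ?t * (Im b - Im a)"
    using d by auto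
  moreover have "Re x = Re a + t * (Re b - Re a) \<Longrightarrow> Im x = Im a + t * (Im b - Im a) \<Longrightarrow>
      x = (1 - t) *\<^sub>R a + t *\<^sub>R b" for t
    by (simp add: complex_eq_iff algebra_simps)
  ultimately show ?thesis by blast
qed

lemma dist_sq: "(dist x y)^2 = (Re x - Re y)^2 + (Im x - Im y)^2"
  by (simp add: dist_norm cmod_power2)

lemma dist_eq_iff_sq: "d \<ge> 0 \<Longrightarrow> dist x y = d \<longleftrightarrow> (Re x - Re y)^2 + (Im x - Im y)^2 = d^2"
  by (metis dist_sq power2_eq_iff_nonneg zero_le_dist)

text \<open>The two distances fix the inner product with \<open>b - a\<close>; Lagrange's identity
  then fixes the square of \<open>cross\<close>, and its sign is given.\<close>

lemma left_unique:
  assumes "dist a x = dist a y" "dist b x = dist b y" "cross a b x > 0" "cross a b y > 0"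
  shows "x = y"
proof -
  have ab: "a \<noteq> b" using assms by auto
  define u v where "u = Re x - Re a" and "v = Im x - Im a"
  define u' v' where "u' = Re y - Re a" and "v' = Im y - Im a"
  define c d where "c = Re b - Re a" and "d = Im b - Im a"
  have 1: "u^2 + v^2 = u'^2 + v'^2"
    using arg_cong[OF assms(1), of "\<lambda>t. t^2"] unfolding dist_sq u_def v_def u'_def v'_def by (simp add: power2_commute)
  have 2: "(c - u)^2 + (d - v)^2 = (c - u')^2 + (d - v')^2"
    using arg_cong[OF assms(2), of "\<lambda>t. t^2"] unfolding dist_sq u_def v_def u'_def v'_def c_def d_def by simp
  have 3: "c * u + d * v = c * u' + d * v'" using 1 2 by (simp add: power2_eq_square algebra_simps)
  have p: "c * v - d * u > 0" "c * v' - d * u' > 0"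
    using assms(3,4) unfolding cross_def u_def v_def u'_def v'_def c_def d_def by auto
  have "(c * v - d * u)^2 = (c^2+d^2) * (u^2+v^2) - (c * u + d * v)^2"
    "(c * v' - d * u')^2 = (c^2+d^2) * (u'^2+v'^2) - (c * u' + d * v')^2" by algebra+
  then have "(c * v - d * u)^2 = (c * v' - d * u')^2" using 1 3 by simp
  then have 4: "c * v - d * u = c * v' - d * u'" using p by (simp add: power2_eq_iff)
  have cd: "c^2+d^2 \<noteq> 0" using ab unfolding c_def d_def by (auto simp: complex_eq_iff sum_power2_eq_zero_iff)
  have "(c^2+d^2) * (u - u') = 0" "(c^2+d^2) * (v - v') = 0" using 3 4 by algebra+
  then have "u = u'" "v = v'" using cd by auto
  then show ?thesis unfolding u_def v_def u'_def v'_def by (simp add: complex_eq_iff)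
qed

text \<open>For \<open>norm w = 1\<close> these are the orientation-preserving isometries. Mirror
  images are reduced to them by conjugation.\<close>

definition motion :: "complex \<Rightarrow> complex \<Rightarrow> complex \<Rightarrow> complex" where
  "motion a w z = a + w * z"

lemma dist_mv: "norm w = 1 \<Longrightarrow> dist (motion a w x) (motion a w y) = dist x y"
  unfolding motion_def dist_norm by (simp add: norm_mult flip: right_diff_distrib)

lemma cr_mv:
  assumes "norm w = 1"
  shows "cross (motion a w x) (motion a w y) (motion a w z) = cross x y z"
proof -
  have "(Re w)^2 + (Im w)^2 = 1" using assms by (metis cmod_power2 one_power2)
  moreover have "cross (motion a w x) (motion a w y) (motion a w z) = ((Re w)^2 + (Im w)^2) * cross x y z"
    unfolding cross_def motion_def by (simp; algebra)
  ultimately show ?thesis by simp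
qed

lemma mv_inj: "norm w = 1 \<Longrightarrow> motion a w x = motion a w y \<longleftrightarrow> x = y"
  unfolding motion_def by auto

lemma mv_inverse:
  assumes "norm w = 1"
  shows "motion a w (motion (- cnj w * a) (cnj w) z) = z"
proof -
  have "w * cnj w = 1" using complex_norm_square[of w] assms by simp
  then show ?thesis unfolding motion_def by (simp add: algebra_simps) 
qed

lemma mv_surj: "norm w = 1 \<Longrightarrow> \<exists>z. x = motion a w z"
  by (metis mv_inverse)

lemma mv_hull: "motion a w ` (convex hull X) = convex hull (motion a w ` X)"
proof -
  have 1: "motion a w ` Y = (\<lambda>x. a + x) ` (\<lambda>x. w * x) ` Y" for Y
    by (auto simp: motion_def image_image)
  have "linear (\<lambda>x. w * x)" by (simp add: bounded_linear.linear bounded_linear_mult_right)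
  then show ?thesis unfolding 1
    by (simp only: convex_hull_linear_image convex_hull_translation)
qed

section \<open>Lengths in the hexagon, from the quartic\<close>

locale ratio =
  fixes r :: real
  assumes r_gt: "1/2 < r" and r_lt: "r < 3/5" and root: "quartic r = 0"
begin

lemma r_bounds: "0.545 < r" "r < 0.546" "r > 0"
  using quartic_root_bounds[OF r_gt root] by auto

text \<open>The three small centres form an equilateral triangle of side 2r, with circumradius
  \<open>hs\<close> and inradius r / sqrt 3. \<open>hq\<close> adds 1 + r to the circumradius;
  \<open>hm\<close> adds to the inradius the height sqrt (1 + 2r) of the isosceles triangle with
  base 2r and legs 1 + r.\<close>

definition hq :: real where "hq = 2 * r / sqrt 3 + 1 + r"
definition hm :: real where "hm = r / sqrt 3 + sqrt (1 + 2 * r)"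
definition hs :: real where "hs = 2 * r / sqrt 3"

text \<open>Squaring this relation gives exactly the quartic; positivity of the right side selects
  the square root.\<close>

lemma sqrt_relation: "(1 + r) * sqrt (1 + 2 * r) = (2 + sqrt 3) * r^2 + (4 + sqrt 3) * r - 2"
proof -
  let ?R = "(2 + sqrt 3) * r^2 + (4 + sqrt 3) * r - 2"
  have p: "?R > 0"
  proof -
    have "(2 + sqrt 3) * r^2 \<ge> 0" by simp
    moreover have "(4 + sqrt 3) * r \<ge> (4 + sqrt 3) * (1/2)" using r_gt by (intro mult_left_mono) auto
    ultimately show ?thesis using sqrt3_bounds by argo
  qed
  have "?R^2 - (1 + r)^2 * (1 + 2 * r) = quartic r"
  proof -
    have q: "sqrt 3 ^ 2 = 3" by simp
    have "?R^2 - (1 + r)^2 * (1 + 2 * r) = quartic r + (sqrt 3 ^ 2 - 3) * (r^2 + r)^2"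
      unfolding quartic_def by algebra
    then show ?thesis unfolding q by simp
  qed
  then have "?R^2 = (1 + r)^2 * (1 + 2 * r)" using root by simp
  then have "?R = sqrt ((1 + r)^2 * (1 + 2 * r))" using p by (metis less_le real_sqrt_abs abs_of_pos)
  then show ?thesis using r_gt by (simp add: real_sqrt_mult)
qed

lemma sqrt3_div: "x / sqrt 3 = x * sqrt 3 / 3"
  by (simp add: field_simps)

lemma hs_sqrt3: "hs * sqrt 3 = 2 * r" and hs_sq: "hs^2 * 3 = 4 * r^2"
  unfolding hs_def by (auto simp: power_divide power_mult_distrib)

lemma hq_hs: "hq - hs = 1 + r" unfolding hq_def hs_def by simp

text \<open>Law of cosines at the centre of the hexagon, angle pi/3: a small disc touches the unit
  discs at the two nearest vertices at distance \<open>hm\<close>.\<close>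

lemma hm_hs: "hm^2 - hm * hs + hs^2 = (1 + r)^2"
proof -
  have y: "(sqrt (1 + 2 * r))^2 = 1 + 2 * r" using r_gt by simp
  have "hm = hs / 2 + sqrt (1 + 2 * r)" unfolding hm_def hs_def by simp
  moreover have "(s / 2 + x)^2 - (s / 2 + x) * s + s^2 = x^2 + s^2 * 3 / 4" for s x :: real
    by (simp add: power2_eq_square field_simps)
  ultimately have "hm^2 - hm * hs + hs^2 = (sqrt (1 + 2 * r))^2 + hs^2 * 3 / 4" by metis
  then show ?thesis unfolding y hs_sq by (simp add: power2_eq_square algebra_simps)
qed

lemma hq_hm_lin: "(hq - hm / 2) * (1 + r) = 2"
proof -
  have "(hq - hm / 2) * (1 + r) * 2 = (1 + r) * (sqrt 3 * r) + 2 * (1 + r)^2 - (1 + r) * sqrt (1 + 2 * r)"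
    unfolding hq_def hm_def sqrt3_div by (simp add: power2_eq_square field_simps)
  also have "\<dots> = 4" unfolding sqrt_relation by (simp add: power2_eq_square algebra_simps)
  finally show ?thesis by linarith
qed

text \<open>Law of cosines at the centre, angle pi/3: the sides of the hexagon have length
  2.\<close>

lemma hq_hm: "hq^2 + hm^2 - hq * hm = 4"
proof -
  have "hq^2 + hm^2 - hq * hm = (hm^2 - hm * hs + hs^2) + (hq - hs)^2 + 2 * (hq - hs) * (hq - hm/2) - 2 * (hq - hs)^2"
    by algebra
  also have "\<dots> = (1 + r)^2 + (1 + r)^2 + 2 * ((hq - hm/2) * (1 + r)) - 2 * (1 + r)^2"
    unfolding hm_hs hq_hs by simp
  also have "\<dots> = 4" unfolding hq_hm_lin by simp
  finally show ?thesis .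
qed

lemma hs_bounds: "0.629 < hs" "hs < 0.632"
proof -
  have "0.545 * 1.732 \<le> r * sqrt 3" "r * sqrt 3 \<le> 0.546 * 1.7321"
    using sqrt3_bounds r_bounds by (intro mult_mono; simp)+
  then show "0.629 < hs" "hs < 0.632" unfolding hs_def sqrt3_div by auto
qed

lemma hq_bounds: "2.17 < hq" "hq < 2.18"
  using hq_hs hs_bounds r_bounds by auto

lemma hm_bounds: "1.75 < hm" "hm < 1.77"
proof -
  have "1.445 < sqrt (1 + 2 * r)" "sqrt (1 + 2 * r) < 1.447"
    by (rule real_less_rsqrt real_less_lsqrt; use r_bounds in \<open>simp add: power2_eq_square\<close>)+
  moreover have "hm = hs / 2 + sqrt (1 + 2 * r)" unfolding hm_def hs_def by simp
  ultimately show "1.75 < hm" "hm < 1.77" using hs_bounds by auto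
qed

end

section \<open>Convex polygons with sides of length 2\<close>

definition succ_vertex :: "complex list \<Rightarrow> nat \<Rightarrow> complex" where
  "succ_vertex vs i = vs ! (Suc i mod length vs)"

text \<open>The bound \<open>12/5\<close> makes the line through a side of length \<open>2\<close> stay at distance at least
  \<open>6/5\<close> from the other vertices, so that the tile contains its sector of radius \<open>6/5\<close> at each vertex.\<close>

definition good_polygon :: "complex list \<Rightarrow> bool" where
  "good_polygon vs \<longleftrightarrow> 3 \<le> length vs \<and>
     (\<forall>i<length vs. \<forall>j<length vs. j \<noteq> i \<longrightarrow> j \<noteq> Suc i mod length vs \<longrightarrow>
        12/5 \<le> cross (vs ! i) (succ_vertex vs i) (vs ! j)) \<and>
     (\<forall>i<length vs. dist (vs ! i) (succ_vertex vs i) = 2) \<and>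
     (\<forall>i<length vs. \<forall>j<length vs. i \<noteq> j \<longrightarrow> 2 \<le> dist (vs ! i) (vs ! j) \<and>
        (dist (vs ! i) (vs ! j) = 2 \<longrightarrow> j = Suc i mod length vs \<or> i = Suc j mod length vs)) \<and>
     (\<forall>x. (\<forall>i<length vs. 0 \<le> cross (vs ! i) (succ_vertex vs i) x) \<longrightarrow> x \<in> convex hull set vs) \<and>
     (\<forall>x\<in>convex hull set vs. x \<in> set vs \<or> (\<exists>v\<in>set vs. dist x v < 2)) \<and>
     (\<exists>c. ball c (1/2) \<subseteq> convex hull set vs \<and> convex hull set vs \<subseteq> cball c 3)"

text \<open>A side is directed, with the tile on its left, and is described by the region alone, so
  that tiles can be handled without their vertex lists.\<close>

definition side :: "complex set \<Rightarrow> complex \<Rightarrow> complex \<Rightarrow> bool" where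
  "side t a b \<longleftrightarrow> a extreme_point_of t \<and> b extreme_point_of t \<and> dist a b = 2 \<and> (\<forall>x\<in>t. 0 \<le> cross a b x)"

definition tile :: "complex set \<Rightarrow> bool" where
  "tile t \<longleftrightarrow> (\<exists>vs. good_polygon vs \<and> t = convex hull set vs)"

lemma suc_mod:
  assumes "i < n" "3 \<le> n"
  shows "Suc i mod n < n" "Suc i mod n \<noteq> i" "Suc (Suc i mod n) mod n \<noteq> i"
  using assms by (cases "Suc i = n"; cases "Suc (Suc i) = n"; simp)+

lemma pred_mod:
  assumes "i < n"
  obtains j where "j < n" "Suc j mod n = i"
proof (cases i)
  case 0
  then show ?thesis using assms that[of "n - 1"] by simp
next
  case (Suc j)
  then show ?thesis using assms that[of j] by simp
qed

lemma closed_segmentE: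
  assumes "x \<in> closed_segment a b"
  obtains t where "0 \<le> t" "t \<le> 1" "x = (1 - t) *\<^sub>R a + t *\<^sub>R b"
  using assms unfolding closed_segment_def by auto

context
  fixes vs assumes good_polygon: "good_polygon vs"
begin

private abbreviation "n \<equiv> length vs"
private abbreviation "P \<equiv> convex hull set vs"
private abbreviation "crs i x \<equiv> cross (vs ! i) (succ_vertex vs i) x"

lemma n3: "3 \<le> n" using good_polygon unfolding good_polygon_def by simp

lemma far: "i < n \<Longrightarrow> j < n \<Longrightarrow> j \<noteq> i \<Longrightarrow> j \<noteq> Suc i mod n \<Longrightarrow> 12/5 \<le> crs i (vs ! j)"
  using good_polygon unfolding good_polygon_def by blast

lemma side_len: "i < n \<Longrightarrow> dist (vs ! i) (succ_vertex vs i) = 2"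
  using good_polygon unfolding good_polygon_def by blast

lemma sep: "i < n \<Longrightarrow> j < n \<Longrightarrow> i \<noteq> j \<Longrightarrow> 2 \<le> dist (vs ! i) (vs ! j)"
  "i < n \<Longrightarrow> j < n \<Longrightarrow> dist (vs ! i) (vs ! j) = 2 \<Longrightarrow> j = Suc i mod n \<or> i = Suc j mod n"
  using good_polygon unfolding good_polygon_def by (blast, metis dist_self zero_neq_numeral)

text \<open>Since unit centres are at least 2 apart, a tile whose vertices are unit centres contains
  no further one.\<close>

lemma near: "\<forall>x\<in>P. x \<in> set vs \<or> (\<exists>v\<in>set vs. dist x v < 2)"
  using good_polygon unfolding good_polygon_def by (elim conjE)

text \<open>The inner ball keeps nonoverlapping tiles apart and the outer ball bounds them; families
  of tiles become locally finite.\<close>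

lemma centre: "\<exists>c. ball c (1/2) \<subseteq> P \<and> P \<subseteq> cball c 3"
  using good_polygon unfolding good_polygon_def by (elim conjE)

lemma nth_inj: "i < n \<Longrightarrow> j < n \<Longrightarrow> vs ! i = vs ! j \<Longrightarrow> i = j"
  using sep(1)[of i j] by force

lemma crs_vertex: "i < n \<Longrightarrow> j < n \<Longrightarrow> 0 \<le> crs i (vs ! j)"
  using far[of i j] by (cases "j = i \<or> j = Suc i mod n") (auto simp: succ_vertex_def)

lemma crs_nonneg: "i < n \<Longrightarrow> x \<in> P \<Longrightarrow> 0 \<le> crs i x"
proof -
  assume i: "i < n" and x: "x \<in> P"
  have "P \<subseteq> {x. 0 \<le> crs i x}"
    by (rule hull_minimal) (use i crs_vertex convex_cr in \<open>auto simp: in_set_conv_nth\<close>)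
  then show ?thesis using x by auto
qed

lemma mem_iff: "x \<in> P \<longleftrightarrow> (\<forall>i<n. 0 \<le> crs i x)"
proof -
  have "\<forall>x. (\<forall>i<n. 0 \<le> crs i x) \<longrightarrow> x \<in> P"
    using good_polygon unfolding good_polygon_def by (elim conjE)
  then show ?thesis using crs_nonneg by blast
qed

lemma nx_mem: "i < n \<Longrightarrow> succ_vertex vs i \<in> set vs"
  unfolding succ_vertex_def using n3 by (intro nth_mem mod_less_divisor) auto

lemma vs_mem: "i < n \<Longrightarrow> vs ! i \<in> P" "i < n \<Longrightarrow> succ_vertex vs i \<in> P"
  using nx_mem by (auto intro!: hull_inc)

lemma interior_eq: "interior P = {x. \<forall>i<n. 0 < crs i x}"
proof
  show "interior P \<subseteq> {x. \<forall>i<n. 0 < crs i x}"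
  proof (safe)
    fix x i assume x: "x \<in> interior P" and i: "i < n"
    let ?N = "\<i> * (succ_vertex vs i - vs ! i)"
    have N: "?N \<noteq> 0" using side_len[OF i] by auto
    have "P \<subseteq> {x. ?N \<bullet> x \<ge> ?N \<bullet> (vs ! i)}"
      using crs_nonneg[OF i] unfolding cr_inner by auto
    then have "interior P \<subseteq> interior {x. ?N \<bullet> x \<ge> ?N \<bullet> (vs ! i)}" by (rule interior_mono)
    also have "\<dots> = {x. ?N \<bullet> x > ?N \<bullet> (vs ! i)}" using interior_halfspace_ge[OF N] .
    finally show "0 < crs i x" using x unfolding cr_inner by auto
  qed
  have "{x. \<forall>i<n. 0 < crs i x} = (\<Inter>i\<in>{..<n}. {x. 0 < crs i x})" by auto
  then have "open {x. \<forall>i<n. 0 < crs i x}" using open_cr by auto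
  then show "{x. \<forall>i<n. 0 < crs i x} \<subseteq> interior P"
    by (intro interior_maximal) (auto simp: mem_iff less_imp_le)
qed

text \<open>The lines of the two adjacent sides cut the line of side \<open>i\<close> at its end
  points; their half planes bound the parameter \<open>t\<close> by 1 and by 0.\<close>

lemma on_side:
  assumes "i < n" "x \<in> P" "crs i x = 0"
  shows "x \<in> closed_segment (vs ! i) (succ_vertex vs i)"
proof -
  have "vs ! i \<noteq> succ_vertex vs i" using side_len[OF assms(1)] by auto
  then obtain t where x: "x = (1 - t) *\<^sub>R (vs ! i) + t *\<^sub>R succ_vertex vs i"
    using cr_zero_line[OF assms(3)] by blast
  note s = suc_mod[OF assms(1) n3]
  have "12/5 \<le> crs (Suc i mod n) (vs ! i)" using s assms(1) by (intro far) auto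
  moreover have "crs (Suc i mod n) x = (1 - t) * crs (Suc i mod n) (vs ! i)"
    unfolding x cr_affine by (simp add: succ_vertex_def)
  moreover have "0 \<le> crs (Suc i mod n) x" using crs_nonneg[OF s(1) assms(2)] .
  ultimately have t1: "t \<le> 1" by (simp add: zero_le_mult_iff)
  obtain j where j: "j < n" "Suc j mod n = i" using pred_mod[OF assms(1)] .
  have ji: "succ_vertex vs j = vs ! i" unfolding succ_vertex_def j(2) ..
  have "12/5 \<le> crs j (succ_vertex vs i)" unfolding succ_vertex_def[of vs i]
    using suc_mod[OF j(1) n3] j s by (intro far) auto
  moreover have "crs j x = t * crs j (succ_vertex vs i)"
    unfolding x cr_affine ji by simp
  moreover have "0 \<le> crs j x" using crs_nonneg[OF j(1) assms(2)] .
  ultimately have "0 \<le> t" by (simp add: zero_le_mult_iff)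
  then show ?thesis using t1 x unfolding closed_segment_def by auto
qed

lemma seg_eq: "i < n \<Longrightarrow> closed_segment (vs ! i) (succ_vertex vs i) = P \<inter> {x. crs i x = 0}"
proof -
  assume i: "i < n"
  have "closed_segment (vs ! i) (succ_vertex vs i) \<subseteq> P"
    using vs_mem[OF i] by (intro closed_segment_subset) auto
  moreover have "crs i x = 0" if "x \<in> closed_segment (vs ! i) (succ_vertex vs i)" for x
    using that by (rule closed_segmentE) (simp add: cr_affine)
  ultimately show ?thesis using on_side[OF i] by auto
qed

lemma seg_face: "i < n \<Longrightarrow> closed_segment (vs ! i) (succ_vertex vs i) face_of P"
proof -
  assume i: "i < n"
  let ?N = "\<i> * (succ_vertex vs i - vs ! i)"
  have "P \<inter> {x. ?N \<bullet> x = ?N \<bullet> (vs ! i)} face_of P"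
    using crs_nonneg[OF i] unfolding cr_inner
    by (intro face_of_Int_supporting_hyperplane_ge) (auto simp: convex_convex_hull)
  then show ?thesis unfolding seg_eq[OF i] cr_inner by auto
qed

lemma seg_edge: "i < n \<Longrightarrow> closed_segment (vs ! i) (succ_vertex vs i) edge_of P"
  using seg_face side_len[of i] unfolding edge_of_def
  by (auto simp: segment_convex_hull aff_dim_convex_hull aff_dim_2)

lemma ext_eq: "v extreme_point_of P \<longleftrightarrow> v \<in> set vs"
proof
  assume "v extreme_point_of P"
  then show "v \<in> set vs" using extreme_point_of_convex_hull by blast
next
  assume "v \<in> set vs"
  then obtain i where i: "i < n" "v = vs ! i" by (auto simp: in_set_conv_nth)
  have "v extreme_point_of closed_segment (vs ! i) (succ_vertex vs i)"
    using i by (simp add: extreme_point_of_segment)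
  then show "v extreme_point_of P" using extreme_point_of_face[OF seg_face[OF i(1)]] by auto
qed

text \<open>Distance 2 occurs only between consecutive vertices; the direction is decided by the
  vertex that follows both.\<close>

lemma side_iff: "side P a b \<longleftrightarrow> (\<exists>i<n. a = vs ! i \<and> b = succ_vertex vs i)"
proof
  assume "\<exists>i<n. a = vs ! i \<and> b = succ_vertex vs i"
  then show "side P a b" unfolding side_def ext_eq using side_len crs_nonneg nx_mem by auto
next
  assume s: "side P a b"
  then obtain i j where ij: "i < n" "j < n" "a = vs ! i" "b = vs ! j"
    unfolding side_def ext_eq by (auto simp: in_set_conv_nth)
  have d: "dist (vs ! i) (vs ! j) = 2" using s ij unfolding side_def by auto
  have False if "i = Suc j mod n"
  proof -
    let ?k = "Suc i mod n"
    have k: "?k < n" "?k \<noteq> j" "?k \<noteq> i"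
      using suc_mod[OF ij(1) n3] suc_mod[OF ij(2) n3] that by auto
    have "12/5 \<le> crs j (vs ! ?k)" using far k ij that by blast
    moreover have "0 \<le> cross a b (vs ! ?k)" using s vs_mem(1)[OF k(1)] unfolding side_def by auto
    moreover have "crs j (vs ! ?k) = - cross a b (vs ! ?k)"
      unfolding succ_vertex_def that[symmetric] ij(3,4) by (rule cr_swap(1))
    ultimately show False by linarith
  qed
  then show "\<exists>i<n. a = vs ! i \<and> b = succ_vertex vs i" using sep(2)[OF ij(1,2) d] ij unfolding succ_vertex_def by auto
qed

lemma frontier_eq: "x \<in> frontier P \<longleftrightarrow> (\<exists>i<n. x \<in> closed_segment (vs ! i) (succ_vertex vs i))"
proof -
  have "closed P" by (simp add: compact_imp_closed compact_convex_hull finite_imp_compact)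
  then have "frontier P = P - interior P" by (simp add: frontier_def)
  moreover have "x \<in> P - interior P \<longleftrightarrow> (\<exists>i<n. x \<in> P \<and> crs i x = 0)"
    unfolding interior_eq using crs_nonneg by fastforce
  ultimately show ?thesis using seg_eq by blast
qed

text \<open>At least one end of side \<open>i\<close> is 6/5 or more away from the line of side
  \<open>j\<close>, and an inner point gives that end a positive weight.\<close>

lemma crs_strict:
  assumes i: "i < n" and j: "j < n" and ne: "j \<noteq> i" and x: "x \<in> open_segment (vs ! i) (succ_vertex vs i)"
  shows "0 < crs j x"
proof -
  obtain t where t: "0 < t" "t < 1" "x = (1 - t) *\<^sub>R (vs ! i) + t *\<^sub>R succ_vertex vs i"
    using x by (auto simp: in_segment)
  have nn: "0 \<le> crs j (vs ! i)" "0 \<le> crs j (succ_vertex vs i)" using crs_nonneg j i vs_mem by auto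
  have "0 < crs j (vs ! i) \<or> 0 < crs j (succ_vertex vs i)"
  proof (cases "i = Suc j mod n")
    case True
    have "Suc i mod n \<noteq> j" using suc_mod(3)[OF j n3] True by simp
    moreover have "Suc i mod n \<noteq> Suc j mod n" using True suc_mod(2)[OF i n3] by simp
    ultimately have "12/5 \<le> crs j (vs ! (Suc i mod n))" using suc_mod(1)[OF i n3] j by (intro far) auto
    then show ?thesis unfolding succ_vertex_def[of vs i] by linarith
  next
    case False
    then have "12/5 \<le> crs j (vs ! i)" using ne i j by (intro far) auto
    then show ?thesis by linarith
  qed
  then show ?thesis unfolding t(3) cr_affine using nn t(1,2)
    by (metis add_nonneg_pos add_pos_nonneg diff_gt_0_iff_gt less_imp_le mult_nonneg_nonneg mult_pos_pos)
qed

end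

section \<open>Tiles without vertex lists\<close>

lemma tile_props:
  assumes "tile t"
  shows tile_compact: "compact t" and tile_closed: "closed t" and tile_convex: "convex t"
    and tile_ext_finite: "finite {v. v extreme_point_of t}"
    and tile_mem_iff: "\<And>x. x \<in> t \<longleftrightarrow> (\<forall>a b. side t a b \<longrightarrow> 0 \<le> cross a b x)"
    and tile_interior_iff: "\<And>x. x \<in> interior t \<longleftrightarrow> (\<forall>a b. side t a b \<longrightarrow> 0 < cross a b x)"
    and tile_frontier_iff: "\<And>x. x \<in> frontier t \<longleftrightarrow> (\<exists>a b. side t a b \<and> x \<in> closed_segment a b)"
    and tile_hull: "t = convex hull {v. v extreme_point_of t}"
    and tile_near: "\<And>x. x \<in> t \<Longrightarrow> x extreme_point_of t \<or> (\<exists>v. v extreme_point_of t \<and> dist x v < 2)"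
    and tile_centre: "\<exists>c. ball c (1/2) \<subseteq> t \<and> t \<subseteq> cball c 3"
    and tile_sep: "\<And>v w. v extreme_point_of t \<Longrightarrow> w extreme_point_of t \<Longrightarrow> v \<noteq> w \<Longrightarrow> 2 \<le> dist v w"
    and tile_adj: "\<And>v w. v extreme_point_of t \<Longrightarrow> w extreme_point_of t \<Longrightarrow> dist v w = 2 \<Longrightarrow> side t v w \<or> side t w v"
    and tile_side_out: "\<And>v. v extreme_point_of t \<Longrightarrow> \<exists>b. side t v b"
    and tile_side_in: "\<And>v. v extreme_point_of t \<Longrightarrow> \<exists>a. side t a v"
proof -
  obtain vs where g: "good_polygon vs" and t: "t = convex hull set vs" using assms unfolding tile_def by blast
  show "compact t" unfolding t by (simp add: compact_convex_hull finite_imp_compact)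
  then show "closed t" by (rule compact_imp_closed)
  show "convex t" unfolding t by (rule convex_convex_hull)
  show "finite {v. v extreme_point_of t}" unfolding t ext_eq[OF g] by simp
  show "t = convex hull {v. v extreme_point_of t}" unfolding t ext_eq[OF g] by simp
  show "x \<in> t \<longleftrightarrow> (\<forall>a b. side t a b \<longrightarrow> 0 \<le> cross a b x)" for x
    unfolding t side_iff[OF g] mem_iff[OF g] by auto
  show "x \<in> interior t \<longleftrightarrow> (\<forall>a b. side t a b \<longrightarrow> 0 < cross a b x)" for x
    unfolding t side_iff[OF g] interior_eq[OF g] by auto
  show "x \<in> frontier t \<longleftrightarrow> (\<exists>a b. side t a b \<and> x \<in> closed_segment a b)" for x
    unfolding t side_iff[OF g] frontier_eq[OF g] by auto
  show "x extreme_point_of t \<or> (\<exists>v. v extreme_point_of t \<and> dist x v < 2)" if "x \<in> t" for x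
    using that near[OF g] unfolding t ext_eq[OF g] by blast
  show "\<exists>c. ball c (1/2) \<subseteq> t \<and> t \<subseteq> cball c 3"
    unfolding t by (rule centre[OF g])
  show "2 \<le> dist v w" if "v extreme_point_of t" "w extreme_point_of t" "v \<noteq> w" for v w
    using that sep(1)[OF g] unfolding t ext_eq[OF g] by (metis in_set_conv_nth)
  show "side t v w \<or> side t w v" if vw: "v extreme_point_of t" "w extreme_point_of t" "dist v w = 2" for v w
  proof -
    obtain i j where "i < length vs" "v = vs ! i" "j < length vs" "w = vs ! j"
      using vw unfolding t ext_eq[OF g] by (auto simp: in_set_conv_nth)
    then show ?thesis using sep(2)[OF g, of i j] vw(3) unfolding t side_iff[OF g] succ_vertex_def by blast
  qed
  show "\<exists>b. side t v b" if "v extreme_point_of t" for v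
    using that unfolding t ext_eq[OF g] side_iff[OF g] by (auto simp: in_set_conv_nth)
  show "\<exists>a. side t a v" if v: "v extreme_point_of t" for v
  proof -
    obtain i where i: "i < length vs" "v = vs ! i"
      using v unfolding t ext_eq[OF g] by (auto simp: in_set_conv_nth)
    obtain j where "j < length vs" "Suc j mod length vs = i" using pred_mod[OF i(1)] .
    then show ?thesis using i unfolding t side_iff[OF g] succ_vertex_def by auto
  qed
qed

lemma tile_side_props:
  assumes "tile t" and s: "side t a b"
  shows side_on: "\<And>x. x \<in> t \<Longrightarrow> cross a b x = 0 \<Longrightarrow> x \<in> closed_segment a b"
    and side_edge: "closed_segment a b edge_of t"
    and side_strict: "\<And>c d x. side t c d \<Longrightarrow> (c, d) \<noteq> (a, b) \<Longrightarrow> x \<in> open_segment a b \<Longrightarrow> 0 < cross c d x"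
    and side_far: "\<And>v. v extreme_point_of t \<Longrightarrow> v \<noteq> a \<Longrightarrow> v \<noteq> b \<Longrightarrow> 12/5 \<le> cross a b v"
proof -
  obtain vs where g: "good_polygon vs" and t: "t = convex hull set vs" using assms unfolding tile_def by blast
  obtain i where i: "i < length vs" "a = vs ! i" "b = succ_vertex vs i"
    using s unfolding t side_iff[OF g] by blast
  show "x \<in> closed_segment a b" if "x \<in> t" "cross a b x = 0" for x
    using on_side[OF g i(1)] that t i by auto
  show "closed_segment a b edge_of t" using seg_edge[OF g i(1)] i t by auto
  show "0 < cross c d x" if "side t c d" "(c, d) \<noteq> (a, b)" "x \<in> open_segment a b" for c d x
    using that crs_strict[OF g i(1)] i unfolding t side_iff[OF g] by metis
  show "12/5 \<le> cross a b v" if "v extreme_point_of t" "v \<noteq> a" "v \<noteq> b" for v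
    using that far[OF g i(1)] i unfolding t ext_eq[OF g] succ_vertex_def by (metis in_set_conv_nth)
qed

lemma side_mem: "side t a b \<Longrightarrow> a \<in> t" "side t a b \<Longrightarrow> b \<in> t"
  unfolding side_def extreme_point_of_def by auto

lemma side_ext: "side t a b \<Longrightarrow> a extreme_point_of t" "side t a b \<Longrightarrow> b extreme_point_of t"
  unfolding side_def by auto

lemma side_dist: "side t a b \<Longrightarrow> dist a b = 2" unfolding side_def by auto

lemma side_cr: "side t a b \<Longrightarrow> x \<in> t \<Longrightarrow> 0 \<le> cross a b x" unfolding side_def by auto

lemma side_neq: "side t a b \<Longrightarrow> a \<noteq> b" unfolding side_def by auto

lemma tile_interior_nonempty: "tile t \<Longrightarrow> interior t \<noteq> {}"
proof -
  assume "tile t"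
  then obtain c where "ball c (1/2) \<subseteq> t" using tile_centre by blast
  then have "ball c (1/2) \<subseteq> interior t" by (intro interior_maximal) auto
  then show ?thesis by force
qed

lemma tile_closure_interior: "tile t \<Longrightarrow> closure (interior t) = t"
  using convex_closure_interior[OF tile_convex tile_interior_nonempty, of t] tile_closed[of t] closure_closed[of t]
  by metis

lemma tile_side_subset: "tile t \<Longrightarrow> side t a b \<Longrightarrow> closed_segment a b \<subseteq> t"
  by (meson closed_segment_subset side_mem tile_convex)

text \<open>\<open>edge_to_edge\<close> speaks of one-dimensional faces. Such a face lies in the
  frontier, so its midpoint is on some side; that side is a face too, hence contains both ends of
  the edge, and these, being extreme, are its own ends.\<close>

lemma edge_imp_side:
  assumes "tile t" "e edge_of t"
  obtains a b where "side t a b" "e = closed_segment a b"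
proof -
  have face: "e face_of t" and dim: "aff_dim e = 1" using assms(2) unfolding edge_of_def by auto
  have comp: "compact e" using face tile_compact[OF assms(1)] tile_convex[OF assms(1)]
    by (metis face_of_imp_compact)
  have conv: "convex e" using face by (rule face_of_imp_convex)
  have "collinear e" unfolding collinear_aff_dim using dim by simp
  moreover have "e \<noteq> {}" using dim by auto
  ultimately obtain a b where ab: "e = closed_segment a b"
    using compact_convex_collinear_segment[OF _ comp conv] by blast
  have ne: "a \<noteq> b" using dim unfolding ab by auto
  have ext: "a extreme_point_of t" "b extreme_point_of t"
    using extreme_point_of_face[OF face] unfolding ab by (auto simp: extreme_point_of_segment)
  have "aff_dim t = 2"
    using tile_interior_nonempty[OF assms(1)] aff_dim_nonempty_interior[of t] by simp
  then have "e \<noteq> t" using dim by auto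
  then have "e \<subseteq> rel_frontier t" by (rule face_of_subset_rel_frontier[OF face])
  also have "rel_frontier t = frontier t"
    using tile_interior_nonempty[OF assms(1)] by (rule rel_frontier_nonempty_interior)
  finally have "midpoint a b \<in> frontier t" unfolding ab by auto
  then obtain c d where cd: "side t c d" "midpoint a b \<in> closed_segment c d"
    using tile_frontier_iff[OF assms(1)] by blast
  have fcd: "closed_segment c d face_of t" using side_edge[OF assms(1) cd(1)] unfolding edge_of_def by auto
  have "midpoint a b \<in> open_segment a b" using ne by simp
  then have "a \<in> closed_segment c d" "b \<in> closed_segment c d"
    using fcd cd(2) ext unfolding face_of_def extreme_point_of_def by blast+
  then have "a extreme_point_of closed_segment c d" "b extreme_point_of closed_segment c d"
    using ext extreme_point_of_face[OF fcd] by auto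
  then have "a \<in> {c, d}" "b \<in> {c, d}" by (auto simp: extreme_point_of_segment)
  then have "closed_segment a b = closed_segment c d" using ne closed_segment_commute by auto
  then show thesis using that cd(1) ab by metis
qed

section \<open>The two prototiles\<close>

lemma nx_map: "i < length vs \<Longrightarrow> succ_vertex (map f vs) i = f (succ_vertex vs i)"
  unfolding succ_vertex_def by (subst nth_map) (auto intro!: mod_less_divisor)

lemma good_mv:
  assumes g: "good_polygon vs" and w: "norm w = 1"
  shows "good_polygon (map (motion a w) vs)"
proof -
  let ?f = "motion a w"
  let ?vs = "map ?f vs"
  have n: "length ?vs = length vs" by simp
  have hull: "convex hull set ?vs = ?f ` (convex hull set vs)" by (simp add: mv_hull)
  have succ_vertex: "succ_vertex ?vs i = ?f (succ_vertex vs i)" if "i < length vs" for i using nx_map[OF that] .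
  have 1: "3 \<le> length ?vs" using n3[OF g] by simp
  have 2: "\<forall>i<length ?vs. \<forall>j<length ?vs. j \<noteq> i \<longrightarrow> j \<noteq> Suc i mod length ?vs \<longrightarrow>
        12/5 \<le> cross (?vs ! i) (succ_vertex ?vs i) (?vs ! j)"
    using far[OF g] by (simp add: succ_vertex cr_mv[OF w])
  have 3: "\<forall>i<length ?vs. dist (?vs ! i) (succ_vertex ?vs i) = 2"
    using side_len[OF g] by (simp add: succ_vertex dist_mv[OF w])
  have 4: "\<forall>i<length ?vs. \<forall>j<length ?vs. i \<noteq> j \<longrightarrow> 2 \<le> dist (?vs ! i) (?vs ! j) \<and>
        (dist (?vs ! i) (?vs ! j) = 2 \<longrightarrow> j = Suc i mod length ?vs \<or> i = Suc j mod length ?vs)"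
    using sep[OF g] by (simp add: dist_mv[OF w])
  have 5: "\<forall>x. (\<forall>i<length ?vs. 0 \<le> cross (?vs ! i) (succ_vertex ?vs i) x) \<longrightarrow> x \<in> convex hull set ?vs"
  proof (intro allI impI)
    fix x assume x: "\<forall>i<length ?vs. 0 \<le> cross (?vs ! i) (succ_vertex ?vs i) x"
    obtain z where z: "x = ?f z" using mv_surj[OF w] by blast
    have "z \<in> convex hull set vs"
      unfolding mem_iff[OF g] using x by (simp add: z succ_vertex cr_mv[OF w])
    then show "x \<in> convex hull set ?vs" unfolding hull z by blast
  qed
  have 6: "\<forall>x\<in>convex hull set ?vs. x \<in> set ?vs \<or> (\<exists>v\<in>set ?vs. dist x v < 2)"
    unfolding hull using near[OF g] by (auto simp: dist_mv[OF w])
  obtain c where c: "ball c (1/2) \<subseteq> convex hull set vs" "convex hull set vs \<subseteq> cball c 3"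
    using centre[OF g] by blast
  have "x \<in> convex hull set ?vs" if "x \<in> ball (?f c) (1/2)" for x
  proof -
    obtain z where z: "x = ?f z" using mv_surj[OF w] by blast
    then have "z \<in> ball c (1/2)" using that by (simp add: dist_mv[OF w])
    then show ?thesis unfolding hull z using c by blast
  qed
  moreover have "convex hull set ?vs \<subseteq> cball (?f c) 3"
    unfolding hull using c(2) by (auto simp: dist_mv[OF w])
  ultimately have 7: "\<exists>c. ball c (1/2) \<subseteq> convex hull set ?vs \<and> convex hull set ?vs \<subseteq> cball c 3" by blast
  show ?thesis unfolding good_polygon_def using 1 2 3 4 5 6 7 by (intro conjI)
qed

text \<open>The distance to \<open>b\<close> is at most the mean of 2 and \<open>norm b\<close> with
  weights s and 1 - s; it can reach 2 only for s = 1, that is at \<open>a\<close>.\<close>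

lemma near_fan:
  assumes "0 \<le> s" "0 \<le> t" "s + t \<le> 1" "norm b < 2" "dist a b \<le> (2::real)"
  shows "s *\<^sub>R a + t *\<^sub>R b = a \<or> dist (s *\<^sub>R a + t *\<^sub>R b) b < 2"
proof (cases "s = 1")
  case True
  then have "t = 0" using assms by simp
  then show ?thesis using True by simp
next
  case False
  then have s: "s < 1" using assms by simp
  have "s *\<^sub>R a + t *\<^sub>R b - b = s *\<^sub>R (a - b) + (1 - s - t) *\<^sub>R (- b)"
    by (simp add: algebra_simps)
  then have "dist (s *\<^sub>R a + t *\<^sub>R b) b \<le> norm (s *\<^sub>R (a - b)) + norm ((1 - s - t) *\<^sub>R (- b))"
    unfolding dist_norm by (metis norm_triangle_ineq)
  also have "\<dots> = s * dist a b + (1 - s - t) * norm b" using assms by (simp add: dist_norm)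
  also have "\<dots> \<le> s * 2 + (1 - s) * norm b"
    using assms by (intro add_mono mult_left_mono mult_right_mono) auto
  also have "\<dots> < s * 2 + (1 - s) * 2" using s assms by (intro add_strict_left_mono mult_strict_left_mono) auto
  finally show ?thesis by simp
qed

text \<open>Certificate by the fan of triangles from 0: the cones over the sides cover the plane,
  and the half plane of a side cuts its cone down to a triangle, so the intersection of the half
  planes is the hull. \<open>norms(2)\<close> provides each triangle with a vertex closer than 2 to
  the origin, as \<open>near_fan\<close> asks.\<close>

lemma fan_good:
  assumes n: "3 \<le> length vs"
    and far: "\<And>i j. i < length vs \<Longrightarrow> j < length vs \<Longrightarrow> j \<noteq> i \<Longrightarrow> j \<noteq> Suc i mod length vs \<Longrightarrow>
        12/5 \<le> cross (vs ! i) (succ_vertex vs i) (vs ! j)"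
    and sep: "\<And>i j. i < j \<Longrightarrow> j < length vs \<Longrightarrow> dist (vs ! i) (vs ! j) = 2 \<and> (j = Suc i \<or> (i = 0 \<and> Suc j = length vs))
        \<or> dist (vs ! i) (vs ! j) > 2 \<and> j \<noteq> Suc i \<and> \<not> (i = 0 \<and> Suc j = length vs)"
    and cones: "\<And>z. \<exists>i<length vs. \<exists>s t. 0 \<le> s \<and> 0 \<le> t \<and> z = s *\<^sub>R (vs ! i) + t *\<^sub>R succ_vertex vs i"
    and origin: "\<And>i. i < length vs \<Longrightarrow> 1 \<le> cross (vs ! i) (succ_vertex vs i) 0"
    and zero: "0 \<in> convex hull set vs"
    and norms: "\<And>i. i < length vs \<Longrightarrow> norm (vs ! i) \<le> 3" "\<And>i. i < length vs \<Longrightarrow> norm (vs ! i) < 2 \<or> norm (succ_vertex vs i) < 2"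
  shows "good_polygon vs"
proof -
  let ?n = "length vs" and ?P = "convex hull set vs"
  have nxi: "succ_vertex vs i \<in> set vs" if "i < ?n" for i
    unfolding succ_vertex_def using n by (intro nth_mem mod_less_divisor) auto
  have 3: "dist (vs ! i) (succ_vertex vs i) = 2" if i: "i < ?n" for i
  proof (cases "Suc i = ?n")
    case True
    then show ?thesis using sep[of 0 i] n unfolding succ_vertex_def by (auto simp: dist_commute)
  next
    case False
    then show ?thesis using sep[of i "Suc i"] i unfolding succ_vertex_def by auto
  qed
  have 4: "2 \<le> dist (vs ! i) (vs ! j) \<and>
        (dist (vs ! i) (vs ! j) = 2 \<longrightarrow> j = Suc i mod ?n \<or> i = Suc j mod ?n)" if ij: "i < ?n" "j < ?n" "i \<noteq> j" for i j
  proof -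
    have "2 \<le> dist (vs ! i) (vs ! j) \<and>
        (dist (vs ! i) (vs ! j) = 2 \<longrightarrow> j = Suc i mod ?n \<or> i = Suc j mod ?n)" if ij: "i < j" "j < ?n" for i j
      using sep[OF ij] ij by (auto simp: less_imp_le)
    from this[of i j] this[of j i] show ?thesis using ij by (cases i j rule: linorder_cases) (auto simp: dist_commute)
  qed
  have fan: "\<exists>i<?n. \<exists>s t. 0 \<le> s \<and> 0 \<le> t \<and> s + t \<le> 1 \<and> x = s *\<^sub>R (vs ! i) + t *\<^sub>R succ_vertex vs i"
    if x: "\<forall>i<?n. 0 \<le> cross (vs ! i) (succ_vertex vs i) x" for x
  proof -
    obtain i s t where i: "i < ?n" and st: "0 \<le> s" "0 \<le> t" "x = s *\<^sub>R (vs ! i) + t *\<^sub>R succ_vertex vs i"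
      using cones[of x] by blast
    \<comment> \<open>\<open>cross\<close> is affine and vanishes at both ends of the side, so only
      1 - s - t matters.\<close>
    have "cross (vs ! i) (succ_vertex vs i) x = (1 - s - t) * cross (vs ! i) (succ_vertex vs i) 0"
      unfolding st(3) cross_def by (simp add: algebra_simps)
    then have "0 \<le> (1 - s - t) * cross (vs ! i) (succ_vertex vs i) 0" using x i by metis
    then have "s + t \<le> 1" using origin[OF i] by (simp add: zero_le_mult_iff)
    then show ?thesis using i st by blast
  qed
  have 5: "x \<in> ?P" if x: "\<forall>i<?n. 0 \<le> cross (vs ! i) (succ_vertex vs i) x" for x
  proof -
    obtain i s t where i: "i < ?n" and st: "0 \<le> s" "0 \<le> t" "s + t \<le> 1" "x = s *\<^sub>R (vs ! i) + t *\<^sub>R succ_vertex vs i"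
      using fan[OF x] by blast
    have "\<exists>u v w. 0 \<le> u \<and> 0 \<le> v \<and> 0 \<le> w \<and> u + v + w = 1 \<and> x = u *\<^sub>R 0 + v *\<^sub>R (vs ! i) + w *\<^sub>R succ_vertex vs i"
      by (rule exI[of _ "1 - s - t"], rule exI[of _ s], rule exI[of _ t]) (use st in simp)
    then have "x \<in> convex hull {0, vs ! i, succ_vertex vs i}"
      unfolding convex_hull_3 by blast
    also have "\<dots> \<subseteq> ?P"
      using i nxi zero by (intro hull_minimal) (auto simp: convex_convex_hull intro!: hull_inc)
    finally show ?thesis .
  qed
  have crP: "0 \<le> cross (vs ! i) (succ_vertex vs i) x" if "i < ?n" "x \<in> ?P" for i x
  proof -
    have "0 \<le> cross (vs ! i) (succ_vertex vs i) (vs ! j)" if j: "j < ?n" for j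
      using far[OF \<open>i < ?n\<close> j] by (cases "j = i \<or> j = Suc i mod ?n") (auto simp: succ_vertex_def)
    then have "?P \<subseteq> {x. 0 \<le> cross (vs ! i) (succ_vertex vs i) x}"
      by (intro hull_minimal) (use convex_cr in \<open>auto simp: in_set_conv_nth\<close>)
    then show ?thesis using that by auto
  qed
  have 6: "x \<in> set vs \<or> (\<exists>v\<in>set vs. dist x v < 2)" if x: "x \<in> ?P" for x
  proof -
    obtain i s t where i: "i < ?n" and st: "0 \<le> s" "0 \<le> t" "s + t \<le> 1" "x = s *\<^sub>R (vs ! i) + t *\<^sub>R succ_vertex vs i"
      using fan crP x by blast
    show ?thesis
    proof (cases "norm (vs ! i) < 2")
      case True
      then have "x = succ_vertex vs i \<or> dist x (vs ! i) < 2"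
        using near_fan[of t s "vs ! i" "succ_vertex vs i"] st 3[OF i] by (simp add: dist_commute add.commute)
      then show ?thesis using i nxi by auto
    next
      case False
      then have "x = vs ! i \<or> dist x (succ_vertex vs i) < 2"
        using near_fan[of s t "succ_vertex vs i" "vs ! i"] st 3[OF i] norms(2)[OF i] by auto
      then show ?thesis using i nxi by auto
    qed
  qed
  have "x \<in> ?P" if x: "x \<in> ball 0 (1/2)" for x
  proof (rule 5, intro allI impI)
    fix i assume i: "i < ?n"
    \<comment> \<open>By \<open>origin\<close> the point 0 is at distance at least 1/2 from each
      side line; hence the radius 1/2.\<close>
    have "\<bar>cross (vs ! i) (succ_vertex vs i) x - cross (vs ! i) (succ_vertex vs i) 0\<bar> \<le> 2 * norm x"
      using cr_lipschitz[of "vs ! i" "succ_vertex vs i" x 0] 3[OF i] by simp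
    then show "0 \<le> cross (vs ! i) (succ_vertex vs i) x" using origin[OF i] x by simp
  qed
  moreover have "?P \<subseteq> cball 0 3"
    using norms by (intro hull_minimal) (auto simp: in_set_conv_nth)
  ultimately have 7: "\<exists>c. ball c (1/2) \<subseteq> ?P \<and> ?P \<subseteq> cball c 3" by blast
  show ?thesis unfolding good_polygon_def
    using n far 3 4 5 6 7 by (intro conjI) blast+
qed

lemma all_less_6: "(\<forall>i<(6::nat). Q i) \<longleftrightarrow> Q 0 \<and> Q 1 \<and> Q 2 \<and> Q 3 \<and> Q 4 \<and> Q 5"
  by (auto simp: eval_nat_numeral All_less_Suc)

lemma all_less_3: "(\<forall>i<(3::nat). Q i) \<longleftrightarrow> Q 0 \<and> Q 1 \<and> Q 2"
  by (auto simp: eval_nat_numeral All_less_Suc)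

lemma dist_2_iff: "dist x y = 2 \<longleftrightarrow> (Re x - Re y)^2 + (Im x - Im y)^2 = 4"
  "dist x y > 2 \<longleftrightarrow> (Re x - Re y)^2 + (Im x - Im y)^2 > 4"
proof -
  show "dist x y = 2 \<longleftrightarrow> (Re x - Re y)^2 + (Im x - Im y)^2 = 4" by (subst dist_eq_iff_sq) auto
  have "dist x y > 2 \<longleftrightarrow> (dist x y)^2 > 2^2"
    using power_strict_mono[of 2 "dist x y" 2] power_mono[of "dist x y" 2 2] by fastforce
  then show "dist x y > 2 \<longleftrightarrow> (Re x - Re y)^2 + (Im x - Im y)^2 > 4" by (simp add: dist_sq)
qed

definition triv :: "complex list" where
  "triv = [Complex (2 * sqrt 3 / 3) 0, Complex (- sqrt 3 / 3) 1, Complex (- sqrt 3 / 3) (- 1)]"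

lemma good_triv: "good_polygon triv"
proof (rule fan_good)
  have len: "length triv = 3" by (simp add: triv_def)
  have s3: "sqrt 3 * sqrt 3 = 3" by simp
  show "3 \<le> length triv" by (simp add: len)
  show "12/5 \<le> cross (triv ! i) (succ_vertex triv i) (triv ! j)"
    if "i < length triv" "j < length triv" "j \<noteq> i" "j \<noteq> Suc i mod length triv" for i j
  proof -
    have "\<forall>i<3. \<forall>j<3. j \<noteq> i \<longrightarrow> j \<noteq> Suc i mod 3 \<longrightarrow> cross (triv ! i) (succ_vertex triv i) (triv ! j) = 2 * sqrt 3"
      unfolding all_less_3 succ_vertex_def len by (simp add: triv_def cross_def)
    then have "cross (triv ! i) (succ_vertex triv i) (triv ! j) = 2 * sqrt 3" using that len by simp
    then show ?thesis using sqrt3_bounds by simp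
  qed
  show "dist (triv ! i) (triv ! j) = 2 \<and> (j = Suc i \<or> (i = 0 \<and> Suc j = length triv))
        \<or> dist (triv ! i) (triv ! j) > 2 \<and> j \<noteq> Suc i \<and> \<not> (i = 0 \<and> Suc j = length triv)"
    if "i < j" "j < length triv" for i j
  proof -
    have "\<forall>i<3. \<forall>j<3. i < j \<longrightarrow> dist (triv ! i) (triv ! j) = 2"
      unfolding all_less_3 dist_2_iff by (simp add: triv_def power2_eq_square)
    moreover have "\<forall>i<3. \<forall>j<3. i < j \<longrightarrow> j = Suc i \<or> i = (0::nat) \<and> Suc j = 3"
      unfolding all_less_3 by simp
    ultimately show ?thesis using that len by auto
  qed
  show "\<exists>i<length triv. \<exists>s t. 0 \<le> s \<and> 0 \<le> t \<and> z = s *\<^sub>R (triv ! i) + t *\<^sub>R succ_vertex triv i" for z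
  proof -
    have c0: "\<exists>s t. 0 \<le> s \<and> 0 \<le> t \<and> z = s *\<^sub>R (triv ! 0) + t *\<^sub>R succ_vertex triv 0"
      if "0 \<le> Im z" "0 \<le> sqrt 3 * Re z + Im z"
      by (rule exI[of _ "(sqrt 3 * Re z + Im z) / 2"], rule exI[of _ "Im z"])
        (use that s3 in \<open>simp add: complex_eq_iff triv_def succ_vertex_def field_simps\<close>)
    have c1: "\<exists>s t. 0 \<le> s \<and> 0 \<le> t \<and> z = s *\<^sub>R (triv ! 1) + t *\<^sub>R succ_vertex triv 1"
      if "sqrt 3 * Re z \<le> Im z" "sqrt 3 * Re z + Im z \<le> 0"
      by (rule exI[of _ "(Im z - sqrt 3 * Re z) / 2"], rule exI[of _ "- (sqrt 3 * Re z + Im z) / 2"])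
        (use that s3 in \<open>simp add: complex_eq_iff triv_def succ_vertex_def field_simps\<close>)
    have c2: "\<exists>s t. 0 \<le> s \<and> 0 \<le> t \<and> z = s *\<^sub>R (triv ! 2) + t *\<^sub>R succ_vertex triv 2"
      if "Im z \<le> 0" "Im z \<le> sqrt 3 * Re z"
      by (rule exI[of _ "- Im z"], rule exI[of _ "(sqrt 3 * Re z - Im z) / 2"])
        (use that s3 in \<open>simp add: complex_eq_iff triv_def succ_vertex_def field_simps\<close>)
    have "0 \<le> Im z \<and> 0 \<le> sqrt 3 * Re z + Im z \<or> sqrt 3 * Re z \<le> Im z \<and> sqrt 3 * Re z + Im z \<le> 0 \<or>
        Im z \<le> 0 \<and> Im z \<le> sqrt 3 * Re z" by linarith
    then show ?thesis
    proof (elim disjE conjE)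
      assume "0 \<le> Im z" "0 \<le> sqrt 3 * Re z + Im z" 
      then show ?thesis using c0 len by (intro exI[of _ 0]) simp
    next
      assume "sqrt 3 * Re z \<le> Im z" "sqrt 3 * Re z + Im z \<le> 0"
      then show ?thesis using c1 len by (intro exI[of _ 1]) simp
    next
      assume "Im z \<le> 0" "Im z \<le> sqrt 3 * Re z"
      then show ?thesis using c2 len by (intro exI[of _ 2]) simp
    qed
  qed
  show "1 \<le> cross (triv ! i) (succ_vertex triv i) 0" if "i < length triv" for i
  proof -
    have "\<forall>i<3. cross (triv ! i) (succ_vertex triv i) 0 = 2 * sqrt 3 / 3"
      unfolding all_less_3 succ_vertex_def len by (simp add: triv_def cross_def)
    then have "cross (triv ! i) (succ_vertex triv i) 0 = 2 * sqrt 3 / 3" using that[unfolded len] by blast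
    then show ?thesis using sqrt3_bounds by simp
  qed
  have "0 = (1/3) *\<^sub>R (triv ! 0) + (1/3) *\<^sub>R (triv ! 1) + (1/3) *\<^sub>R (triv ! 2)"
    by (simp add: complex_eq_iff triv_def)
  then have "0 \<in> convex hull {triv ! 0, triv ! 1, triv ! 2}"
    unfolding convex_hull_3 by (auto intro!: exI[of _ "1/3"])
  then show "0 \<in> convex hull set triv" by (simp add: triv_def)
  have nn: "\<forall>i<3. norm (triv ! i) < 2" unfolding all_less_3
    using dist_2_iff(2)[of _ 0] sqrt3_bounds by (simp add: triv_def cmod_def power2_eq_square real_less_lsqrt)
  then show "norm (triv ! i) \<le> 3" if "i < length triv" for i using that len by fastforce
  show "norm (triv ! i) < 2 \<or> norm (succ_vertex triv i) < 2" if "i < length triv" for i using that len nn by auto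
qed

context ratio begin

text \<open>The hexagon is centred at \<open>0\<close>: its vertices with interior angle \<open>2\<alpha>'\<close> lie at distance
  \<open>hq\<close>, the others at distance \<open>hm\<close>, and the centres of the three small discs at distance \<open>hs\<close>
  on the rays through the former.\<close>

definition hexv :: "complex list" where
  "hexv = [Complex hq 0, Complex (hm/2) (hm * sqrt 3/2), Complex (- hq/2) (hq * sqrt 3/2),
     Complex (- hm) 0, Complex (- hq/2) (- hq * sqrt 3/2), Complex (hm/2) (- hm * sqrt 3/2)]"

lemma length_hexv [simp]: "length hexv = 6" by (simp add: hexv_def)

text \<open>By symmetry only the values \<open>c1\<close> to \<open>c4\<close> of
  \<open>cross\<close> occur. The tightest is \<open>c1\<close>, with lower bound 0.866 * 2.17 *
  1.32, about 2.48; 12/5 is a round number below it.\<close>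

lemma good_hexv: "good_polygon hexv"
proof (rule fan_good)
  note qb = hq_bounds and mb = hm_bounds
  define k where "k = sqrt 3"
  have k: "1.732 < k" using sqrt3_bounds unfolding k_def by simp
  define c1 c2 c3 c4 where "c1 = k/2 * (hq * (2 * hm - hq))" "c2 = k/2 * (hm * (2 * hq - hm))"
    "c3 = k/2 * (hm * (hm + hq))" "c4 = k/2 * (hq * (hm + hq))"
  have p: "2.17 * 1.32 \<le> hq * (2 * hm - hq)" "1.75 * 2 \<le> hm * (2 * hq - hm)"
    "1.75 * 3 \<le> hm * (hm + hq)" "2.17 * 3 \<le> hq * (hm + hq)" "2.17 * 1.75 \<le> hq * hm"
    by ((rule mult_mono; use qb mb in simp)+)
  have m: "0.866 * A \<le> k/2 * B" if "A \<le> B" "0 \<le> A" for A B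
    by (rule mult_mono) (use that k in auto)
  have big: "0.866 * (2.17 * 1.32) \<le> c1" "0.866 * (1.75 * 2) \<le> c2" "0.866 * (1.75 * 3) \<le> c3"
    "0.866 * (2.17 * 3) \<le> c4" "0.866 * (2.17 * 1.75) \<le> k/2 * (hq * hm)"
    unfolding c1_c2_c3_c4_def using p by (intro m; simp)+
  show "3 \<le> length hexv" by simp
  show "12/5 \<le> cross (hexv ! i) (succ_vertex hexv i) (hexv ! j)"
    if "i < length hexv" "j < length hexv" "j \<noteq> i" "j \<noteq> Suc i mod length hexv" for i j
  proof -
    have "\<forall>i<6. \<forall>j<6. j \<noteq> i \<longrightarrow> j \<noteq> Suc i mod 6 \<longrightarrow> cross (hexv ! i) (succ_vertex hexv i) (hexv ! j) \<in> {c1, c2, c3, c4}"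
      unfolding all_less_6 succ_vertex_def c1_c2_c3_c4_def k_def by (simp add: hexv_def cross_def field_simps)
    then have "cross (hexv ! i) (succ_vertex hexv i) (hexv ! j) \<in> {c1, c2, c3, c4}" using that by simp
    then show ?thesis using big by auto
  qed
  show "dist (hexv ! i) (hexv ! j) = 2 \<and> (j = Suc i \<or> (i = 0 \<and> Suc j = length hexv))
        \<or> dist (hexv ! i) (hexv ! j) > 2 \<and> j \<noteq> Suc i \<and> \<not> (i = 0 \<and> Suc j = length hexv)"
    if "i < j" "j < length hexv" for i j
  proof -
    have sq: "4 < 3 * hq^2" "4 < 3 * hm^2" "4 < (hq + hm)^2"
      using mult_mono[of 2 hq 2 hq] mult_mono[of "1.5" hm "1.5" hm] mult_mono[of "2.1" "hq + hm" "2.1" "hq + hm"] qb mb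
      by (auto simp: power2_eq_square)
    have "\<forall>i<6. \<forall>j<6. i < j \<longrightarrow> (if j = Suc i \<or> i = 0 \<and> j = 5 then dist (hexv ! i) (hexv ! j) = 2 else dist (hexv ! i) (hexv ! j) > 2)"
      unfolding all_less_6 dist_2_iff
      using sq hq_hm
      by (simp add: hexv_def power2_eq_square field_simps)
    then have "if j = Suc i \<or> i = 0 \<and> j = 5 then dist (hexv ! i) (hexv ! j) = 2 else dist (hexv ! i) (hexv ! j) > 2"
      using that less_trans[OF that] unfolding length_hexv by blast
    then show ?thesis by (auto split: if_splits)
  qed
  show "\<exists>i<length hexv. \<exists>s t. 0 \<le> s \<and> 0 \<le> t \<and> z = s *\<^sub>R (hexv ! i) + t *\<^sub>R succ_vertex hexv i" for z
  proof -
    \<comment> \<open>In these coordinates the six rays through the vertices lie on y = 0, y = x and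
      y = - x, so \<open>sqrt 3\<close> drops out of the description of the cones.\<close>
    define x y where "x = Re z" and "y = Im z / sqrt 3"
    have z: "z = Complex x (y * sqrt 3)" unfolding x_def y_def by (simp add: complex_eq_iff)
    have pos: "hq > 0" "hm > 0" using qb mb by auto
    note ss = complex_eq_iff hexv_def succ_vertex_def field_simps z
    have c0: "\<exists>s t. 0 \<le> s \<and> 0 \<le> t \<and> z = s *\<^sub>R (hexv ! 0) + t *\<^sub>R succ_vertex hexv 0" if "0 \<le> y" "y \<le> x"
      by (rule exI[of _ "(x - y) / hq"], rule exI[of _ "2 * y / hm"]) (use that pos in \<open>simp add: ss\<close>)
    have c1: "\<exists>s t. 0 \<le> s \<and> 0 \<le> t \<and> z = s *\<^sub>R (hexv ! 1) + t *\<^sub>R succ_vertex hexv 1" if "x \<le> y" "- y \<le> x"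
      by (rule exI[of _ "(x + y) / hm"], rule exI[of _ "(y - x) / hq"]) (use that pos in \<open>simp add: ss\<close>)
    have c2: "\<exists>s t. 0 \<le> s \<and> 0 \<le> t \<and> z = s *\<^sub>R (hexv ! 2) + t *\<^sub>R succ_vertex hexv 2" if "x \<le> - y" "0 \<le> y"
      by (rule exI[of _ "2 * y / hq"], rule exI[of _ "(- x - y) / hm"]) (use that pos in \<open>simp add: ss\<close>)
    have c3: "\<exists>s t. 0 \<le> s \<and> 0 \<le> t \<and> z = s *\<^sub>R (hexv ! 3) + t *\<^sub>R succ_vertex hexv 3" if "x \<le> y" "y \<le> 0"
      by (rule exI[of _ "(y - x) / hm"], rule exI[of _ "- 2 * y / hq"]) (use that pos in \<open>simp add: ss\<close>)
    have c4: "\<exists>s t. 0 \<le> s \<and> 0 \<le> t \<and> z = s *\<^sub>R (hexv ! 4) + t *\<^sub>R succ_vertex hexv 4" if "y \<le> x" "x \<le> - y"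
      by (rule exI[of _ "- (x + y) / hq"], rule exI[of _ "(x - y) / hm"]) (use that pos in \<open>simp add: ss\<close>)
    have c5: "\<exists>s t. 0 \<le> s \<and> 0 \<le> t \<and> z = s *\<^sub>R (hexv ! 5) + t *\<^sub>R succ_vertex hexv 5" if "- y \<le> x" "y \<le> 0"
      by (rule exI[of _ "- 2 * y / hm"], rule exI[of _ "(x + y) / hq"]) (use that pos in \<open>simp add: ss\<close>)
    have ex6: "Q 0 \<or> Q 1 \<or> Q 2 \<or> Q 3 \<or> Q 4 \<or> Q 5 \<Longrightarrow> \<exists>i<length hexv. Q i" for Q
      using all_less_6[of "\<lambda>i. \<not> Q i"] by auto
    have "0 \<le> y \<and> y \<le> x \<or> x \<le> y \<and> - y \<le> x \<or> x \<le> - y \<and> 0 \<le> y \<or> x \<le> y \<and> y \<le> 0 \<or> y \<le> x \<and> x \<le> - y \<or> - y \<le> x \<and> y \<le> 0"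
      by linarith
    then show ?thesis using c0 c1 c2 c3 c4 c5 by (intro ex6) metis
  qed
  show "1 \<le> cross (hexv ! i) (succ_vertex hexv i) 0" if "i < length hexv" for i
  proof -
    have "\<forall>i<6. cross (hexv ! i) (succ_vertex hexv i) 0 = k/2 * (hq * hm)"
      unfolding all_less_6 succ_vertex_def k_def by (simp add: hexv_def cross_def field_simps)
    then have "cross (hexv ! i) (succ_vertex hexv i) 0 = k/2 * (hq * hm)" using that[unfolded length_hexv] by blast
    then show ?thesis using big(5) by (simp only:) simp
  qed
  have "0 = (1/3) *\<^sub>R (hexv ! 0) + (1/3) *\<^sub>R (hexv ! 2) + (1/3) *\<^sub>R (hexv ! 4)"
    by (simp add: complex_eq_iff hexv_def)
  then have "0 \<in> convex hull {hexv ! 0, hexv ! 2, hexv ! 4}"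
    unfolding convex_hull_3 by (auto intro!: exI[of _ "1/3"])
  moreover have "convex hull {hexv ! 0, hexv ! 2, hexv ! 4} \<subseteq> convex hull set hexv"
    by (intro hull_mono) (auto simp: hexv_def)
  ultimately show "0 \<in> convex hull set hexv" by blast
  have nn: "\<forall>i<6. norm (hexv ! i) = (if even i then hq else hm)" unfolding all_less_6
    using qb mb by (simp add: hexv_def cmod_def power_divide power_mult_distrib real_sqrt_divide)
  then show "norm (hexv ! i) \<le> 3" if "i < length hexv" for i using that qb mb by fastforce
  show "norm (hexv ! i) < 2 \<or> norm (succ_vertex hexv i) < 2" if "i < length hexv" for i
  proof -
    have "\<forall>i<6. norm (hexv ! i) < 2 \<or> norm (succ_vertex hexv i) < 2"
      using nn mb unfolding all_less_6 succ_vertex_def by simp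
    then show ?thesis using that by simp
  qed
qed

end

section \<open>Rigidity of the hexagon\<close>

text \<open>Once a motion is removed, the isometry \<open>g\<close> fixes 0 and 1. Distances to
  these fix the real part, and the imaginary part up to sign; the distance to the image of the
  imaginary unit makes the sign the same for all points.\<close>

lemma isometry_mv:
  fixes f :: "complex \<Rightarrow> complex"
  assumes f: "\<And>x y. dist (f x) (f y) = dist x y"
  obtains a w where "norm w = 1" "f = motion a w \<or> f = motion a w \<circ> cnj"
proof -
  define a w where "a = f 0" and "w = f 1 - f 0"
  have w: "norm w = 1" using f[of 1 0] by (simp add: w_def dist_norm)
  have ww: "w * cnj w = 1" using complex_norm_square[of w] w by simp
  define g where "g z = cnj w * (f z - a)" for z
  have fg: "f z = motion a w (g z)" for z
    using ww by (simp add: g_def motion_def flip: mult.assoc)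
  have g: "dist (g x) (g y) = dist x y" for x y
    using f[of x y] unfolding fg dist_mv[OF w] .
  have g0: "g 0 = 0" and g1: "g 1 = 1" using ww by (simp_all add: g_def a_def w_def mult.commute)
  have sq: "(Re (g z) - Re (g y))^2 + (Im (g z) - Im (g y))^2 = (Re z - Re y)^2 + (Im z - Im y)^2" for z y
    using arg_cong[OF g[of z y], of "\<lambda>t. t^2"] unfolding dist_sq .
  have re: "Re (g z) = Re z" and im2: "(Im (g z))^2 = (Im z)^2" for z
  proof -
    show "Re (g z) = Re z"
      using sq[of z 0] sq[of z 1] g0 g1 by (simp add: power2_eq_square algebra_simps)
    then show "(Im (g z))^2 = (Im z)^2" using sq[of z 0] g0 by simp
  qed
  have "Im (g \<i>) = 1 \<or> Im (g \<i>) = - 1" using im2[of \<i>] by (simp add: power2_eq_1_iff)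
  then have "g = (\<lambda>z. z) \<or> g = cnj"
  proof
    assume i: "Im (g \<i>) = 1"
    have "Im (g z) = Im z" for z
      using sq[of z \<i>] re im2[of z] i by (simp add: power2_eq_square algebra_simps)
    then have "g = (\<lambda>z. z)" using re by (auto simp: complex_eq_iff)
    then show ?thesis ..
  next
    assume i: "Im (g \<i>) = - 1"
    have "Im (g z) = - Im z" for z
      using sq[of z \<i>] re im2[of z] i by (simp add: power2_eq_square algebra_simps)
    then have "g = cnj" using re by (auto simp: complex_eq_iff)
    then show ?thesis ..
  qed
  then have "f = motion a w \<or> f = motion a w \<circ> cnj" using fg by (auto simp: fun_eq_iff)
  then show thesis using that w by blast
qed

lemma mv_comp: "motion a w (motion b v z) = motion (a + w * b) (w * v) z"
  by (simp add: motion_def algebra_simps)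

lemma good_convex_polygon:
  assumes "good_polygon vs"
  shows "convex_polygon vs (convex hull set vs)"
  unfolding convex_polygon_def
proof (intro conjI)
  show "distinct vs" using nth_inj[OF assms] by (metis distinct_conv_nth)
  show "{v. v extreme_point_of convex hull set vs} = set vs" using ext_eq[OF assms] by blast
  show "\<forall>i<length vs. closed_segment (vs ! i) (vs ! (Suc i mod length vs)) edge_of convex hull set vs"
    using seg_edge[OF assms] unfolding succ_vertex_def by blast
qed simp

text \<open>A segment joining the two sides of the line would cross it in a point of the face, and
  the face would then contain an end that is off the line. This supplies the orientation that
  \<open>convex_polygon\<close> does not mention.\<close>

lemma face_one_side:
  assumes f: "closed_segment a b face_of P" and P: "convex P" and xy: "x \<in> P" "y \<in> P" "0 < cross a b x" "cross a b y < 0"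
  shows False
proof -
  have ab: "a \<noteq> b" using xy by auto
  define t where "t = cross a b x / (cross a b x - cross a b y)"
  have t: "0 < t" "t < 1" using xy unfolding t_def by (simp_all add: field_simps)
  define z where "z = (1 - t) *\<^sub>R x + t *\<^sub>R y"
  have "cross a b z = 0" unfolding z_def cr_affine t_def using xy by (simp add: field_simps)
  then obtain u where "z = (1 - u) *\<^sub>R a + u *\<^sub>R b" using cr_zero_line ab by blast
  then have "z \<in> affine hull {a, b}" unfolding affine_hull_2 by (intro CollectI exI[of _ "1-u"] exI[of _ u]) simp
  then have aff: "z \<in> affine hull closed_segment a b" by (simp add: segment_convex_hull affine_hull_convex_hull)
  have zP: "z \<in> P" unfolding z_def using P xy t by (simp add: convex_alt)
  have "closed_segment a b = affine hull closed_segment a b \<inter> P" by (rule face_of_imp_eq_affine_Int[OF P f])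
  then have "z \<in> closed_segment a b" using aff zP by blast
  moreover have "x \<noteq> y" using xy by auto
  then have "z \<in> open_segment x y" unfolding z_def in_segment using t by blast
  ultimately have "x \<in> closed_segment a b" using f xy unfolding face_of_def by blast
  then have "cross a b x = 0" by (rule closed_segmentE) (simp add: cr_affine)
  then show False using xy by simp
qed

lemma polygon_turns:
  assumes P: "convex_polygon vs P" and i: "i < length vs" and n: "3 \<le> length vs"
    and x: "x \<in> set vs" and y: "y \<in> set vs" and "0 < cross (vs ! i) (succ_vertex vs i) x"
  shows "0 \<le> cross (vs ! i) (succ_vertex vs i) y"
proof -
  have "P = convex hull set vs" and "closed_segment (vs ! i) (succ_vertex vs i) face_of P"
    using P i unfolding convex_polygon_def edge_of_def succ_vertex_def by auto
  then show ?thesis using face_one_side[of "vs ! i" "succ_vertex vs i" P x y] x y assms(6) hull_inc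
    by (metis convex_convex_hull not_le)
qed

lemma inner_dist: "(dist x (y::complex))^2 = (dist x z)^2 + (dist y z)^2 - 2 * ((x - z) \<bullet> (y - z))"
  unfolding dist_sq inner_complex_def by (simp add: power2_eq_square algebra_simps)

text \<open>Lagrange's identity: lengths and inner product fix a turn up to its sign.\<close>

lemma cr_inner_sq: "(cross x y z)^2 = (dist x y)^2 * (dist z y)^2 - ((x - y) \<bullet> (z - y))^2"
  unfolding dist_sq inner_complex_def cross_def by (simp, algebra)

lemma mv_frame:
  assumes "dist x y = dist u v" "u \<noteq> v"
  obtains a w where "norm w = 1" "x = motion a w u" "y = motion a w v"
proof -
  define w where "w = (y - x) / (v - u)"
  have "norm w = 1" using assms unfolding w_def by (simp add: norm_divide dist_norm norm_minus_commute)
  moreover have "x = motion (x - w * u) w u" by (simp add: motion_def)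
  moreover have "w * (v - u) = y - x" using assms by (simp add: w_def)
  then have "y = motion (x - w * u) w v" unfolding motion_def by (simp add: algebra_simps)
  ultimately show thesis using that by blast
qed

text \<open>\<open>left_unique\<close> in moving coordinates: once two points are matched with the
  model, a third follows. Repetition of this identifies whole hexagons and coronas.\<close>

lemma mv_step:
  assumes w: "norm w = 1" and x: "x = motion a w u" and y: "y = motion a w v"
    and d: "dist z x = dist p u" "dist z y = dist p v" and c: "0 < cross x y z" "0 < cross u v p"
  shows "z = motion a w p"
  using left_unique[of x z "motion a w p" y] d c unfolding x y
  by (simp add: dist_mv[OF w] cr_mv[OF w] dist_commute)

section \<open>Angles of the hexagon\<close>

context ratio begin

lemma cos_alpha': "cos (alpha' r) = 1 / (1 + r)"
  and alpha'_bounds: "0 < alpha' r" "alpha' r < pi / 2"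
proof -
  have b: "- 1 < 1 / (1 + r)" "0 < 1 / (1 + r)" "1 / (1 + r) < 1" using r_gt by (auto simp: field_simps)
  show "cos (alpha' r) = 1 / (1 + r)" unfolding alpha'_def by (rule cos_arccos) (use b in linarith)+
  show "0 < alpha' r" unfolding alpha'_def using arccos_lt_bounded[OF b(1,3)] by simp
  show "alpha' r < pi / 2" unfolding alpha'_def using b arccos_less_arccos[of 0 "1 / (1 + r)"] by auto
qed

text \<open>\<open>gamma\<close> is the angle at a centre of radius \<open>r\<close> in the triangle of two small discs and a unit disc.\<close>

definition gamma :: real where "gamma = arccos (r / (1 + r))"

lemma cos_gam: "cos gamma = r / (1 + r)"
  and sin_gam: "sin gamma = sqrt (1 + 2 * r) / (1 + r)"
  and gam_bounds: "pi / 3 < gamma" "gamma < pi / 2"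
  and gam_7: "gamma < 7 * pi / 18"
proof -
  have b: "0.3525 < r / (1 + r)" "0 < r / (1 + r)" "r / (1 + r) < 1/2" using r_bounds by (auto simp: field_simps)
  have b': "- 1 \<le> r / (1 + r)" "r / (1 + r) \<le> 1" using r_gt by (simp_all add: field_simps)
  show c: "cos gamma = r / (1 + r)" unfolding gamma_def by (rule cos_arccos) (use b in linarith)+
  have "1 - (r / (1 + r))^2 = ((1 + r)^2 - r^2) / (1 + r)^2"
    using r_gt by (simp add: diff_divide_distrib power_divide)
  also have "(1 + r)^2 - r^2 = 1 + 2 * r" by (simp add: power2_eq_square algebra_simps)
  finally have "1 - (r / (1 + r))^2 = (1 + 2 * r) / (1 + r)^2" .
  then show "sin gamma = sqrt (1 + 2 * r) / (1 + r)"
    unfolding gamma_def sin_arccos[OF b'] using r_gt by (simp add: real_sqrt_divide)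
  have "arccos (1/2) < gamma" unfolding gamma_def using b b' by (intro arccos_less_arccos) auto
  moreover have "arccos (1/2) = pi / 3" using arccos_cos[of "pi / 3"] cos_60 by simp
  ultimately show g3: "pi / 3 < gamma" by simp
  show g2: "gamma < pi / 2" unfolding gamma_def using b arccos_less_arccos[of 0 "r / (1 + r)"] b' by simp
  \<comment> \<open>At 7 * pi / 18 the corona r, 1, r, 1, 1 would close, since its angles add up to
    3 * \<open>gamma\<close> + 5 * pi / 6; the bound is needed in \<open>corona_radii\<close>.
    Tripling the angle leads to the explicit cosine of 5 * pi / 6.\<close>
  show "gamma < 7 * pi / 18"
  proof (rule ccontr)
    assume "\<not> gamma < 7 * pi / 18"
    then have g: "7 * pi / 6 \<le> 3 * gamma" by simp
    have "cos (2 * pi - 3 * gamma) \<ge> cos (5 * pi / 6)"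
      using g g2 by (intro cos_monotone_0_pi_le) auto
    moreover have "cos (5 * pi / 6) = - sqrt 3 / 2"
      using cos_pi_minus[of "pi / 6"] cos_30 by (simp add: field_simps)
    moreover have "cos (2 * pi - 3 * gamma) = cos (3 * gamma)" by (simp add: cos_diff)
    moreover have "cos (3 * gamma) = 4 * cos gamma ^ 3 - 3 * cos gamma" by (rule cos_treble_cos)
    ultimately have le: "- sqrt 3 / 2 \<le> 4 * (r / (1 + r)) ^ 3 - 3 * (r / (1 + r))" using c by simp
    define c where "c = r / (1 + r)"
    have cb: "0.3525 < c" "c < 0.354" using b r_bounds unfolding c_def by (auto simp: field_simps)
    have "c * c \<le> 0.354 * 0.354" using cb by (intro mult_mono) auto
    then have "c * (3 - 4 * (c * c)) \<ge> 0.3525 * (3 - 4 * (0.354 * 0.354))" using cb by (intro mult_mono) auto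
    moreover have "4 * c ^ 3 - 3 * c = - (c * (3 - 4 * (c * c)))" by (simp add: algebra_simps power3_eq_cube)
    ultimately show False using le sqrt3_bounds unfolding c_def[symmetric] by simp
  qed
qed

lemma beta_gam: "beta r = pi - 2 * gamma" unfolding beta_def gamma_def ..

text \<open>The quartic in terms of angles: the corona r, r, 1, 1, 1 of a small disc closes up. Both
  sides lie between 0 and pi, so it suffices to compare cosines.\<close>

lemma alpha'_gam: "2 * alpha' r = pi / 6 + gamma"
proof -
  have r1: "1 + r \<noteq> 0" using r_gt by simp
  have "cos (pi / 6 + gamma) = sqrt 3 / 2 * (r / (1 + r)) - 1 / 2 * (sqrt (1 + 2 * r) / (1 + r))"
    unfolding cos_add cos_30 sin_30 cos_gam sin_gam ..
  also have "\<dots> = (sqrt 3 * r * (1 + r) - (1 + r) * sqrt (1 + 2 * r)) / (2 * (1 + r)^2)"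
    using r1 by (simp add: power2_eq_square diff_divide_distrib)
  also have "\<dots> = (4 - 2 * (1 + r)^2) / (2 * (1 + r)^2)"
    unfolding sqrt_relation by (simp add: algebra_simps power2_eq_square)
  also have "\<dots> = 2 * (1 / (1 + r))^2 - 1"
    using r1 by (simp add: diff_divide_distrib power_divide)
  also have "\<dots> = cos (2 * alpha' r)" unfolding cos_double_cos cos_alpha' ..
  finally have "cos (2 * alpha' r) = cos (pi / 6 + gamma)" ..
  then show ?thesis by (rule cos_inj_pi[rotated 4]) (use alpha'_bounds gam_bounds in linarith)+
qed

lemma cos_even: "cos (2 * alpha' r) = 2 / (1 + r)^2 - 1"
  unfolding cos_double_cos cos_alpha' by (simp add: power_divide)

text \<open>Two sides of length 2, symmetric about the ray through their common vertex at distance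
  \<open>hm\<close>, have inner product 2 * c^2 - 4, where c = \<open>hm - hq / 2\<close> is their
  inward component along it. After multiplication by (1 + r)^2 and elimination of the square root
  through \<open>R\<close>, the two sides of the equation differ by a multiple of the
  quartic.\<close>

lemma cos_odd: "4 * cos (2 * alpha' r + beta r) = 2 * (hm - hq / 2)^2 - 4"
proof -
  define R where "R = (1 + r) * sqrt (1 + 2 * r)"
  have r1: "1 + r \<noteq> 0" using r_gt by simp
  have R: "R = (2 + sqrt 3) * r^2 + (4 + sqrt 3) * r - 2" unfolding R_def by (rule sqrt_relation)
  have "sqrt (1 + 2 * r) ^ 2 = 1 + 2 * r" using r_gt by simp
  then have R2: "R^2 = (1 + r)^2 * (1 + 2 * r)" unfolding R_def by (simp add: power_mult_distrib)
  have sR: "sqrt (1 + 2 * r) = R / (1 + r)" using r1 unfolding R_def by simp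
  have "2 * alpha' r + beta r = pi + (pi / 6 - gamma)" unfolding alpha'_gam beta_gam by simp
  then have "cos (2 * alpha' r + beta r) = - cos (pi / 6 - gamma)" by (simp only: cos_periodic_pi2)
  also have "\<dots> = - (sqrt 3 / 2 * (r / (1 + r)) + 1 / 2 * (R / (1 + r) / (1 + r)))"
    unfolding cos_diff cos_30 sin_30 cos_gam sin_gam sR ..
  also have "\<dots> = - (sqrt 3 * r * (1 + r) + R) / (2 * (1 + r)^2)"
    using r1 by (simp add: power2_eq_square add_divide_distrib diff_divide_distrib)
  finally have lhs: "4 * cos (2 * alpha' r + beta r) * (1 + r)^2 = - (2 * sqrt 3 * r * (1 + r) + 2 * R)"
    using r1 by simp
  have "hm - hq / 2 = R / (1 + r) - (1 + r) / 2"
    unfolding hm_def hq_def sR by (simp add: add_divide_distrib)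
  then have "(hm - hq / 2) * (1 + r) = R - (1 + r)^2 / 2"
    using r1 by (simp add: field_simps power2_eq_square)
  then have "(hm - hq / 2)^2 * (1 + r)^2 = (R - (1 + r)^2 / 2)^2" by (simp only: power_mult_distrib[symmetric])
  also have "\<dots> = R^2 - R * (1 + r)^2 + (1 + r)^4 / 4"
    by (simp add: power2_diff power_divide)
  finally have "(hm - hq / 2)^2 * (1 + r)^2 = R^2 - R * (1 + r)^2 + (1 + r)^4 / 4" .
  then have rhs: "(2 * (hm - hq / 2)^2 - 4) * (1 + r)^2 =
      2 * ((1 + r)^2 * (1 + 2 * r)) - 2 * R * (1 + r)^2 + (1 + r)^4 / 2 - 4 * (1 + r)^2"
    unfolding R2 by (simp add: algebra_simps)
  have "2 * (2 * ((1 + r)^2 * (1 + 2 * r)) - 2 * R * (1 + r)^2 + (1 + r)^4 / 2 - 4 * (1 + r)^2 + (2 * sqrt 3 * r * (1 + r) + 2 * R)) = - quartic r"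
    unfolding R quartic_def by (simp add: field_simps eval_nat_numeral)
  then have "(2 * (hm - hq / 2)^2 - 4) * (1 + r)^2 = 4 * cos (2 * alpha' r + beta r) * (1 + r)^2"
    unfolding lhs rhs root by simp
  then show ?thesis using r1 by simp
qed

lemma angles_range: "0 < 2 * alpha' r" "2 * alpha' r < 2 * alpha' r + beta r" "2 * alpha' r + beta r < pi"
  using alpha'_gam gam_bounds unfolding beta_gam by auto

lemma hexv_inner:
  assumes "i < 6"
  shows "(hexv ! ((i + 5) mod 6) - hexv ! i) \<bullet> (succ_vertex hexv i - hexv ! i) =
    4 * cos (if even i then 2 * alpha' r else 2 * alpha' r + beta r)"
proof -
  have e: "2 * (hq - hm / 2)^2 - 4 = 4 * cos (2 * alpha' r)"
  proof -
    have "(hq - hm / 2) = 2 / (1 + r)" using hq_hm_lin r_gt by (simp add: field_simps)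
    then show ?thesis unfolding cos_even by (simp add: power_divide)
  qed
  have "\<forall>i<6. (hexv ! ((i + 5) mod 6) - hexv ! i) \<bullet> (succ_vertex hexv i - hexv ! i) =
    (if even i then 2 * (hq - hm / 2)^2 - (hq^2 + hm^2 - hq * hm) else 2 * (hm - hq / 2)^2 - (hq^2 + hm^2 - hq * hm))"
    unfolding all_less_6 succ_vertex_def
    by (simp add: hexv_def inner_complex_def power2_eq_square field_simps)
  then have "(hexv ! ((i + 5) mod 6) - hexv ! i) \<bullet> (succ_vertex hexv i - hexv ! i) =
    (if even i then 2 * (hq - hm / 2)^2 - 4 else 2 * (hm - hq / 2)^2 - 4)"
    using assms unfolding hq_hm by blast
  then show ?thesis using e cos_odd by (simp split: if_splits)
qed

lemma hexv_interior_angle: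
  assumes "i < 6"
  shows "interior_angle hexv i = (if even i then 2 * alpha' r else 2 * alpha' r + beta r)"
proof -
  let ?j = "(i + 5) mod 6"
  have "Suc ?j mod 6 = i" using assms by presburger
  then have j: "succ_vertex hexv ?j = hexv ! i" unfolding succ_vertex_def by simp
  have n1: "norm (hexv ! ?j - hexv ! i) = 2"
    using side_len[OF good_hexv, of ?j] unfolding j by (simp add: dist_norm)
  have n2: "norm (succ_vertex hexv i - hexv ! i) = 2"
    using side_len[OF good_hexv, of i] assms by (simp add: dist_norm norm_minus_commute)
  have k: "(i + length hexv - 1) mod length hexv = ?j" by (simp add: add.commute)
  have "interior_angle hexv i = arccos (cos (if even i then 2 * alpha' r else 2 * alpha' r + beta r))"
    using hexv_inner[OF assms] n1 n2 k unfolding interior_angle_def angle_def succ_vertex_def by simp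
  also have "\<dots> = (if even i then 2 * alpha' r else 2 * alpha' r + beta r)"
    using angles_range by (intro arccos_cos) auto
  finally show ?thesis .
qed

lemma hexagon_exists: "is_hexagon_P r (convex hull set hexv)"
  unfolding is_hexagon_P_def
  using good_convex_polygon[OF good_hexv] hexv_interior_angle side_len[OF good_hexv]
  by (intro exI[of _ hexv]) (simp add: side_length_def succ_vertex_def)

text \<open>Sides and angles determine the distances between vertices two steps apart, and the turns
  up to sign; convexity gives all turns the same sign. For left turns the list is matched with
  \<open>hexv\<close> vertex by vertex; a list with right turns is conjugated first.\<close>

lemma hexagon_rigid:
  assumes P: "convex_polygon vs P" and n: "length vs = 6"
    and len: "\<And>i. i < 6 \<Longrightarrow> dist (vs ! i) (succ_vertex vs i) = 2"
    and ang: "\<And>i. i < 6 \<Longrightarrow> interior_angle vs i = interior_angle hexv i"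
  shows "\<exists>a w. norm w = 1 \<and> P = motion a w ` (convex hull set hexv)"
proof -
  let ?p = "\<lambda>i. (i + 5) mod 6"
  have hP: "P = convex hull set vs" using P unfolding convex_polygon_def by blast
  have pn: "succ_vertex us (?p i) = us ! i" if "i < 6" "length us = 6" for us i
  proof -
    have "Suc (?p i) mod 6 = i" using that by presburger
    then show ?thesis using that unfolding succ_vertex_def by simp
  qed
  have hlen: "dist (hexv ! i) (succ_vertex hexv i) = 2" if "i < 6" for i using side_len[OF good_hexv] that by simp
  have val: "interior_angle us i = arccos ((us ! ?p i - us ! i) \<bullet> (succ_vertex us i - us ! i) / 4)"
    and bnd: "\<bar>(us ! ?p i - us ! i) \<bullet> (succ_vertex us i - us ! i) / 4\<bar> \<le> 1"
    if us: "length us = 6" "\<And>i. i < 6 \<Longrightarrow> dist (us ! i) (succ_vertex us i) = 2" and i: "i < 6" for us i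
  proof -
    have n1: "norm (us ! ?p i - us ! i) = 2"
      using us(2)[of "?p i"] pn[OF i us(1)] by (simp add: dist_norm)
    have n2: "norm (succ_vertex us i - us ! i) = 2" using us(2)[OF i] by (simp add: dist_norm norm_minus_commute)
    have k: "(i + length us - 1) mod length us = ?p i" using us by (simp add: add.commute)
    show "interior_angle us i = arccos ((us ! ?p i - us ! i) \<bullet> (succ_vertex us i - us ! i) / 4)"
      using n1 n2 k us(1) unfolding interior_angle_def angle_def succ_vertex_def by simp
    show "\<bar>(us ! ?p i - us ! i) \<bullet> (succ_vertex us i - us ! i) / 4\<bar> \<le> 1"
      using Cauchy_Schwarz_ineq2[of "us ! ?p i - us ! i" "succ_vertex us i - us ! i"] n1 n2 by simp
  qed
  have inn: "(vs ! ?p i - vs ! i) \<bullet> (succ_vertex vs i - vs ! i) = (hexv ! ?p i - hexv ! i) \<bullet> (succ_vertex hexv i - hexv ! i)" if i: "i < 6" for i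
    using val[OF n len i] val[OF length_hexv hlen i] bnd[OF n len i] bnd[OF length_hexv hlen i] ang[OF i]
    by (simp add: arccos_eq_iff)
  have skip: "dist (vs ! ?p i) (succ_vertex vs i) = dist (hexv ! ?p i) (succ_vertex hexv i)" if i: "i < 6" for i
  proof -
    have "dist (vs ! ?p i) (vs ! i) = 2" "dist (hexv ! ?p i) (hexv ! i) = 2"
      using len[of "?p i"] pn[OF i n] hlen[of "?p i"] pn[OF i length_hexv] by auto
    then have "(dist (vs ! ?p i) (succ_vertex vs i))^2 = (dist (hexv ! ?p i) (succ_vertex hexv i))^2"
      using inner_dist[of "vs ! ?p i" "succ_vertex vs i" "vs ! i"] inner_dist[of "hexv ! ?p i" "succ_vertex hexv i" "hexv ! i"]
        inn[OF i] len[OF i] hlen[OF i] by (simp add: dist_commute)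
    then show ?thesis by simp
  qed
  have turn_sq: "(cross (vs ! ?p i) (vs ! i) (succ_vertex vs i))^2 = (cross (hexv ! ?p i) (hexv ! i) (succ_vertex hexv i))^2" if i: "i < 6" for i
  proof -
    have "dist (vs ! ?p i) (vs ! i) = 2" "dist (hexv ! ?p i) (hexv ! i) = 2"
      using len[of "?p i"] pn[OF i n] hlen[of "?p i"] pn[OF i length_hexv] by auto
    then show ?thesis unfolding cr_inner_sq inn[OF i] using len[OF i] hlen[OF i] by (simp add: dist_commute)
  qed
  have hpos: "0 < cross (hexv ! ?p i) (hexv ! i) (succ_vertex hexv i)" if i: "i < 6" for i
  proof -
    have "i = 0 \<or> i = 1 \<or> i = 2 \<or> i = 3 \<or> i = 4 \<or> i = 5" using i by linarith
    then have ne: "Suc i mod 6 \<noteq> ?p i" "Suc i mod 6 \<noteq> Suc (?p i) mod 6" by (elim disjE; simp)+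
    then have "12/5 \<le> cross (hexv ! ?p i) (succ_vertex hexv (?p i)) (hexv ! (Suc i mod 6))"
      using far[OF good_hexv, of "?p i" "Suc i mod 6"] by simp
    then show ?thesis unfolding pn[OF i length_hexv] by (simp add: succ_vertex_def)
  qed
  have turn_nz: "cross (vs ! ?p i) (vs ! i) (succ_vertex vs i) \<noteq> 0" if i: "i < 6" for i
    using turn_sq[OF i] hpos[OF i] by auto
  \<comment> \<open>Consecutive turns have equal sign, since the vertices before and after a side
    lie on the same side of its line.\<close>
  have turn_next: "0 < cross (vs ! ?p (Suc i)) (vs ! (Suc i)) (succ_vertex vs (Suc i))"
    if i: "Suc i < 6" and c: "0 < cross (vs ! ?p i) (vs ! i) (succ_vertex vs i)" for i
  proof -
    have s: "succ_vertex vs i = vs ! Suc i" "?p (Suc i) = i" using i n by (auto simp: succ_vertex_def)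
    have "0 < cross (vs ! i) (succ_vertex vs i) (vs ! ?p i)" using c by (simp add: cr_rotate)
    then have "0 \<le> cross (vs ! i) (succ_vertex vs i) (succ_vertex vs (Suc i))"
      using i n by (intro polygon_turns[OF P, of i "vs ! ?p i"]) (auto simp: succ_vertex_def)
    then show ?thesis using turn_nz[OF i] s by simp
  qed
  have chain: "\<exists>a w. norm w = 1 \<and> us = map (motion a w) hexv"
    if us: "length us = 6" and l: "\<And>i. i < 6 \<Longrightarrow> dist (us ! i) (succ_vertex us i) = 2"
      and sk: "\<And>i. i < 6 \<Longrightarrow> dist (us ! ?p i) (succ_vertex us i) = dist (hexv ! ?p i) (succ_vertex hexv i)"
      and tn: "\<And>i. i < 6 \<Longrightarrow> 0 < cross (us ! ?p i) (us ! i) (succ_vertex us i)" for us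
  proof -
    have e: "succ_vertex us i = us ! Suc i" "succ_vertex hexv i = hexv ! Suc i" if "Suc i < 6" for i
      using that us by (auto simp: succ_vertex_def)
    have "dist (us ! 0) (us ! 1) = dist (hexv ! 0) (hexv ! 1)" "hexv ! 0 \<noteq> hexv ! 1"
      using l[of 0] hlen[of 0] e[of 0] by auto
    then obtain a w where w: "norm w = 1" and b: "us ! 0 = motion a w (hexv ! 0)" "us ! 1 = motion a w (hexv ! 1)"
      using mv_frame by metis
    have step: "us ! Suc (Suc i) = motion a w (hexv ! Suc (Suc i))"
      if "Suc (Suc i) < 6" "us ! i = motion a w (hexv ! i)" "us ! Suc i = motion a w (hexv ! Suc i)" for i
    proof -
      have p: "?p (Suc i) = i" using that by simp
      show ?thesis
        using that sk[of "Suc i"] tn[of "Suc i"] hpos[of "Suc i"] l[of "Suc i"] hlen[of "Suc i"] p e[of "Suc i"]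
        by (intro mv_step[OF w that(2,3)]) (auto simp: dist_commute)
    qed
    have "us ! i = motion a w (hexv ! i) \<and> (Suc i < 6 \<longrightarrow> us ! Suc i = motion a w (hexv ! Suc i))" if "i < 6" for i
      using that by (induction i) (use b step in auto)
    then have "us = map (motion a w) hexv" using us by (intro nth_equalityI) auto
    then show ?thesis using w by blast
  qed
  have all6: "Q 0 \<Longrightarrow> (\<And>i. Suc i < 6 \<Longrightarrow> Q i \<Longrightarrow> Q (Suc i)) \<Longrightarrow> i < 6 \<Longrightarrow> Q i" for Q and i :: nat
    by (induction i) auto
  show ?thesis
  proof (cases "0 < cross (vs ! ?p 0) (vs ! 0) (succ_vertex vs 0)")
    case True
    then have "0 < cross (vs ! ?p i) (vs ! i) (succ_vertex vs i)" if "i < 6" for i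
      by (rule all6[of "\<lambda>i. 0 < cross (vs ! ?p i) (vs ! i) (succ_vertex vs i)", OF _ turn_next that])
    then obtain a w where "norm w = 1" "vs = map (motion a w) hexv"
      using chain[OF n len skip] by blast
    then show ?thesis unfolding hP by (auto simp: mv_hull)
  next
    case False
    let ?us = "map cnj vs"
    have crc: "cross (cnj x) (cnj y) (cnj z) = - cross x y z" for x y z unfolding cross_def by (simp add: algebra_simps)
    have dc: "dist (cnj x) (cnj y) = dist x y" for x y
      by (metis complex_cnj_diff complex_mod_cnj dist_norm)
    have nxc: "succ_vertex ?us i = cnj (succ_vertex vs i)" if "i < 6" for i using nx_map[of i vs cnj] that n by simp
    have pc: "?us ! ?p i = cnj (vs ! ?p i)" "i < 6 \<Longrightarrow> ?us ! i = cnj (vs ! i)" for i using n by simp_all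
    have neg: "cross (vs ! ?p i) (vs ! i) (succ_vertex vs i) < 0" if "i < 6" for i
    proof (rule all6[of "\<lambda>i. cross (vs ! ?p i) (vs ! i) (succ_vertex vs i) < 0", OF _ _ that])
      have "cross (vs ! ?p 0) (vs ! 0) (succ_vertex vs 0) \<noteq> 0" by (rule turn_nz) simp
      then show "cross (vs ! ?p 0) (vs ! 0) (succ_vertex vs 0) < 0" using False by linarith
      show "cross (vs ! ?p (Suc i)) (vs ! Suc i) (succ_vertex vs (Suc i)) < 0"
        if i: "Suc i < 6" and c: "cross (vs ! ?p i) (vs ! i) (succ_vertex vs i) < 0" for i
      proof (rule ccontr)
        have s: "succ_vertex vs i = vs ! Suc i" "?p (Suc i) = i" using i n by (auto simp: succ_vertex_def)
        assume "\<not> cross (vs ! ?p (Suc i)) (vs ! Suc i) (succ_vertex vs (Suc i)) < 0"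
        then have "0 < cross (vs ! i) (succ_vertex vs i) (succ_vertex vs (Suc i))" using turn_nz[OF i] s by simp
        then have "0 \<le> cross (vs ! i) (succ_vertex vs i) (vs ! ?p i)"
          using i n by (intro polygon_turns[OF P, of i "succ_vertex vs (Suc i)"]) (auto simp: succ_vertex_def)
        then show False using c by (simp add: cr_rotate)
      qed
    qed
    have "\<exists>a w. norm w = 1 \<and> ?us = map (motion a w) hexv"
      using len skip neg by (intro chain) (simp_all add: n nxc pc dc crc del: nth_map)
    then obtain a w where w: "norm w = 1" and us: "?us = map (motion a w) hexv" by blast
    have "cnj (cnj x) = x" for x by simp
    then have "set vs = cnj ` set ?us" by (force simp: image_image)
    also have "\<dots> = motion (cnj a) (cnj w) ` cnj ` set hexv"
      unfolding us by (simp add: image_image motion_def)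
    \<comment> \<open>The model is symmetric about the real axis, so conjugating back again gives a
      moved copy of it.\<close>
    also have "cnj ` set hexv = set hexv" by (auto simp: hexv_def complex_cnj)
    finally have "P = motion (cnj a) (cnj w) ` (convex hull set hexv)" unfolding hP mv_hull by simp
    then show ?thesis using w by (metis complex_mod_cnj)
  qed
qed

end

section \<open>Congruent copies and inscribed trios\<close>

text \<open>Rotation by 2 * pi / 3, the symmetry of the hexagon that permutes its three small discs
  cyclically.\<close>

definition omega :: complex where "omega = Complex (- 1/2) (sqrt 3/2)"

lemma norm_om [simp]: "norm omega = 1"
  by (simp add: omega_def cmod_def power_divide)

lemma all_lt_3: "i < (3::nat) \<longleftrightarrow> i = 0 \<or> i = 1 \<or> i = 2" by auto

lemma all_lt_6: "i < (6::nat) \<longleftrightarrow> i = 0 \<or> i = 1 \<or> i = 2 \<or> i = 3 \<or> i = 4 \<or> i = 5" by auto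

text \<open>Differences of the squared distance equations are linear in x - y; with three points not
  on a line only the zero solution remains.\<close>

lemma dist3_unique:
  assumes "dist x a = dist y a" "dist x b = dist y b" "dist x c = dist y c" "cross a b c \<noteq> 0"
  shows "x = y"
proof -
  define u v where "u = Re x - Re y" and "v = Im x - Im y"
  have *: "(Re x - Re z)^2 + (Im x - Im z)^2 = (Re y - Re z)^2 + (Im y - Im z)^2" if "dist x z = dist y z" for z
    using arg_cong[OF that, of "\<lambda>t. t^2"] unfolding dist_sq .
  have 1: "u * (Re b - Re a) + v * (Im b - Im a) = 0"
    using *[OF assms(1)] *[OF assms(2)] unfolding u_def v_def by (simp add: power2_eq_square algebra_simps)
  have 2: "u * (Re c - Re a) + v * (Im c - Im a) = 0"
    using *[OF assms(1)] *[OF assms(3)] unfolding u_def v_def by (simp add: power2_eq_square algebra_simps)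
  have "u * cross a b c = 0" "v * cross a b c = 0" using 1 2 unfolding cross_def by algebra+
  then show ?thesis using assms(4) unfolding u_def v_def by (simp add: complex_eq_iff)
qed

lemma length_triv [simp]: "length triv = 3" by (simp add: triv_def)

lemma equilateral_frame:
  assumes d: "dist x y = 2" "dist y z = 2" "dist z x = 2" and c: "0 < cross x y z"
  obtains a w where "norm w = 1" "x = motion a w (triv ! 0)" "y = motion a w (triv ! 1)" "z = motion a w (triv ! 2)"
proof -
  have t: "dist (triv ! 0) (triv ! 1) = 2" "dist (triv ! 1) (triv ! 2) = 2" "dist (triv ! 2) (triv ! 0) = 2"
    using side_len[OF good_triv, of 0] side_len[OF good_triv, of 1] side_len[OF good_triv, of 2] by (simp_all add: succ_vertex_def numeral_2_eq_2)
  have "12/5 \<le> cross (triv ! 0) (triv ! 1) (triv ! 2)" using far[OF good_triv, of 0 2] by (simp add: succ_vertex_def)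
  then have tc: "0 < cross (triv ! 0) (triv ! 1) (triv ! 2)" by simp
  obtain a w where w: "norm w = 1" "x = motion a w (triv ! 0)" "y = motion a w (triv ! 1)"
    using mv_frame[of x y "triv ! 0" "triv ! 1"] d(1) t(1) by (metis dist_self zero_neq_numeral)
  have "z = motion a w (triv ! 2)"
    by (rule mv_step[OF w]) (use d t c tc in \<open>simp_all add: dist_commute\<close>)
  then show thesis using that w by blast
qed

definition triangle :: "complex \<Rightarrow> complex \<Rightarrow> complex set" where
  "triangle a w = motion a w ` (convex hull set triv)"

lemma tri_hull: "triangle a w = convex hull set (map (motion a w) triv)"
  unfolding triangle_def mv_hull by simp

lemma tile_tri: "norm w = 1 \<Longrightarrow> tile (triangle a w)"
  unfolding tile_def tri_hull using good_mv[OF good_triv] by blast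

lemma tri_equilateral: "norm w = 1 \<Longrightarrow> equilateral_triangle 2 (triangle a w)"
proof -
  assume w: "norm w = 1"
  note g = good_mv[OF good_triv w, of a]
  show ?thesis unfolding equilateral_triangle_def tri_hull
    using good_convex_polygon[OF g] side_len[OF g]
    by (intro exI[of _ "map (motion a w) triv"]) (simp add: side_length_def succ_vertex_def)
qed

lemma equilateral_nondegenerate:
  assumes d: "dist x y = 2" "dist y z = 2" "dist z x = 2"
  shows "cross x y z \<noteq> 0"
proof
  assume "cross x y z = 0"
  then have "((x - y) \<bullet> (z - y))^2 = 16"
    using cr_inner_sq[of x y z] d by (simp add: dist_commute)
  moreover have "(x - y) \<bullet> (z - y) = 2" using inner_dist[of x z y] d by (simp add: dist_commute)
  ultimately show False by simp
qed

lemma equilateral_hull: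
  assumes d: "dist x y = 2" "dist y z = 2" "dist z x = 2"
  shows "\<exists>a w. norm w = 1 \<and> convex hull {x, y, z} = triangle a w"
proof -
  have pos: "\<exists>a w. norm w = 1 \<and> convex hull {x, y, z} = triangle a w"
    if d: "dist x y = 2" "dist y z = 2" "dist z x = 2" and c: "0 < cross x y z" for x y z
  proof -
    obtain a w where w: "norm w = 1" and e: "x = motion a w (triv ! 0)" "y = motion a w (triv ! 1)" "z = motion a w (triv ! 2)"
      using equilateral_frame[OF d c] .
    have "{x, y, z} = motion a w ` set triv" unfolding e by (auto simp: triv_def)
    then show ?thesis using w unfolding triangle_def mv_hull by metis
  qed
  show ?thesis
  proof (cases "0 < cross x y z")
    case True
    then show ?thesis using pos d by blast
  next
    case False
    then have "0 < cross x z y" using equilateral_nondegenerate[OF d] cr_swap(2)[of x z y] by linarith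
    then show ?thesis using pos[of x z y] d by (simp add: dist_commute insert_commute)
  qed
qed

lemma equilateral_triangle_iff: "equilateral_triangle 2 t \<longleftrightarrow> (\<exists>a w. norm w = 1 \<and> t = triangle a w)"
proof
  assume "equilateral_triangle 2 t"
  then obtain vs where vs: "length vs = 3" "convex_polygon vs t" "\<forall>i<3. side_length vs i = 2"
    unfolding equilateral_triangle_def by blast
  have l: "vs = [vs ! 0, vs ! 1, vs ! 2]"
    using vs(1) by (auto intro!: nth_equalityI simp: all_lt_3 nth_Cons')
  have "dist (vs ! 0) (vs ! 1) = 2" "dist (vs ! 1) (vs ! 2) = 2" "dist (vs ! 2) (vs ! 0) = 2"
    using vs unfolding all_less_3 side_length_def by (simp_all add: numeral_2_eq_2)
  then obtain a w where "norm w = 1" "convex hull {vs ! 0, vs ! 1, vs ! 2} = triangle a w"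
    using equilateral_hull by blast
  moreover have "t = convex hull {vs ! 0, vs ! 1, vs ! 2}"
    using vs(2) l unfolding convex_polygon_def by (metis list.set(1) list.simps(15))
  ultimately show "\<exists>a w. norm w = 1 \<and> t = triangle a w" by blast
qed (use tri_equilateral in blast)

lemma angle_commute: "angle u v = angle v u"
  unfolding angle_def by (simp add: inner_commute mult.commute)

lemma angle_mv: "norm w = 1 \<Longrightarrow> angle (motion a w x - motion a w y) (motion a w z - motion a w y) = angle (x - y) (z - y)"
proof -
  assume w: "norm w = 1"
  have "(motion a w x - motion a w y) \<bullet> (motion a w z - motion a w y) = (x - y) \<bullet> (z - y)"
    using inner_dist[of "motion a w x" "motion a w z" "motion a w y"] inner_dist[of x z y] by (simp add: dist_mv[OF w])
  moreover have "norm (motion a w u - motion a w v) = norm (u - v)" for u v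
    using dist_mv[OF w, of a u v] by (simp add: dist_norm)
  ultimately show ?thesis unfolding angle_def by simp
qed

context ratio begin

definition sv :: "complex list" where
  "sv = [Complex hs 0, Complex (- hs/2) r, Complex (- hs/2) (- r)]"

definition hexagon :: "complex \<Rightarrow> complex \<Rightarrow> complex set" where
  "hexagon a w = motion a w ` (convex hull set hexv)"

definition trio :: "complex \<Rightarrow> complex \<Rightarrow> disc set" where
  "trio a w = (\<lambda>z. (motion a w z, r)) ` set sv"

lemma hx_hull: "hexagon a w = convex hull set (map (motion a w) hexv)"
  unfolding hexagon_def mv_hull by simp

lemma tile_hx: "norm w = 1 \<Longrightarrow> tile (hexagon a w)"
  unfolding tile_def hx_hull using good_mv[OF good_hexv] by blast

lemma sv_alt: "sv = [Complex hs 0, Complex (- hs/2) (hs * sqrt 3/2), Complex (- hs/2) (- (hs * sqrt 3/2))]"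
  unfolding sv_def hs_sqrt3 by simp

lemma mv_om_hexv: "i < 6 \<Longrightarrow> motion a (w * omega) (hexv ! i) = motion a w (hexv ! ((i + 2) mod 6))"
proof -
  have "\<forall>i<6. omega * hexv ! i = hexv ! ((i + 2) mod 6)"
    unfolding all_less_6 by (simp add: hexv_def omega_def complex_eq_iff field_simps)
  then show "i < 6 \<Longrightarrow> ?thesis" unfolding motion_def by (simp add: mult.assoc)
qed

lemma mv_om_sv: "i < 3 \<Longrightarrow> motion a (w * omega) (sv ! i) = motion a w (sv ! ((i + 1) mod 3))"
proof -
  have "\<forall>i<3. omega * sv ! i = sv ! ((i + 1) mod 3)"
    unfolding all_less_3 by (simp add: sv_alt omega_def complex_eq_iff field_simps)
  then show "i < 3 \<Longrightarrow> ?thesis" unfolding motion_def by (simp add: mult.assoc)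
qed

lemma set_hexv: "f ` set hexv = {f (hexv ! 0), f (hexv ! 1), f (hexv ! 2), f (hexv ! 3), f (hexv ! 4), f (hexv ! 5)}"
  by (simp add: hexv_def)

lemma set_sv: "f ` set sv = {f (sv ! 0), f (sv ! 1), f (sv ! 2)}"
  by (simp add: sv_def)

lemma hx_om: "hexagon a (w * omega) = hexagon a w"
proof -
  have m: "motion a (w * omega) (hexv ! 0) = motion a w (hexv ! 2)" "motion a (w * omega) (hexv ! 1) = motion a w (hexv ! 3)"
    "motion a (w * omega) (hexv ! 2) = motion a w (hexv ! 4)" "motion a (w * omega) (hexv ! 3) = motion a w (hexv ! 5)"
    "motion a (w * omega) (hexv ! 4) = motion a w (hexv ! 0)" "motion a (w * omega) (hexv ! 5) = motion a w (hexv ! 1)"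
    by (subst mv_om_hexv, simp, rule arg_cong[of _ _ "\<lambda>k. motion a w (hexv ! k)"], simp)+
  have "motion a (w * omega) ` set hexv = motion a w ` set hexv"
    unfolding set_hexv m by (intro equalityI insert_subsetI empty_subsetI) simp_all
  then show ?thesis unfolding hexagon_def mv_hull by simp
qed

lemma trio_om: "trio a (w * omega) = trio a w"
proof -
  have m: "motion a (w * omega) (sv ! 0) = motion a w (sv ! 1)" "motion a (w * omega) (sv ! 1) = motion a w (sv ! 2)"
    "motion a (w * omega) (sv ! 2) = motion a w (sv ! 0)"
    by (subst mv_om_sv; simp add: numeral_2_eq_2)+
  show ?thesis unfolding trio_def set_sv m by (intro equalityI insert_subsetI empty_subsetI) simp_all
qed

lemma hx_ext: "norm w = 1 \<Longrightarrow> v extreme_point_of hexagon a w \<longleftrightarrow> (\<exists>i<6. v = motion a w (hexv ! i))"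
  unfolding hx_hull ext_eq[OF good_mv[OF good_hexv]] by (auto simp: in_set_conv_nth image_iff) (metis length_hexv nth_mem)

lemma hx_side: "norm w = 1 \<Longrightarrow> side (hexagon a w) x y \<longleftrightarrow> (\<exists>i<6. x = motion a w (hexv ! i) \<and> y = motion a w (hexv ! (Suc i mod 6)))"
  unfolding hx_hull side_iff[OF good_mv[OF good_hexv]] by (auto simp: succ_vertex_def)

text \<open>After such a relabelling any chosen disc of a trio has index 0, and its unit neighbours
  have the indices 5, 0, 1.\<close>

lemma frame_shift:
  assumes w: "norm w = 1" and i: "i < (3::nat)"
  obtains w' where "norm w' = 1" "hexagon a w' = hexagon a w" "trio a w' = trio a w"
    "\<And>j. j < 6 \<Longrightarrow> motion a w' (hexv ! j) = motion a w (hexv ! ((j + 2 * i) mod 6))"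
    "\<And>j. j < 3 \<Longrightarrow> motion a w' (sv ! j) = motion a w (sv ! ((j + i) mod 3))"
  using i
proof (induction i arbitrary: thesis)
  case 0
  then show ?case using w by simp
next
  case (Suc i)
  obtain w' where w': "norm w' = 1" "hexagon a w' = hexagon a w" "trio a w' = trio a w"
    "\<And>j. j < 6 \<Longrightarrow> motion a w' (hexv ! j) = motion a w (hexv ! ((j + 2 * i) mod 6))"
    "\<And>j. j < 3 \<Longrightarrow> motion a w' (sv ! j) = motion a w (sv ! ((j + i) mod 3))"
    using Suc.IH Suc.prems by (metis Suc_lessD)
  show ?case
  proof (rule Suc.prems(1)[of "w' * omega"])
    show "norm (w' * omega) = 1" using w' by (simp add: norm_mult)
    show "hexagon a (w' * omega) = hexagon a w" "trio a (w' * omega) = trio a w" using w' hx_om trio_om by auto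
    show "motion a (w' * omega) (hexv ! j) = motion a w (hexv ! ((j + 2 * Suc i) mod 6))" if "j < 6" for j
    proof -
      have "((j + 2) mod 6 + 2 * i) mod 6 = (j + 2 * Suc i) mod 6" by (subst mod_add_left_eq) simp
      then show ?thesis using that by (simp only: mv_om_hexv) (simp add: w'(4))
    qed
    show "motion a (w' * omega) (sv ! j) = motion a w (sv ! ((j + Suc i) mod 3))" if "j < 3" for j
    proof -
      have "((j + 1) mod 3 + i) mod 3 = (j + Suc i) mod 3" by (subst mod_add_left_eq) simp
      then show ?thesis using that by (simp only: mv_om_sv) (simp add: w'(5))
    qed
  qed
qed

lemma sv_hexv_dist:
  "dist (sv ! 0) (hexv ! 0) = 1 + r" "dist (sv ! 0) (hexv ! 1) = 1 + r" "dist (sv ! 0) (hexv ! 5) = 1 + r"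
  "1 + r < dist (sv ! 0) (hexv ! 2)" "1 + r < dist (sv ! 0) (hexv ! 3)" "1 + r < dist (sv ! 0) (hexv ! 4)"
proof -
  have s: "(Re x - Re y)^2 + (Im x - Im y)^2 = (1+r)^2 \<Longrightarrow> dist x y = 1 + r" for x y
    using r_gt by (subst dist_eq_iff_sq) auto
  have g: "1 + r < dist x y" if "2 < \<bar>Re x - Re y\<bar>" for x y
  proof -
    have "\<bar>Re x - Re y\<bar> \<le> dist x y" using abs_Re_le_cmod[of "x - y"] by (simp add: dist_norm)
    then show ?thesis using that r_lt by linarith
  qed
  show "dist (sv ! 0) (hexv ! 0) = 1 + r"
    by (rule s) (use hq_hs in \<open>simp add: sv_def hexv_def power2_commute\<close>)
  show "dist (sv ! 0) (hexv ! 1) = 1 + r" "dist (sv ! 0) (hexv ! 5) = 1 + r"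
    by (rule s, simp only: hm_hs[symmetric], simp add: sv_def hexv_def power2_eq_square field_simps)+
  show "1 + r < dist (sv ! 0) (hexv ! 3)"
    by (rule g) (use hs_bounds hm_bounds in \<open>simp add: sv_def hexv_def\<close>)
  have "1 + r < dist (sv ! 0) (Complex (- hq / 2) y)" for y
  proof -
    have "1.7 \<le> \<bar>Re (sv ! 0) - Re (Complex (- hq / 2) y)\<bar>" using hs_bounds hq_bounds by (simp add: sv_def)
    also have "\<dots> \<le> dist (sv ! 0) (Complex (- hq / 2) y)"
      using abs_Re_le_cmod[of "sv ! 0 - Complex (- hq / 2) y"] by (simp add: dist_norm)
    finally show ?thesis using r_lt by linarith
  qed
  then show "1 + r < dist (sv ! 0) (hexv ! 2)" "1 + r < dist (sv ! 0) (hexv ! 4)" by (simp_all add: hexv_def)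
qed

lemma sv_dist: "dist (sv ! 0) (sv ! 1) = 2 * r" "dist (sv ! 0) (sv ! 2) = 2 * r" "dist (sv ! 1) (sv ! 2) = 2 * r"
  using r_gt hs_sq by (subst dist_eq_iff_sq; simp add: sv_def power2_eq_square field_simps)+

text \<open>The counterclockwise corona of \<open>sv ! 0\<close> is \<open>hexv ! 0\<close>,
  \<open>hexv ! 1\<close>, \<open>sv ! 1\<close>, \<open>sv ! 2\<close>,
  \<open>hexv ! 5\<close>.\<close>

lemma sv_cr:
  "0 < cross (sv ! 0) (hexv ! 0) (hexv ! 1)" "0 < cross (sv ! 0) (hexv ! 1) (sv ! 1)"
  "0 < cross (sv ! 0) (sv ! 1) (sv ! 2)" "0 < cross (sv ! 0) (sv ! 2) (hexv ! 5)"
  "0 < cross (sv ! 0) (hexv ! 5) (hexv ! 0)"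
proof -
  have p: "0 < hm * sqrt 3 / 2" "0 < hq - hs" "0 < r" "0 < hs" using hm_bounds hq_bounds hs_bounds r_gt by auto
  show "0 < cross (sv ! 0) (hexv ! 0) (hexv ! 1)" "0 < cross (sv ! 0) (hexv ! 5) (hexv ! 0)"
    using mult_pos_pos[OF p(2) p(1)] by (simp_all add: cross_def sv_def hexv_def mult.commute)
  show "0 < cross (sv ! 0) (sv ! 1) (sv ! 2)" using mult_pos_pos[OF p(3,4)] by (simp add: cross_def sv_def)
  have "0 < hs * sqrt 3 / 2 * (2 * hm - hs)" using p hm_bounds hs_bounds by (intro mult_pos_pos) auto
  then show "0 < cross (sv ! 0) (hexv ! 1) (sv ! 1)" "0 < cross (sv ! 0) (sv ! 2) (hexv ! 5)"
    by (simp_all add: cross_def sv_alt hexv_def field_simps)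
qed

text \<open>By symmetry three values of \<open>cross\<close> occur, each at least 2: the small
  centres are at distance at least 1, hence more than \<open>r\<close>, from all side lines.\<close>

lemma sv_interior: "k < 3 \<Longrightarrow> cball (sv ! k) r \<subseteq> interior (convex hull set hexv)"
proof -
  assume k: "k < 3"
  define A where "A = hm * (hq - hs)"
  define B where "B = hm * (hq + hs) - hq * hs"
  define C where "C = hm * hq + hq * hs"
  have "1.75 * 1.5 \<le> A" unfolding A_def using hm_bounds hq_bounds hs_bounds by (intro mult_mono) auto
  moreover have "1.75 * 2.7 \<le> hm * (hq + hs)" "hq * hs \<le> 2.18 * 0.632" "1.75 * 2.17 \<le> hm * hq" "2.17 * 0.629 \<le> hq * hs"
    using hm_bounds hq_bounds hs_bounds by (intro mult_mono; simp)+
  ultimately have ABC: "1.75 * 1.5 \<le> A" "1.75 * 1.5 \<le> B" "1.75 * 1.5 \<le> C" unfolding B_def C_def by simp_all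
  have "\<forall>k<3. \<forall>i<6. cross (hexv ! i) (succ_vertex hexv i) (sv ! k) \<in> {sqrt 3 / 2 * A, sqrt 3 / 2 * B, sqrt 3 / 2 * C}"
    unfolding all_less_6 all_less_3 succ_vertex_def A_def B_def C_def
    by (simp add: hexv_def sv_alt cross_def field_simps)
  then have mem: "cross (hexv ! i) (succ_vertex hexv i) (sv ! k) \<in> {sqrt 3 / 2 * A, sqrt 3 / 2 * B, sqrt 3 / 2 * C}" if "i < 6" for i
    using k that by blast
  have big: "2 \<le> sqrt 3 / 2 * X" if "1.75 * 1.5 \<le> X" for X
    using mult_mono[of "0.866" "sqrt 3 / 2" "1.75 * 1.5" X] sqrt3_bounds that by simp
  show ?thesis
  proof
    fix x assume x: "x \<in> cball (sv ! k) r"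
    have "0 < cross (hexv ! i) (succ_vertex hexv i) x" if i: "i < 6" for i
    proof -
      have "2 \<le> cross (hexv ! i) (succ_vertex hexv i) (sv ! k)" using mem[OF i] big[OF ABC(1)] big[OF ABC(2)] big[OF ABC(3)]
        unfolding insert_iff empty_iff by metis
      moreover have "\<bar>cross (hexv ! i) (succ_vertex hexv i) (sv ! k) - cross (hexv ! i) (succ_vertex hexv i) x\<bar> \<le> 2 * r"
        using cr_lipschitz[of "hexv ! i" "succ_vertex hexv i" "sv ! k" x] side_len[OF good_hexv, of i] i x
        by (simp add: order_trans[OF _ mult_left_mono])
      ultimately show ?thesis using r_lt by linarith
    qed
    then show "x \<in> interior (convex hull set hexv)" unfolding interior_eq[OF good_hexv] by simp
  qed
qed


lemma cnj_hx: "cnj ` hexagon b v = hexagon (cnj b) (cnj v)"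
proof -
  have "linear cnj" by (simp add: bounded_linear.linear bounded_linear_cnj)
  then have "cnj ` hexagon b v = convex hull (cnj ` motion b v ` set hexv)"
    unfolding hexagon_def mv_hull by (simp add: convex_hull_linear_image)
  also have "cnj ` motion b v ` set hexv = motion (cnj b) (cnj v) ` cnj ` set hexv"
    by (simp add: image_image motion_def)
  also have "cnj ` set hexv = set hexv" by (auto simp: hexv_def complex_cnj)
  finally show ?thesis unfolding hexagon_def mv_hull .
qed

lemma mv_hx: "motion a w ` hexagon b v = hexagon (a + w * b) (w * v)"
  unfolding hexagon_def image_image mv_comp ..

lemma hexagon_P_hx: "is_hexagon_P r P \<Longrightarrow> \<exists>b v. norm v = 1 \<and> P = hexagon b v"
  unfolding is_hexagon_P_def hexagon_def
  using hexagon_rigid hexv_interior_angle by (auto simp: side_length_def succ_vertex_def)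

text \<open>Isometries include reflections, but the mirror image of a moved hexagon is again one
  (\<open>cnj_hx\<close>), so motions give all copies.\<close>

lemma congruent_iff:
  assumes "is_hexagon_P r P"
  shows "congruent_to P t \<longleftrightarrow> (\<exists>a w. norm w = 1 \<and> t = hexagon a w)"
proof -
  obtain b v where v: "norm v = 1" and P: "P = hexagon b v" using hexagon_P_hx[OF assms] by blast
  show ?thesis
  proof
    assume "congruent_to P t"
    then obtain f where f: "\<And>x y. dist (f x) (f y) = dist x y" and t: "t = f ` P"
      unfolding congruent_to_def by blast
    obtain a w where w: "norm w = 1" and "f = motion a w \<or> f = motion a w \<circ> cnj" using isometry_mv[OF f] .
    then have "t = hexagon (a + w * b) (w * v) \<or> t = hexagon (a + w * cnj b) (w * cnj v)"
      unfolding t P by (metis image_comp mv_hx cnj_hx)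
    then show "\<exists>a w. norm w = 1 \<and> t = hexagon a w" using v w by (metis norm_mult complex_mod_cnj mult_1)
  next
    assume "\<exists>a w. norm w = 1 \<and> t = hexagon a w"
    then obtain a w where w: "norm w = 1" and t: "t = hexagon a w" by blast
    have "v * cnj v = 1" using complex_norm_square[of v] v by simp
    then have "motion (a - w * cnj v * b) (w * cnj v) ` hexagon b v = hexagon a w"
      unfolding mv_hx by (simp add: mult.assoc mult.commute[of "cnj v" v])
    moreover have "norm (w * cnj v) = 1" using v w by (simp add: norm_mult)
    ultimately show "congruent_to P t" unfolding congruent_to_def P t using dist_mv by metis
  qed
qed

lemma card_trio: "norm w = 1 \<Longrightarrow> card (trio a w) = 3"
proof -
  assume w: "norm w = 1"
  have "inj_on (\<lambda>z. (motion a w z, r)) (set sv)" using mv_inj[OF w] by (auto intro: inj_onI)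
  moreover have "card (set sv) = 3" using hs_bounds r_gt by (simp add: sv_def)
  ultimately show ?thesis unfolding trio_def by (simp add: card_image)
qed

lemma trio_frame:
  assumes w: "norm w = 1" and D: "D \<in> trio a w"
  obtains w' where "norm w' = 1" "hexagon a w' = hexagon a w" "trio a w' = trio a w" "D = (motion a w' (sv ! 0), r)"
proof -
  obtain k where k: "k < 3" "D = (motion a w (sv ! k), r)"
proof -
    obtain z where "z \<in> set sv" "D = (motion a w z, r)" using D unfolding trio_def by blast
    moreover have "length sv = 3" by (simp add: sv_def)
    ultimately show thesis using that by (metis in_set_conv_nth)
  qed
  obtain w' where "norm w' = 1" "hexagon a w' = hexagon a w" "trio a w' = trio a w"
    "\<And>j. j < 3 \<Longrightarrow> motion a w' (sv ! j) = motion a w (sv ! ((j + k) mod 3))"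
    using frame_shift[OF w k(1)] by metis
  then show thesis using that k by simp
qed

lemma trio_tangent: "norm w = 1 \<Longrightarrow> pairwise tangent (trio a w)"
proof -
  assume w: "norm w = 1"
  have "dist x y = 2 * r" if "x \<in> set sv" "y \<in> set sv" "x \<noteq> y" for x y
    using that sv_dist by (auto simp: sv_def dist_commute)
  then show ?thesis unfolding pairwise_def trio_def tangent_def by (auto simp: dist_mv[OF w])
qed

lemma trio_ball: "norm w = 1 \<Longrightarrow> D \<in> trio a w \<Longrightarrow> cball (fst D) r \<subseteq> interior (hexagon a w)"
proof -
  assume w: "norm w = 1" and D: "D \<in> trio a w"
  obtain w' where w': "norm w' = 1" "hexagon a w' = hexagon a w" "D = (motion a w' (sv ! 0), r)"
    using trio_frame[OF w D] by metis
  have "x \<in> interior (hexagon a w')" if x: "x \<in> cball (motion a w' (sv ! 0)) r" for x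
  proof -
    obtain z where z: "x = motion a w' z" using mv_surj[OF w'(1)] by blast
    then have "z \<in> cball (sv ! 0) r" using x by (simp add: dist_mv[OF w'(1)])
    then have "z \<in> interior (convex hull set hexv)" using sv_interior[of 0] by auto
    then show ?thesis unfolding hx_hull interior_eq[OF good_mv[OF good_hexv w'(1)]] interior_eq[OF good_hexv] z
      by (simp add: nx_map cr_mv[OF w'(1)])
  qed
  then show ?thesis unfolding w'(2,3)[symmetric] by (auto simp: w'(3))
qed

lemma trio_inscribed:
  assumes w: "norm w = 1"
  shows "inscribed_trio r (hexagon a w) (trio a w)"
  unfolding inscribed_trio_def
proof (intro conjI ballI)
  show "card (trio a w) = 3" by (rule card_trio[OF w])
  show "pairwise tangent (trio a w)" by (rule trio_tangent[OF w])
  fix D assume D: "D \<in> trio a w"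
  show s: "snd D = r" using D unfolding trio_def by auto
  show "cball (fst D) (snd D) \<subseteq> hexagon a w" using trio_ball[OF w D] interior_subset unfolding s by blast
  obtain w' where w': "norm w' = 1" "hexagon a w' = hexagon a w" "D = (motion a w' (sv ! 0), r)"
    using trio_frame[OF w D] by metis
  define us where "us = map (motion a w') hexv"
  \<comment> \<open>The list is rotated so that the vertex with angle 2 * \<open>alpha'\<close>
    stands at index 1, where \<open>inscribed_trio\<close> expects it.\<close>
  define vs where "vs = map (\<lambda>i. us ! ((i + 5) mod 6)) [0..<6]"
  have us: "length us = 6" "convex_polygon us (hexagon a w)"
  proof -
    show "length us = 6" unfolding us_def by simp
    have "hexagon a w = convex hull set us" unfolding us_def using w'(2) hx_hull by metis
    then show "convex_polygon us (hexagon a w)"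
      using good_convex_polygon[OF good_mv[OF good_hexv w'(1)]] unfolding us_def by simp
  qed
  have l: "length vs = 6" by (simp add: vs_def)
  have nth: "vs ! i = us ! ((i + 5) mod 6)" if "i < 6" for i using that by (simp add: vs_def)
  have "set vs = set us"
  proof -
    have "set us = {us ! 0, us ! 1, us ! 2, us ! 3, us ! 4, us ! 5}" unfolding us_def by (simp add: hexv_def)
    moreover have "set vs = {us ! 5, us ! 0, us ! 1, us ! 2, us ! 3, us ! 4}" unfolding vs_def by (simp add: upt_rec)
    ultimately show ?thesis by auto
  qed
  moreover from this have "distinct vs"
    using us l distinct_card[of us] unfolding convex_polygon_def by (intro card_distinct) simp
  moreover have "closed_segment (vs ! i) (vs ! (Suc i mod length vs)) edge_of hexagon a w" if i: "i < length vs" for i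
  proof -
    have e: "(Suc i mod 6 + 5) mod 6 = Suc ((i + 5) mod 6) mod 6" by presburger
    have "\<forall>k<6. closed_segment (us ! k) (us ! (Suc k mod 6)) edge_of hexagon a w"
      using us(2) unfolding convex_polygon_def us(1) by blast
    then have "closed_segment (us ! ((i + 5) mod 6)) (us ! (Suc ((i + 5) mod 6) mod 6)) edge_of hexagon a w"
      by simp
    then show ?thesis using i nth e unfolding l by simp
  qed
  ultimately have cp: "convex_polygon vs (hexagon a w)"
    using us unfolding convex_polygon_def by (metis (no_types, lifting))
  have h: "vs ! 0 = motion a w' (hexv ! 5)" "vs ! 1 = motion a w' (hexv ! 0)" "vs ! 2 = motion a w' (hexv ! 1)"
    using nth[of 0] nth[of 1] nth[of 2] unfolding us_def by simp_all
  have "interior_angle vs 1 = angle (vs ! 0 - vs ! 1) (vs ! 2 - vs ! 1)"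
    unfolding interior_angle_def l by (simp add: numeral_2_eq_2)
  moreover have "interior_angle hexv 0 = angle (hexv ! 5 - hexv ! 0) (hexv ! 1 - hexv ! 0)"
    unfolding interior_angle_def by simp
  ultimately have "interior_angle vs 1 = interior_angle hexv 0"
    unfolding h by (simp add: angle_mv[OF w'(1)])
  then have "interior_angle vs 1 = 2 * alpha' r" using hexv_interior_angle[of 0] by simp
  moreover have "\<forall>j<3. tangent D (vs ! j, 1)"
    unfolding all_less_3 tangent_def h w'(3) using sv_hexv_dist(1-3) by (simp add: dist_mv[OF w'(1)])
  ultimately show "\<exists>vs. length vs = 6 \<and> convex_polygon vs (hexagon a w) \<and> interior_angle vs 1 = 2 * alpha' r \<and>
              (\<forall>j<3. tangent D (vs ! j, 1))"
    using l cp by blast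
qed

lemma hx_edge_neighbour:
  assumes w: "norm w = 1" and e: "closed_segment u v edge_of hexagon a w" and i: "i < 6" and u: "u = motion a w (hexv ! i)"
  shows "v = motion a w (hexv ! (Suc i mod 6)) \<or> v = motion a w (hexv ! ((i + 5) mod 6))"
proof -
  obtain x y where s: "side (hexagon a w) x y" "closed_segment u v = closed_segment x y"
    using edge_imp_side[OF tile_hx[OF w] e] by metis
  obtain k where k: "k < 6" "x = motion a w (hexv ! k)" "y = motion a w (hexv ! (Suc k mod 6))"
    using s(1) unfolding hx_side[OF w] by blast
  have inj: "motion a w (hexv ! i) = motion a w (hexv ! j) \<Longrightarrow> i < 6 \<Longrightarrow> j < 6 \<Longrightarrow> i = j" for i j
    using nth_inj[OF good_hexv] unfolding mv_inj[OF w] by simp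
  have "{u, v} = {x, y}" using s(2) by (simp add: closed_segment_eq)
  then consider "u = x" "v = y" | "u = y" "v = x" by (auto simp: doubleton_eq_iff)
  then show ?thesis
  proof cases
    case 1
    then have "i = k" using inj i k(1) u k(2) by metis
    then show ?thesis using 1 k by simp
  next
    case 2
    then have "i = Suc k mod 6" using inj i u k by (metis mod_less_divisor zero_less_numeral)
    then have "k = (i + 5) mod 6" using k(1) by presburger
    then show ?thesis using 2 k by simp
  qed
qed

text \<open>A disc of \<open>K\<close> belongs to a vertex with angle 2 * \<open>alpha'\<close>,
  which has even index since \<open>beta r\<close> is positive. The other two vertices are its
  neighbours in some order, so three distances fix the centre by \<open>dist3_unique\<close>. Hence
  \<open>K\<close> lies in the trio, and the cardinalities agree.\<close>

lemma inscribed_trio_unique: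
  assumes w: "norm w = 1" and K: "inscribed_trio r (hexagon a w) K"
  shows "K = trio a w"
proof -
  have "K \<subseteq> trio a w"
  proof
    fix D assume D: "D \<in> K"
    obtain vs where vs: "length vs = 6" "convex_polygon vs (hexagon a w)" "interior_angle vs 1 = 2 * alpha' r"
        "\<forall>j<3. tangent D (vs ! j, 1)" and sD: "snd D = r"
      using K D unfolding inscribed_trio_def by blast
    have "vs ! 1 extreme_point_of hexagon a w"
      using vs(1,2) nth_mem[of 1 vs] unfolding convex_polygon_def by auto
    then obtain i where i: "i < 6" "vs ! 1 = motion a w (hexv ! i)" unfolding hx_ext[OF w] by blast
    have ed: "closed_segment (vs ! j) (vs ! (Suc j mod 6)) edge_of hexagon a w" if "j < 6" for j
      using vs(2) that unfolding convex_polygon_def vs(1) by blast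
    have n0: "vs ! 0 = motion a w (hexv ! (Suc i mod 6)) \<or> vs ! 0 = motion a w (hexv ! ((i + 5) mod 6))"
      using ed[of 0] hx_edge_neighbour[OF w _ i] by (simp add: closed_segment_commute)
    have n2: "vs ! 2 = motion a w (hexv ! (Suc i mod 6)) \<or> vs ! 2 = motion a w (hexv ! ((i + 5) mod 6))"
      using ed[of 1] hx_edge_neighbour[OF w _ i] by (simp add: numeral_2_eq_2)
    have "vs ! 0 \<noteq> vs ! 2" using vs unfolding convex_polygon_def by (simp add: nth_eq_iff_index_eq)
    then have n02: "vs ! 0 = motion a w (hexv ! (Suc i mod 6)) \<and> vs ! 2 = motion a w (hexv ! ((i + 5) mod 6)) \<or>
      vs ! 0 = motion a w (hexv ! ((i + 5) mod 6)) \<and> vs ! 2 = motion a w (hexv ! (Suc i mod 6))" using n0 n2 by metis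
    have k: "(i + length hexv - 1) mod length hexv = (i + 5) mod 6" by (simp add: add.commute)
    have "interior_angle vs 1 = angle (vs ! 0 - vs ! 1) (vs ! 2 - vs ! 1)"
      unfolding interior_angle_def vs(1) by (simp add: numeral_2_eq_2)
    also have "\<dots> = angle (motion a w (hexv ! ((i + 5) mod 6)) - motion a w (hexv ! i)) (motion a w (hexv ! (Suc i mod 6)) - motion a w (hexv ! i))"
      using n02 i(2) angle_commute by metis
    also have "\<dots> = interior_angle hexv i"
      unfolding angle_mv[OF w] interior_angle_def k by simp
    finally have "2 * alpha' r = (if even i then 2 * alpha' r else 2 * alpha' r + beta r)"
      using vs(3) hexv_interior_angle[OF i(1)] by simp
    then have "even i" using angles_range by (auto split: if_splits)
    then obtain m where m: "i = 2 * m" "m < 3" using i(1) by (elim evenE) auto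
    obtain w' where w': "norm w' = 1" "trio a w' = trio a w"
      "\<And>j. j < 6 \<Longrightarrow> motion a w' (hexv ! j) = motion a w (hexv ! ((j + 2 * m) mod 6))"
      using frame_shift[OF w m(2)] by metis
    have d: "dist (fst D) (vs ! j) = 1 + r" if "j < 3" for j
      using vs(4) that sD unfolding tangent_def by simp
    have h: "motion a w' (hexv ! 0) = vs ! 1" "motion a w' (hexv ! 1) = motion a w (hexv ! (Suc i mod 6))"
      "motion a w' (hexv ! 5) = motion a w (hexv ! ((i + 5) mod 6))"
      using w'(3)[of 0] w'(3)[of 1] w'(3)[of 5] i m by (simp_all add: add.commute)
    have "dist (fst D) (motion a w' (hexv ! 0)) = 1 + r" "dist (fst D) (motion a w' (hexv ! 1)) = 1 + r"
      "dist (fst D) (motion a w' (hexv ! 5)) = 1 + r"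
      unfolding h using n02 d[of 0] d[of 1] d[of 2] by auto
    then have "fst D = motion a w' (sv ! 0)"
    proof (intro dist3_unique[of _ "motion a w' (hexv ! 0)" _ "motion a w' (hexv ! 1)" "motion a w' (hexv ! 5)"])
      have "12/5 \<le> cross (hexv ! 0) (hexv ! 1) (hexv ! 5)" using far[OF good_hexv, of 0 5] by (simp add: succ_vertex_def)
      then show "cross (motion a w' (hexv ! 0)) (motion a w' (hexv ! 1)) (motion a w' (hexv ! 5)) \<noteq> 0"
        unfolding cr_mv[OF w'(1)] by simp
    qed (simp_all add: dist_mv[OF w'(1)] sv_hexv_dist sv_hexv_dist[unfolded One_nat_def])
    then have "D = (motion a w' (sv ! 0), r)" using sD by (simp add: prod_eq_iff)
    moreover have "sv ! 0 \<in> set sv" by (simp add: sv_def)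
    ultimately have "D \<in> trio a w'" unfolding trio_def by blast
    then show "D \<in> trio a w" unfolding w'(2) .
  qed
  moreover have "card K = 3" using K unfolding inscribed_trio_def by blast
  moreover have "finite (trio a w)" unfolding trio_def by simp
  ultimately show ?thesis using card_trio[OF w] by (metis card_subset_eq)
qed

end

section \<open>Tiles spanned by a separated set\<close>

lemma separated_finite:
  fixes A :: "complex set"
  assumes sep: "\<And>x y. x \<in> A \<Longrightarrow> y \<in> A \<Longrightarrow> x \<noteq> y \<Longrightarrow> d \<le> dist x y" and d: "0 < d" and b: "bounded A"
  shows "finite A"
proof (rule ccontr)
  assume "infinite A"
  then obtain x where "x islimpt A" using bounded_infinite_imp_islimpt[OF subset_refl b] by auto
  then have inf: "infinite (A \<inter> ball x (d/2))" using d unfolding islimpt_eq_infinite_ball by auto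
  then obtain y where y: "y \<in> A \<inter> ball x (d/2)" using infinite_imp_nonempty by blast
  have "infinite (A \<inter> ball x (d/2) - {y})" using inf by simp
  then obtain z where z: "z \<in> A \<inter> ball x (d/2)" "z \<noteq> y" using infinite_imp_nonempty by blast
  have "dist y z < d" using y z dist_triangle3[of y z x] by auto
  then show False using sep[of y z] y z by auto
qed

lemma tile_interior_ball:
  assumes "tile t"
  obtains c where "ball c (1/2) \<subseteq> interior t" "t \<subseteq> cball c 3"
proof -
  obtain c where c: "ball c (1/2) \<subseteq> t" "t \<subseteq> cball c 3" using tile_centre[OF assms] by blast
  have "ball c (1/2) \<subseteq> interior t" using c(1) by (intro interior_maximal) auto
  then show thesis using that c by blast
qed

abbreviation nonoverlapping :: "complex set set \<Rightarrow> bool" where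
  "nonoverlapping T \<equiv> pairwise (\<lambda>s t. interior s \<inter> interior t = {}) T"

text \<open>The balls of radius 1/2 inside the tiles are disjoint, so their centres are at least 1
  apart, while tiles that meet a bounded region have centres in a bounded region.\<close>

lemma nonoverlapping_finite:
  assumes T: "\<And>t. t \<in> T \<Longrightarrow> tile t" and n: "nonoverlapping T"
  shows "finite {t \<in> T. t \<inter> cball x R \<noteq> {}}"
proof -
  let ?F = "{t \<in> T. t \<inter> cball x R \<noteq> {}}"
  have "\<exists>c. ball c (1/2) \<subseteq> interior t \<and> t \<subseteq> cball c 3" if "t \<in> T" for t
    by (rule tile_interior_ball[OF T[OF that]]) blast
  then obtain c where c: "\<And>t. t \<in> T \<Longrightarrow> ball (c t) (1/2) \<subseteq> interior t" "\<And>t. t \<in> T \<Longrightarrow> t \<subseteq> cball (c t) 3"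
    by metis
  have sep: "1 \<le> dist (c s) (c t)" if "s \<in> T" "t \<in> T" "s \<noteq> t" for s t
  proof (rule ccontr)
    assume "\<not> 1 \<le> dist (c s) (c t)"
    then have "midpoint (c s) (c t) \<in> ball (c s) (1/2)" "midpoint (c s) (c t) \<in> ball (c t) (1/2)"
      by (auto simp: dist_midpoint)
    then have "midpoint (c s) (c t) \<in> interior s \<inter> interior t" using c(1) that by blast
    then show False using n that unfolding pairwise_def by blast
  qed
  have "bounded (c ` ?F)"
  proof -
    have "c t \<in> cball x (R + 3)" if t: "t \<in> ?F" for t
    proof -
      obtain y where "y \<in> t" "dist x y \<le> R" using t by auto
      moreover have "dist (c t) y \<le> 3" using c(2)[of t] t \<open>y \<in> t\<close> by auto
      ultimately show ?thesis using dist_triangle2[of x "c t" y] by simp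
    qed
    then have "c ` ?F \<subseteq> cball x (R + 3)" by (rule image_subsetI)
    then show ?thesis by (rule bounded_subset[OF bounded_cball])
  qed
  then have "finite (c ` ?F)" using sep by (intro separated_finite[of _ 1]) auto
  moreover have "inj_on c ?F" using sep by (intro inj_onI) force
  ultimately show ?thesis by (rule finite_imageD)
qed

text \<open>Near \<open>x\<close> only finitely many tiles occur, so closure commutes with the union
  and a single tile accumulates at \<open>x\<close>. This gives closedness of the union, and a tile
  in a prescribed direction from a point.\<close>

lemma nonoverlapping_accumulation:
  assumes T: "\<And>t. t \<in> T \<Longrightarrow> tile t" and n: "nonoverlapping T"
    and A: "A \<subseteq> \<Union>T" and x: "x \<in> closure A"
  obtains t where "t \<in> T" "x \<in> t" "A \<inter> t \<noteq> {}"
proof -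
  let ?F = "{t \<in> T. t \<inter> cball x 1 \<noteq> {}}"
  have fin: "finite ?F" by (rule nonoverlapping_finite[OF T n])
  have clUN: "closure (\<Union>t\<in>F. A \<inter> t) = (\<Union>t\<in>F. closure (A \<inter> t))" if "finite F" for F
    using that by (induction F) (simp_all add: closure_Un)
  have "x \<in> closure (ball x 1 \<inter> A)"
    using open_Int_closure_subset[of "ball x 1" A] x by auto
  also have "closure (ball x 1 \<inter> A) \<subseteq> closure (\<Union>t\<in>?F. A \<inter> t)"
    using A by (intro closure_mono) fastforce
  also have "\<dots> = (\<Union>t\<in>?F. closure (A \<inter> t))" by (rule clUN[OF fin])
  finally obtain t where t: "t \<in> T" "x \<in> closure (A \<inter> t)" by auto
  then have "x \<in> t" using closure_mono[of "A \<inter> t" t] tile_closed[OF T[OF t(1)]] by (auto simp: closure_closed)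
  moreover have "A \<inter> t \<noteq> {}" using t by auto
  ultimately show thesis using that t by blast
qed

text \<open>A tile is the closure of its interior, so an open set that meets it also meets its
  interior.\<close>

lemma nonoverlapping_interior_eq:
  assumes n: "nonoverlapping T" and st: "s \<in> T" "t \<in> T" and t: "tile t" and x: "x \<in> interior s" "x \<in> t"
  shows "s = t"
proof (rule ccontr)
  assume "s \<noteq> t"
  then have "interior s \<inter> interior t = {}" using n st unfolding pairwise_def by blast
  then have "interior s \<inter> closure (interior t) = {}" by (simp add: open_Int_closure_eq_empty)
  then show False using x tile_closure_interior[OF t] by auto
qed

lemma tile_sides_finite: "tile t \<Longrightarrow> finite {(a, b). side t a b}"
proof -
  assume "tile t"
  then have "finite ({v. v extreme_point_of t} \<times> {v. v extreme_point_of t})" using tile_ext_finite by blast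
  then show ?thesis by (rule rev_finite_subset) (auto simp: side_def)
qed

text \<open>At an inner point of a side the finitely many other side conditions are strict, so
  nearby the tile is a half disc.\<close>

lemma side_near:
  assumes t: "tile t" and s: "side t a b" and x: "x \<in> open_segment a b"
  obtains e where "0 < e" "\<And>y. dist x y < e \<Longrightarrow> 0 \<le> cross a b y \<Longrightarrow> y \<in> t"
    "\<And>y. dist x y < e \<Longrightarrow> 0 < cross a b y \<Longrightarrow> y \<in> interior t"
proof -
  let ?S = "{(c, d). side t c d} - {(a, b)}"
  let ?O = "\<Inter>p\<in>?S. {y. 0 < cross (fst p) (snd p) y}"
  have "open ?O" using tile_sides_finite[OF t] open_cr by (intro open_INT) auto
  moreover have "x \<in> ?O"
  proof (intro INT_I CollectI)
    fix p assume "p \<in> ?S"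
    then have "side t (fst p) (snd p)" "(fst p, snd p) \<noteq> (a, b)" by auto
    then show "0 < cross (fst p) (snd p) x" by (rule side_strict[OF t s _ _ x])
  qed
  ultimately obtain e where e: "0 < e" "ball x e \<subseteq> ?O" using open_contains_ball by blast
  have pos: "0 < cross c d y" if "dist x y < e" "side t c d" "(c, d) \<noteq> (a, b)" for y c d
    using that e(2) by (force simp: subset_iff)
  show thesis
  proof (rule that[OF e(1)])
    show "y \<in> t" if "dist x y < e" "0 \<le> cross a b y" for y
      unfolding tile_mem_iff[OF t] using pos[OF that(1)] that(2) by (metis less_imp_le prod.inject)
    show "y \<in> interior t" if "dist x y < e" "0 < cross a b y" for y
      unfolding tile_interior_iff[OF t] using pos[OF that(1)] that(2) by (metis prod.inject)
  qed
qed

lemma left_point: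
  assumes "a \<noteq> b" "0 < e"
  obtains z where "dist x z < e" "cross a b x < cross a b z"
proof -
  define d where "d = dist a b"
  have d: "0 < d" using assms unfolding d_def by simp
  define z where "z = x + (e / (2 * d)) *\<^sub>R (\<i> * (b - a))"
  have "norm (\<i> * (b - a)) = d" unfolding d_def by (simp add: norm_mult dist_norm norm_minus_commute)
  then have "dist x z = e / (2 * d) * d" unfolding z_def dist_norm using assms d by simp
  then have 1: "dist x z < e" using assms d by simp
  have "cross a b (x + k *\<^sub>R (\<i> * (b - a))) = cross a b x + k * ((Re b - Re a)^2 + (Im b - Im a)^2)" for k
    unfolding cross_def by (simp add: algebra_simps power2_eq_square)
  then have "cross a b z = cross a b x + e / (2 * d) * ((Re b - Re a)^2 + (Im b - Im a)^2)"
    unfolding z_def .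
  also have "(Re b - Re a)^2 + (Im b - Im a)^2 = d^2" unfolding d_def dist_sq by (simp add: power2_commute)
  finally have 2: "cross a b x < cross a b z" using assms d by simp
  show thesis using that 1 2 by blast
qed

lemma cr_midpoint: "cross a b (midpoint a b) = 0"
proof -
  have "midpoint a b = (1 - 1/2) *\<^sub>R a + (1/2) *\<^sub>R b" by (simp add: midpoint_def scaleR_right_distrib)
  then show ?thesis by (simp only: cr_affine cr_same)
qed

text \<open>Both tiles have the points just to the left of the midpoint of the side in their
  interior.\<close>

lemma same_side_eq:
  assumes n: "nonoverlapping T" and st: "s \<in> T" "t \<in> T" and tl: "tile s" "tile t"
    and side: "side s a b" "side t a b"
  shows "s = t"
proof -
  have ab: "a \<noteq> b" using side_neq side by blast
  let ?m = "midpoint a b"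
  have m: "?m \<in> open_segment a b" using ab by simp
  have m0: "cross a b ?m = 0" by (rule cr_midpoint)
  obtain e1 where e1: "0 < e1" "\<And>y. dist ?m y < e1 \<Longrightarrow> 0 < cross a b y \<Longrightarrow> y \<in> interior s"
    using side_near[OF tl(1) side(1) m] by metis
  obtain e2 where e2: "0 < e2" "\<And>y. dist ?m y < e2 \<Longrightarrow> 0 < cross a b y \<Longrightarrow> y \<in> interior t"
    using side_near[OF tl(2) side(2) m] by metis
  obtain z where z: "dist ?m z < min e1 e2" "cross a b ?m < cross a b z"
    using left_point[OF ab, of "min e1 e2"] e1(1) e2(1) by (metis min_less_iff_conj)
  then have "z \<in> interior s" "z \<in> interior t" using e1(2)[of z] e2(2)[of z] m0 by auto
  then show ?thesis using nonoverlapping_interior_eq[OF n st tl(2)] interior_subset by blast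
qed

section \<open>Segments between centres at distance 2\<close>

lemma segment_parts:
  fixes a b x :: complex
  assumes "x \<in> closed_segment a b" "dist a b = (2::real)"
  shows "dist x a + dist x b = 2"
proof -
  have "between (a, b) x" using assms(1) by (simp only: between_mem_segment)
  then have "dist a b = dist a x + dist x b" by (simp only: between)
  then show ?thesis using assms(2) dist_commute[of a x] by linarith
qed

lemma opposite_of_unit:
  assumes "dist x a = 1" "dist x b = 1" "dist a b = (2::real)"
  shows "b - x = - (a - (x::complex))"
proof -
  have "(a - x) \<bullet> (b - x) = - 1" using inner_dist[of a b x] assms by (simp add: dist_commute)
  moreover have "norm (a - x) = 1" "norm (b - x) = 1" using assms by (simp_all add: dist_norm norm_minus_commute)
  ultimately have "(norm ((a - x) + (b - x)))^2 = 0"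
    using dot_norm[of "a - x" "b - x"] by simp
  then have "(a - x) + (b - x) = 0" by simp
  then show ?thesis using add_eq_0_iff by blast
qed

text \<open>\<open>U\<close> stands for the centres of the unit discs, \<open>C\<close> for the
  stock of admissible tiles.\<close>

locale unit_centres =
  fixes U :: "complex set" and C :: "complex set set"
  assumes sep2: "\<And>x y. x \<in> U \<Longrightarrow> y \<in> U \<Longrightarrow> x \<noteq> y \<Longrightarrow> 2 \<le> dist x y"
    and C_tile: "\<And>t. t \<in> C \<Longrightarrow> tile t"
begin

definition segs :: "complex set" where
  "segs = \<Union>{closed_segment c d | c d. c \<in> U \<and> d \<in> U \<and> dist c d = 2}"

text \<open>All tiles of the stock with vertices in \<open>U\<close> are taken at once; that they do
  not overlap is a consequence, proved in \<open>TT_nonoverlapping\<close>.\<close>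

definition unit_tiles :: "complex set set" where
  "unit_tiles = {t \<in> C. \<forall>v. v extreme_point_of t \<longrightarrow> v \<in> U}"

lemma TT_tile: "t \<in> unit_tiles \<Longrightarrow> tile t" using C_tile unfolding unit_tiles_def by blast

lemma TT_side: "t \<in> unit_tiles \<Longrightarrow> side t a b \<Longrightarrow> a \<in> U" "t \<in> unit_tiles \<Longrightarrow> side t a b \<Longrightarrow> b \<in> U"
  unfolding unit_tiles_def side_def by blast+

lemma segments_shared_end:
  fixes a b d x :: complex
  assumes "dist a b = 2" "dist a d = 2" "x \<in> closed_segment a b" "x \<in> closed_segment a d"
  shows "b = d \<or> x = a"
proof -
  obtain t where t: "0 \<le> t" "x = (1 - t) *\<^sub>R a + t *\<^sub>R b" using assms(3) by (rule closed_segmentE)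
  obtain s where s: "0 \<le> s" "x = (1 - s) *\<^sub>R a + s *\<^sub>R d" using assms(4) by (rule closed_segmentE)
  have et: "x - a = t *\<^sub>R (b - a)" by (subst t(2)) (simp add: algebra_simps)
  have es: "x - a = s *\<^sub>R (d - a)" by (subst s(2)) (simp add: algebra_simps)
  have "norm (x - a) = t * dist a b" unfolding et using t(1) by (simp add: dist_norm norm_minus_commute)
  moreover have "norm (x - a) = s * dist a d" unfolding es using s(1) by (simp add: dist_norm norm_minus_commute)
  ultimately have "t = s" using assms by simp
  then have "t *\<^sub>R (b - a) - t *\<^sub>R (d - a) = 0" using et es by (metis diff_self)
  then have "t *\<^sub>R (b - d) = 0" by (simp add: algebra_simps)
  then have "t = 0 \<or> b - d = 0" by (rule scaleR_eq_0_iff[THEN iffD1])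
  then show ?thesis
  proof
    assume "t = 0"
    then have "x - a = 0" using et by simp
    then show ?thesis by simp
  qed simp
qed

text \<open>With four distinct ends, separation and the triangle inequality put \<open>x\<close> at
  distance 1 from each of them. Then \<open>c\<close> and \<open>d\<close> are opposite points of
  the unit circle about \<open>x\<close>, which also carries \<open>a\<close>; by Thales the squares
  of the distances from \<open>a\<close> to them add up to 4, but each is at least 4.\<close>

lemma noncrossing:
  assumes U: "a \<in> U" "b \<in> U" "c \<in> U" "d \<in> U" and ab: "dist a b = 2" and cd: "dist c d = 2"
    and x: "x \<in> closed_segment a b" "x \<in> closed_segment c d"
  shows "{a, b} = {c, d} \<or> x \<in> {a, b} \<and> x \<in> {c, d}"
proof -
  consider "a = c" | "a = d" | "b = c" | "b = d" | "a \<noteq> c" "a \<noteq> d" "b \<noteq> c" "b \<noteq> d" by blast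
  then show ?thesis
  proof cases
    case 1
    then show ?thesis using segments_shared_end[of a b d x] ab cd x by auto
  next
    case 2
    then show ?thesis using segments_shared_end[of a b c x] ab cd x
      by (auto simp: dist_commute closed_segment_commute)
  next
    case 3
    then show ?thesis using segments_shared_end[of b a d x] ab cd x
      by (auto simp: dist_commute closed_segment_commute)
  next
    case 4
    then show ?thesis using segments_shared_end[of b a c x] ab cd x
      by (auto simp: dist_commute closed_segment_commute)
  next
    case 5
    have d2: "2 \<le> dist a c" "2 \<le> dist a d" "2 \<le> dist b c" "2 \<le> dist b d" using sep2 U 5 by auto
    have p: "dist x a + dist x b = 2" "dist x c + dist x d = 2" using segment_parts x ab cd by auto
    have "dist x a = 1" "dist x b = 1" "dist x c = 1" "dist x d = 1"
      using d2 p dist_triangle3[of a c x] dist_triangle3[of a d x] dist_triangle3[of b c x] dist_triangle3[of b d x]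
      by linarith+
    then have "d - x = - (c - x)" and ac: "dist a x = 1" "dist c x = 1" "dist d x = 1"
      using opposite_of_unit[of x c d] cd by (simp_all add: dist_commute)
    then have "(a - x) \<bullet> (d - x) = - ((a - x) \<bullet> (c - x))" by (simp only: inner_minus_right)
    then have "(dist a c)^2 + (dist a d)^2 = 4"
      using inner_dist[of a c x] inner_dist[of a d x] ac by simp
    moreover have "4 \<le> (dist a c)^2" "4 \<le> (dist a d)^2"
      using power_mono[OF d2(1), of 2] power_mono[OF d2(2), of 2] by simp_all
    ultimately show ?thesis by simp
  qed
qed

lemma centre_notin_interior:
  assumes t: "t \<in> unit_tiles" and c: "c \<in> U"
  shows "c \<notin> interior t"
proof
  assume ci: "c \<in> interior t"
  then have "c \<in> t" using interior_subset by blast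
  then have "c extreme_point_of t \<or> (\<exists>v. v extreme_point_of t \<and> dist c v < 2)"
    by (rule tile_near[OF TT_tile[OF t]])
  then show False
  proof (elim disjE exE conjE)
    assume "c extreme_point_of t"
    then show False using ci extreme_point_not_in_interior by blast
  next
    fix v assume v: "v extreme_point_of t" "dist c v < 2"
    then have "v \<in> U" using t unfolding unit_tiles_def by blast
    then have "c = v" using sep2[OF c] v by force
    then show False using ci v extreme_point_not_in_interior by blast
  qed
qed

text \<open>The way along the segment from an interior point to the end \<open>c\<close>, which is
  not interior, leads through a side. By \<open>noncrossing\<close> the segment equals that side or
  meets it in a common end point, so \<open>c\<close> is a vertex, and likewise \<open>d\<close>.
  Vertices at distance 2 span a side, which has no interior points of the tile.\<close>

lemma interior_segs:
  assumes t: "t \<in> unit_tiles"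
  shows "interior t \<inter> segs = {}"
proof (rule ccontr)
  assume "interior t \<inter> segs \<noteq> {}"
  then obtain y c d where y: "y \<in> interior t" "y \<in> closed_segment c d" and cd: "c \<in> U" "d \<in> U" "dist c d = 2"
    unfolding segs_def by blast
  note tl = TT_tile[OF t]
  have end_vertex: "c extreme_point_of t" if y: "y \<in> closed_segment c d" and cd: "c \<in> U" "d \<in> U" "dist c d = 2" for c d
  proof -
    have sub: "closed_segment y c \<subseteq> closed_segment c d" using y by (simp add: subset_closed_segment)
    have "y \<in> closed_segment y c \<inter> t" "c \<in> closed_segment y c - interior t"
      using \<open>y \<in> interior t\<close> interior_subset centre_notin_interior[OF t cd(1)] by auto
    then have "closed_segment y c \<inter> frontier (interior t) \<noteq> {}"
      using \<open>y \<in> interior t\<close> by (intro connected_Int_frontier) auto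
    then obtain x where x: "x \<in> closed_segment y c" "x \<in> frontier t"
      using frontier_interior_subset[of t] by blast
    then obtain a b where ab: "side t a b" "x \<in> closed_segment a b" using tile_frontier_iff[OF tl] by blast
    have "{a, b} = {c, d} \<or> x \<in> {a, b} \<and> x \<in> {c, d}"
      using noncrossing[OF TT_side[OF t ab(1)] cd(1,2) side_dist[OF ab(1)] cd(3) ab(2)] x sub by blast
    then show ?thesis
    proof
      assume "{a, b} = {c, d}"
      then show ?thesis using side_ext[OF ab(1)] by (auto simp: doubleton_eq_iff)
    next
      assume xx: "x \<in> {a, b} \<and> x \<in> {c, d}"
      \<comment> \<open>\<open>x\<close> lies between \<open>y\<close> and \<open>c\<close>, so x =
        d would give y = d, a centre in the interior.\<close>
      have "x \<noteq> d"
      proof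
        assume "x = d"
        then have "dist y d + dist d c = dist y c" using x(1) \<open>x = d\<close> unfolding between_mem_segment[symmetric] between by simp
        moreover have "dist y c + dist y d = 2" using segment_parts[OF y cd(3)] .
        moreover have "dist d c = 2" using cd(3) by (simp add: dist_commute)
        ultimately have "dist y d = 0" using zero_le_dist[of y d] by linarith
        then have "y = d" by simp
        then show False using \<open>y \<in> interior t\<close> centre_notin_interior[OF t cd(2)] by blast
      qed
      then show ?thesis using xx side_ext[OF ab(1)] by auto
    qed
  qed
  have "c extreme_point_of t" "d extreme_point_of t"
    using end_vertex[OF y(2) cd] end_vertex[of d c] y(2) cd by (auto simp: closed_segment_commute dist_commute)
  then have "side t c d \<or> side t d c" using tile_adj[OF tl] cd(3) by blast
  then have "y \<in> frontier t" using tile_frontier_iff[OF tl] y(2) closed_segment_commute by metis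
  then show False using y(1) by (simp add: frontier_def)
qed

lemma frontier_segs: "t \<in> unit_tiles \<Longrightarrow> frontier t \<subseteq> segs"
proof
  fix x assume t: "t \<in> unit_tiles" and x: "x \<in> frontier t"
  then obtain a b where ab: "side t a b" "x \<in> closed_segment a b" using tile_frontier_iff[OF TT_tile] by blast
  then show "x \<in> segs" using TT_side[OF t ab(1)] side_dist[OF ab(1)] unfolding segs_def by blast
qed

text \<open>A larger connected set would meet the frontier, which consists of segments.\<close>

lemma interior_component:
  assumes t: "t \<in> unit_tiles"
  shows "interior t \<in> components (UNIV - segs)"
proof -
  note tl = TT_tile[OF t]
  have ne: "interior t \<noteq> {}" using tile_interior_nonempty[OF tl] .
  have con: "connected (interior t)" using tile_convex[OF tl] convex_connected convex_interior by blast
  have sub: "interior t \<subseteq> UNIV - segs" using interior_segs[OF t] by blast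
  show ?thesis unfolding in_components_maximal
  proof (intro conjI allI impI)
    fix d assume d: "d \<noteq> {} \<and> interior t \<subseteq> d \<and> d \<subseteq> UNIV - segs \<and> connected d"
    show "d = interior t"
    proof (rule ccontr)
      assume "d \<noteq> interior t"
      then have "d - interior t \<noteq> {}" "d \<inter> interior t \<noteq> {}" using d ne by auto
      then have "d \<inter> frontier (interior t) \<noteq> {}" using d by (intro connected_Int_frontier) auto
      then have "d \<inter> frontier t \<noteq> {}" using frontier_interior_subset by blast
      then show False using frontier_segs[OF t] d by blast
    qed
  qed (use ne con sub in auto)
qed

lemma TT_nonoverlapping: "nonoverlapping unit_tiles"
  unfolding pairwise_def
proof (intro ballI impI)
  fix s t assume st: "s \<in> unit_tiles" "t \<in> unit_tiles" "s \<noteq> t"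
  have "interior s \<noteq> interior t"
    using st tile_closure_interior[OF TT_tile] by metis
  then show "interior s \<inter> interior t = {}"
    using components_nonoverlap[OF interior_component[OF st(1)] interior_component[OF st(2)]] by blast
qed

text \<open>Common points of two tiles lie on both frontiers. If the tiles share no side, these
  points are vertices of both by \<open>noncrossing\<close>, and convexity of the intersection
  permits only one. If they share a side, they share nothing beyond it.\<close>

lemma TT_edge_to_edge: "edge_to_edge unit_tiles"
  unfolding edge_to_edge_def
proof (intro ballI impI)
  fix s t assume st: "s \<in> unit_tiles" "t \<in> unit_tiles" and ne: "s \<noteq> t" and meet: "s \<inter> t \<noteq> {}"
  note ts = TT_tile[OF st(1)] and tt = TT_tile[OF st(2)]
  note eq = nonoverlapping_interior_eq[OF TT_nonoverlapping]
  have fr: "x \<in> frontier s" "x \<in> frontier t" if "x \<in> s" "x \<in> t" for x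
  proof -
    show "x \<in> frontier s" using eq[OF st tt, of x] that ne closure_subset unfolding frontier_def by blast
    show "x \<in> frontier t" using eq[OF st(2,1) ts, of x] that ne closure_subset unfolding frontier_def by blast
  qed
  show "(\<exists>v. v extreme_point_of s \<and> v extreme_point_of t \<and> s \<inter> t = {v}) \<or>
      (\<exists>e. e edge_of s \<and> e edge_of t \<and> s \<inter> t = e)"
  proof (cases "\<exists>a b c d. side s a b \<and> side t c d \<and> {a, b} = {c, d}")
    case True
    then obtain a b c d where ab: "side s a b" and cd: "side t c d" and e: "{a, b} = {c, d}" by blast
    have seg: "closed_segment a b = closed_segment c d" using e closed_segment_commute by (auto simp: doubleton_eq_iff)
    have "s \<inter> t \<subseteq> closed_segment a b"
    proof (rule ccontr)
      assume "\<not> s \<inter> t \<subseteq> closed_segment a b"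
      then obtain y where y: "y \<in> s" "y \<in> t" "y \<notin> closed_segment a b" by blast
      have p: "0 < cross a b y" using side_on[OF ts ab y(1)] side_cr[OF ab y(1)] y(3) by force
      let ?m = "midpoint a b"
      \<comment> \<open>Halfway from the midpoint of the common side to \<open>y\<close>: interior
        to \<open>s\<close> because \<open>y\<close> is off the line of that side, and in
        \<open>t\<close> by convexity.\<close>
      let ?z = "(1 - 1/2) *\<^sub>R ?m + (1/2) *\<^sub>R y"
      have m: "?m \<in> open_segment a b" using side_neq[OF ab] by simp
      have m0: "cross a b ?m = 0" by (rule cr_midpoint)
      have "?z \<in> interior s" unfolding tile_interior_iff[OF ts]
      proof (intro allI impI)
        fix c d assume cd: "side s c d"
        show "0 < cross c d ?z"
        proof (cases "(c, d) = (a, b)")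
          case True
          then show ?thesis unfolding cr_affine using p m0 by simp
        next
          case False
          then have "0 < cross c d ?m" using side_strict[OF ts ab cd _ m] by blast
          then show ?thesis unfolding cr_affine using side_cr[OF cd y(1)] by simp
        qed
      qed
      moreover have "?z \<in> t"
      proof -
        have "?m \<in> t" using tile_side_subset[OF tt cd] m seg open_closed_segment by blast
        then show ?thesis using convexD_alt[OF tile_convex[OF tt] _ y(2), of ?m "1/2"] by simp
      qed
      ultimately show False using eq[OF st tt] ne by blast
    qed
    then have "s \<inter> t = closed_segment a b"
      using tile_side_subset[OF ts ab] tile_side_subset[OF tt cd] seg by blast
    then show ?thesis using side_edge[OF ts ab] side_edge[OF tt cd] seg by metis
  next
    case False
    have ext: "x extreme_point_of s \<and> x extreme_point_of t" if x: "x \<in> s" "x \<in> t" for x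
    proof -
      obtain a b where ab: "side s a b" "x \<in> closed_segment a b" using fr[OF x] tile_frontier_iff[OF ts] by blast
      obtain c d where cd: "side t c d" "x \<in> closed_segment c d" using fr[OF x] tile_frontier_iff[OF tt] by blast
      have "x \<in> {a, b} \<and> x \<in> {c, d}"
        using noncrossing[OF TT_side[OF st(1) ab(1)] TT_side[OF st(2) cd(1)] side_dist[OF ab(1)] side_dist[OF cd(1)] ab(2) cd(2)]
          False ab(1) cd(1) by blast
      then show ?thesis using side_ext[OF ab(1)] side_ext[OF cd(1)] by blast
    qed
    obtain v where v: "v \<in> s" "v \<in> t" using meet by blast
    have "y = v" if y: "y \<in> s" "y \<in> t" for y
    proof (rule ccontr)
      assume ne: "y \<noteq> v"
      then have m: "midpoint y v \<in> open_segment y v" by simp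
      have "closed_segment y v \<subseteq> s" "closed_segment y v \<subseteq> t"
        using y v tile_convex[OF ts] tile_convex[OF tt] by (simp_all add: closed_segment_subset)
      then have "midpoint y v extreme_point_of s" using ext m open_closed_segment by blast
      then show False using m y v unfolding extreme_point_of_def by blast
    qed
    then have "s \<inter> t = {v}" using v by blast
    then show ?thesis using ext[OF v] by blast
  qed
qed

text \<open>The complement of a countable set in the plane is connected, which
  \<open>TT_cover\<close> draws on.\<close>

lemma U_countable: "countable U"
proof -
  have "U = (\<Union>n::nat. U \<inter> cball 0 (real n))"
    using real_arch_simple by (auto simp: dist_norm)
  moreover have "finite (U \<inter> cball 0 (real n))" for n
    by (rule separated_finite[of _ 2]) (use sep2 in auto)
  ultimately show ?thesis by (metis countable_UN countable_finite countableI_type)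
qed

context
  assumes ne: "unit_tiles \<noteq> {}"
    and opposite: "\<And>t a b. t \<in> unit_tiles \<Longrightarrow> side t a b \<Longrightarrow> \<exists>t'\<in>unit_tiles. side t' b a"
begin

text \<open>At an inner point of a side, the tiles on both sides fill a disc, by
  \<open>opposite\<close>. At a centre no such local statement is available, so the centres are
  removed before connectedness is applied. What is then uncovered is open and contained in the
  countable set \<open>U\<close>, hence empty.\<close>

lemma TT_cover: "\<Union>unit_tiles = UNIV"
proof -
  let ?W = "\<Union>unit_tiles"
  have clo: "closed ?W"
  proof -
    have "x \<in> ?W" if "x \<in> closure ?W" for x
      using nonoverlapping_accumulation[OF TT_tile TT_nonoverlapping subset_refl that] by blast
    then show ?thesis by (metis closure_subset closure_eq subsetI subset_antisym)
  qed
  have int: "x \<in> interior ?W" if x: "x \<in> ?W" "x \<notin> U" for x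
  proof -
    obtain t where t: "t \<in> unit_tiles" "x \<in> t" using x by blast
    note tl = TT_tile[OF t(1)]
    show ?thesis
    proof (cases "x \<in> interior t")
      case True
      then show ?thesis using t interior_mono[of t ?W] by blast
    next
      case False
      then have "x \<in> frontier t" using t(2) closure_subset unfolding frontier_def by blast
      then obtain a b where ab: "side t a b" "x \<in> closed_segment a b" using tile_frontier_iff[OF tl] by blast
      have xo: "x \<in> open_segment a b" "x \<in> open_segment b a"
        using ab x(2) TT_side[OF t(1) ab(1)] unfolding open_segment_def closed_segment_commute[of b a] by auto
      obtain t' where t': "t' \<in> unit_tiles" "side t' b a" using opposite[OF t(1) ab(1)] by blast
      obtain e1 where e1: "0 < e1" "\<And>y. dist x y < e1 \<Longrightarrow> 0 \<le> cross a b y \<Longrightarrow> y \<in> t"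
        using side_near[OF tl ab(1) xo(1)] by metis
      obtain e2 where e2: "0 < e2" "\<And>y. dist x y < e2 \<Longrightarrow> 0 \<le> cross b a y \<Longrightarrow> y \<in> t'"
        using side_near[OF TT_tile[OF t'(1)] t'(2) xo(2)] by metis
      have "y \<in> ?W" if y: "y \<in> ball x (min e1 e2)" for y
        using e1(2)[of y] e2(2)[of y] y t(1) t'(1) cr_swap(1)[of b a y] by (cases "0 \<le> cross a b y") auto
      then show ?thesis using e1(1) e2(1) unfolding mem_interior by (metis min_less_iff_conj subsetI)
    qed
  qed
  have con: "connected (- U)"
    using path_connected_complement_countable[OF _ U_countable] path_connected_imp_connected by simp
  have "interior ?W \<inter> - U \<noteq> {}"
  proof -
    obtain t where t: "t \<in> unit_tiles" using ne by blast
    obtain x where x: "x \<in> interior t" using tile_interior_nonempty[OF TT_tile[OF t]] by blast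
    have "x \<in> interior ?W" using x t interior_mono[of t ?W] by blast
    then show ?thesis using x centre_notin_interior[OF t] by blast
  qed
  moreover have "interior ?W \<inter> - U = {} \<or> - ?W \<inter> - U = {}"
  proof (rule connectedD[OF con])
    show "open (- ?W)" using clo by auto
    show "interior ?W \<inter> - ?W \<inter> - U = {}" using interior_subset by blast
    show "- U \<subseteq> interior ?W \<union> - ?W" using int by blast
  qed auto
  ultimately have "- ?W \<subseteq> U" by blast
  have "- ?W = {}"
  proof (rule ccontr)
    assume "- ?W \<noteq> {}"
    then obtain x where x: "x \<in> - ?W" by (meson ex_in_conv)
    obtain e where e: "0 < e" "ball x e \<subseteq> - ?W" by (rule openE[OF open_Compl[OF clo] x])
    have "ball x e \<subseteq> U" using e(2) \<open>- ?W \<subseteq> U\<close> by (rule subset_trans)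
    then have "countable (ball x e)" using U_countable by (rule countable_subset)
    then show False using uncountable_ball[OF e(1)] by blast
  qed
  then show ?thesis by blast
qed

lemma components_TT: "closure ` components (UNIV - segs) = unit_tiles"
proof
  show "unit_tiles \<subseteq> closure ` components (UNIV - segs)"
    using interior_component tile_closure_interior[OF TT_tile] by (metis image_eqI subsetI)
  show "closure ` components (UNIV - segs) \<subseteq> unit_tiles"
  proof
    fix s assume "s \<in> closure ` components (UNIV - segs)"
    then obtain K where K: "K \<in> components (UNIV - segs)" "s = closure K" by blast
    obtain x where x: "x \<in> K" using in_components_nonempty[OF K(1)] by blast
    have xs: "x \<notin> segs" using in_components_subset[OF K(1)] x by blast
    obtain t where t: "t \<in> unit_tiles" "x \<in> t" using TT_cover by blast
    have "x \<notin> frontier t" using frontier_segs[OF t(1)] xs by blast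
    then have "x \<in> interior t" using t(2) closure_subset unfolding frontier_def by blast
    then have "K = interior t" using components_nonoverlap[OF K(1) interior_component[OF t(1)]] x by blast
    then show "s \<in> unit_tiles" using K(2) tile_closure_interior[OF TT_tile[OF t(1)]] t(1) by simp
  qed
qed

lemma TT_tiling: "tiling unit_tiles"
  unfolding tiling_def using TT_cover TT_nonoverlapping by blast

lemma U_extreme:
  assumes u: "u \<in> U"
  obtains t where "t \<in> unit_tiles" "u extreme_point_of t"
proof -
  obtain t where t: "t \<in> unit_tiles" "u \<in> t" using TT_cover by blast
  have "u \<in> frontier t" using centre_notin_interior[OF t(1) u] t(2) closure_subset unfolding frontier_def by blast
  then obtain a b where ab: "side t a b" "u \<in> closed_segment a b" using tile_frontier_iff[OF TT_tile[OF t(1)]] by blast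
  have "dist u a + dist u b = 2" using segment_parts[OF ab(2) side_dist[OF ab(1)]] .
  then have "u = a \<or> u = b" using sep2[OF u TT_side(1)[OF t(1) ab(1)]] sep2[OF u TT_side(2)[OF t(1) ab(1)]] by force
  then show thesis using that t side_ext[OF ab(1)] by blast
qed

end

end

section \<open>Compactness as a local condition\<close>

lemma packing_iff:
  "packing S \<longleftrightarrow> (\<forall>D\<in>S. snd D > 0) \<and> (\<forall>D\<in>S. \<forall>E\<in>S. D \<noteq> E \<longrightarrow> snd D + snd E \<le> dist (fst D) (fst E))"
proof -
  have "interior (cball (fst D) (snd D)) \<inter> interior (cball (fst E) (snd E)) = {} \<longleftrightarrow> snd D + snd E \<le> dist (fst D) (fst E)"
    if pos: "0 < snd D" "0 < snd E" for D E :: disc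
  proof
    let ?c = "fst D" and ?d = "fst E" and ?p = "snd D" and ?q = "snd E"
    assume *: "interior (cball ?c ?p) \<inter> interior (cball ?d ?q) = {}"
    show "?p + ?q \<le> dist ?c ?d"
    proof (rule ccontr)
      assume lt: "\<not> ?p + ?q \<le> dist ?c ?d"
      \<comment> \<open>\<open>z\<close> divides the segment between the centres in the ratio of the
        radii, which puts it into both open discs.\<close>
      define t where "t = ?p / (?p + ?q)"
      define z where "z = (1 - t) *\<^sub>R ?c + t *\<^sub>R ?d"
      have t: "0 < t" "0 < 1 - t" "t * (?p + ?q) = ?p" "(1 - t) * (?p + ?q) = ?q"
        using pos unfolding t_def by (simp_all add: field_simps)
      have "?c - z = t *\<^sub>R (?c - ?d)" "?d - z = (1 - t) *\<^sub>R (?d - ?c)" unfolding z_def by (simp_all add: algebra_simps)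
      then have "dist ?c z = t * dist ?c ?d" "dist ?d z = (1 - t) * dist ?c ?d"
        using t(1,2) by (simp_all add: dist_norm norm_minus_commute)
      moreover have "t * dist ?c ?d < t * (?p + ?q)" "(1 - t) * dist ?c ?d < (1 - t) * (?p + ?q)"
        using lt t(1,2) by (intro mult_strict_left_mono; simp)+
      ultimately have "z \<in> ball ?c ?p" "z \<in> ball ?d ?q" using t(3,4) by auto
      then show False using * by (auto simp: interior_cball)
    qed
  next
    assume "snd D + snd E \<le> dist (fst D) (fst E)"
    then have "x \<notin> ball (fst D) (snd D) \<inter> ball (fst E) (snd E)" for x
      using dist_triangle2[of "fst D" "fst E" x] by auto
    then show "interior (cball (fst D) (snd D)) \<inter> interior (cball (fst E) (snd E)) = {}"
      by (auto simp: interior_cball)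
  qed
  then show ?thesis unfolding packing_def pairwise_def by blast
qed

lemma tangent_sym: "tangent D E \<longleftrightarrow> tangent E D"
  unfolding tangent_def by (simp add: dist_commute add.commute)

text \<open>Law of cosines: cosine of the angle at a disc of radius \<open>d\<close> between
  neighbours of radii \<open>p\<close> and \<open>q\<close> that touch each other.\<close>

definition corona_cos :: "real \<Rightarrow> real \<Rightarrow> real \<Rightarrow> real" where
  "corona_cos d p q = ((d + p)^2 + (d + q)^2 - (p + q)^2) / (2 * (d + p) * (d + q))"

definition corona_angle :: "real \<Rightarrow> real \<Rightarrow> real \<Rightarrow> real" where "corona_angle d p q = arccos (corona_cos d p q)"

definition dangle :: "disc \<Rightarrow> disc \<Rightarrow> disc \<Rightarrow> real" where
  "dangle D E F = angle (fst E - fst D) (fst F - fst D)"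

lemma dangle_cos:
  assumes "tangent D E" "tangent D F" "0 < snd D" "0 < snd E" "0 < snd F"
  shows "dangle D E F = arccos (((snd D + snd E)^2 + (snd D + snd F)^2 - (dist (fst E) (fst F))^2) / (2 * (snd D + snd E) * (snd D + snd F)))"
proof -
  have n: "norm (fst E - fst D) = snd D + snd E" "norm (fst F - fst D) = snd D + snd F"
    using assms(1,2) unfolding tangent_def by (simp_all add: dist_norm norm_minus_commute)
  have ip: "(fst E - fst D) \<bullet> (fst F - fst D) = ((snd D + snd E)^2 + (snd D + snd F)^2 - (dist (fst E) (fst F))^2) / 2"
    using inner_dist[of "fst E" "fst F" "fst D"] assms(1,2) unfolding tangent_def by (simp add: dist_commute)
  show ?thesis unfolding dangle_def angle_def n ip by (simp only: divide_divide_eq_left mult.assoc)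
qed

lemma dangle_th:
  assumes "tangent D E" "tangent D F" "tangent E F" "0 < snd D" "0 < snd E" "0 < snd F"
  shows "dangle D E F = corona_angle (snd D) (snd E) (snd F)"
  using dangle_cos[OF assms(1,2,4-6)] assms(3) unfolding corona_angle_def corona_cos_def tangent_def by simp

text \<open>Moving the neighbours apart widens the angle. The bound on \<open>corona_cos\<close> and
  the triangle inequality keep the arguments of \<open>arccos\<close> between -1 and 1, where it is
  antitone.\<close>

lemma dangle_ge:
  assumes "tangent D E" "tangent D F" "snd E + snd F \<le> dist (fst E) (fst F)" "0 < snd D" "0 < snd E" "0 < snd F"
    and corona_cos: "corona_cos (snd D) (snd E) (snd F) \<le> 1"
  shows "corona_angle (snd D) (snd E) (snd F) \<le> dangle D E F"
proof -
  let ?d = "snd D" and ?e = "snd E" and ?f = "snd F"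
  let ?N = "(?d + ?e)^2 + (?d + ?f)^2 - (dist (fst E) (fst F))^2"
  have den: "0 < 2 * (?d + ?e) * (?d + ?f)" using assms by simp
  have "(?e + ?f)^2 \<le> (dist (fst E) (fst F))^2" using assms by (intro power_mono) auto
  then have le: "?N / (2 * (?d + ?e) * (?d + ?f)) \<le> corona_cos ?d ?e ?f"
    unfolding corona_cos_def using den by (intro divide_right_mono) auto
  have "dist (fst E) (fst F) \<le> (?d + ?e) + (?d + ?f)"
    using dist_triangle3[of "fst E" "fst F" "fst D"] assms(1,2) unfolding tangent_def by simp
  then have "(dist (fst E) (fst F))^2 \<le> ((?d + ?e) + (?d + ?f))^2" by (intro power_mono) auto
  then have "- (2 * (?d + ?e) * (?d + ?f)) \<le> ?N" by (simp add: power2_eq_square algebra_simps)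
  then have "- 1 \<le> ?N / (2 * (?d + ?e) * (?d + ?f))" using den by (simp add: le_divide_eq)
  then show ?thesis unfolding dangle_cos[OF assms(1,2,4-6)] corona_angle_def
    using le corona_cos by (intro arccos_le_arccos) auto
qed

lemma cr_Arg:
  "cross d e f = norm (e - d) * norm (f - d) * sin (Arg (f - d) - Arg (e - d))"
  "(e - d) \<bullet> (f - d) = norm (e - d) * norm (f - d) * cos (Arg (f - d) - Arg (e - d))"
proof -
  have e: "e - d = rcis (norm (e - d)) (Arg (e - d))" and f: "f - d = rcis (norm (f - d)) (Arg (f - d))"
    by (simp_all add: rcis_cmod_Arg)
  have re: "Re (e - d) = norm (e - d) * cos (Arg (e - d))" "Im (e - d) = norm (e - d) * sin (Arg (e - d))"
    "Re (f - d) = norm (f - d) * cos (Arg (f - d))" "Im (f - d) = norm (f - d) * sin (Arg (f - d))"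
    using arg_cong[OF e, of Re] arg_cong[OF e, of Im] arg_cong[OF f, of Re] arg_cong[OF f, of Im] by simp_all
  have "cross d e f = Re (e - d) * Im (f - d) - Im (e - d) * Re (f - d)" by (simp add: cross_def)
  then show "cross d e f = norm (e - d) * norm (f - d) * sin (Arg (f - d) - Arg (e - d))"
    unfolding re sin_diff by (simp add: algebra_simps)
  show "(e - d) \<bullet> (f - d) = norm (e - d) * norm (f - d) * cos (Arg (f - d) - Arg (e - d))"
    unfolding inner_complex_def re cos_diff by (simp add: algebra_simps)
qed

lemma angle_Arg:
  assumes "u \<noteq> 0" "v \<noteq> 0"
  shows "angle u v = arccos (cos (Arg v - Arg u))"
  using cr_Arg(2)[of u 0 v] assms unfolding angle_def by simp

lemma arccos_cos_le: "0 \<le> x \<Longrightarrow> arccos (cos x) \<le> x"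
  by (cases "x \<le> pi") (auto simp: arccos_cos intro: order_trans[OF arccos_ubound])

text \<open>Counterclockwise differences of sorted arguments; the step from the last to the first
  crosses the cut of \<open>Arg\<close>, hence the added 2 * pi.\<close>

definition gap :: "(nat \<Rightarrow> real) \<Rightarrow> nat \<Rightarrow> nat \<Rightarrow> real" where
  "gap a n i = (if Suc i < n then a (Suc i) - a i else a 0 + 2 * pi - a i)"

lemma sum_gap: "0 < n \<Longrightarrow> (\<Sum>i<n. gap a n i) = 2 * pi"
proof -
  assume "0 < n"
  then obtain m where n: "n = Suc m" by (cases n) auto
  have "(\<Sum>i<m. gap a n i) = (\<Sum>i<m. a (Suc i) - a i)"
    unfolding gap_def n by (intro sum.cong) auto
  also have "\<dots> = a m - a 0" by (rule sum_lessThan_telescope)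
  finally show ?thesis unfolding n by (simp add: gap_def)
qed

lemma cos_gap: "i < n \<Longrightarrow> cos (gap a n i) = cos (a (Suc i mod n) - a i)"
  and sin_gap: "i < n \<Longrightarrow> sin (gap a n i) = sin (a (Suc i mod n) - a i)"
proof -
  assume i: "i < n"
  have p: "gap a n i = a (Suc i mod n) - a i \<or> gap a n i = a (Suc i mod n) - a i + 2 * pi"
    using i unfolding gap_def by (cases "Suc i = n") auto
  then show "cos (gap a n i) = cos (a (Suc i mod n) - a i)" by (auto simp: cos_periodic)
  show "sin (gap a n i) = sin (a (Suc i mod n) - a i)" using p by (auto simp: sin_periodic)
qed

text \<open>The gaps between successive arguments always add up to 2 * pi, and each angle arccos
  (cos gap) is at most its gap. The prescribed sum forces equality throughout, so no gap exceeds pi,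
  and tangency excludes pi itself. Hence, seen from \<open>D\<close>, each disc lies to the left of
  its predecessor.\<close>

lemma surrounded_corona:
  assumes P: "packing S" and D: "D \<in> S" and s: "surrounded S D"
  obtains Ds where "set Ds = {E \<in> S. tangent D E}" "Ds \<noteq> []"
    "\<forall>i<length Ds. tangent (Ds ! i) (Ds ! (Suc i mod length Ds))"
    "\<forall>i<length Ds. 0 < cross (fst D) (fst (Ds ! i)) (fst (Ds ! (Suc i mod length Ds)))"
    "(\<Sum>i<length Ds. dangle D (Ds ! i) (Ds ! (Suc i mod length Ds))) = 2 * pi"
proof -
  obtain Ds where Ds: "set Ds = {E \<in> S. tangent D E}"
     "sorted_wrt (\<lambda>E F. Arg (fst E - fst D) < Arg (fst F - fst D)) Ds"
     "\<forall>i<length Ds. tangent (Ds ! i) (Ds ! (Suc i mod length Ds))"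
     "(\<Sum>i<length Ds. angle (fst (Ds ! i) - fst D) (fst (Ds ! (Suc i mod length Ds)) - fst D)) = 2 * pi"
    using s unfolding surrounded_def by blast
  let ?n = "length Ds"
  define a where "a i = Arg (fst (Ds ! i) - fst D)" for i
  have n: "0 < ?n" using Ds(4) by (cases Ds) auto
  have mem: "Ds ! i \<in> S" "tangent D (Ds ! i)" if "i < ?n" for i using Ds(1) that nth_mem by blast+
  have posr: "0 < snd E" if "E \<in> S" for E using P that unfolding packing_iff by blast
  have nz: "fst (Ds ! i) - fst D \<noteq> 0" if "i < ?n" for i
    using mem[OF that] posr[OF mem(1)[OF that]] posr[OF D] unfolding tangent_def by auto
  have mono: "a i < a j" if "i < j" "j < ?n" for i j
    using Ds(2) that unfolding sorted_wrt_iff_nth_less a_def by blast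
  have bnd: "- pi < a i" "a i \<le> pi" for i unfolding a_def using Arg_bounded by auto
  have gpos: "0 < gap a ?n i" if "i < ?n" for i
    using that mono[of i "Suc i"] bnd[of 0] bnd[of i] unfolding gap_def by auto
  have ang: "angle (fst (Ds ! i) - fst D) (fst (Ds ! (Suc i mod ?n)) - fst D) = arccos (cos (gap a ?n i))" if "i < ?n" for i
    using angle_Arg[OF nz[OF that] nz[of "Suc i mod ?n"]] n cos_gap[OF that] unfolding a_def by simp
  have "(\<Sum>i<?n. gap a ?n i - arccos (cos (gap a ?n i))) = 0"
    using sum_gap[OF n, of a] Ds(4) ang by (simp add: sum_subtractf)
  moreover have "0 \<le> gap a ?n i - arccos (cos (gap a ?n i))" if "i < ?n" for i
    using arccos_cos_le[of "gap a ?n i"] gpos[OF that] by simp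
  ultimately have "gap a ?n i = arccos (cos (gap a ?n i))" if "i < ?n" for i
    using that sum_nonneg_0[of "{..<?n}" "\<lambda>i. gap a ?n i - arccos (cos (gap a ?n i))" i] by simp
  then have gle: "gap a ?n i \<le> pi" if "i < ?n" for i
    using that arccos_ubound[of "cos (gap a ?n i)"] by (metis cos_ge_minus_one cos_le_one)
  show thesis
  proof (rule that[OF Ds(1)])
    show "Ds \<noteq> []" using n by auto
    show "\<forall>i<?n. tangent (Ds ! i) (Ds ! (Suc i mod ?n))" by (rule Ds(3))
    show "(\<Sum>i<?n. dangle D (Ds ! i) (Ds ! (Suc i mod ?n))) = 2 * pi" using Ds(4) unfolding dangle_def .
    show "\<forall>i<?n. 0 < cross (fst D) (fst (Ds ! i)) (fst (Ds ! (Suc i mod ?n)))"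
    proof (intro allI impI)
      fix i assume i: "i < ?n"
      let ?E = "Ds ! i" and ?F = "Ds ! (Suc i mod ?n)"
      have j: "Suc i mod ?n < ?n" using n by simp
      \<comment> \<open>Neighbours in opposite directions have the diameter of \<open>D\<close>
        between them and cannot touch.\<close>
      have "gap a ?n i \<noteq> pi"
      proof
        assume "gap a ?n i = pi"
        then have "cos (Arg (fst ?F - fst D) - Arg (fst ?E - fst D)) = - 1"
          using cos_gap[OF i, of a] unfolding a_def by simp
        then have "(dist (fst ?E) (fst ?F))^2 = (dist (fst ?E) (fst D) + dist (fst ?F) (fst D))^2"
          unfolding inner_dist[of "fst ?E" "fst ?F" "fst D"] cr_Arg(2)
          by (simp add: dist_norm power2_sum)
        then have "dist (fst ?E) (fst ?F) = dist (fst ?E) (fst D) + dist (fst ?F) (fst D)"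
          by (simp add: power2_eq_iff_nonneg)
        moreover have "dist (fst ?E) (fst ?F) = snd ?E + snd ?F" using Ds(3) i unfolding tangent_def by blast
        moreover have "dist (fst ?E) (fst D) = snd D + snd ?E" "dist (fst ?F) (fst D) = snd D + snd ?F"
          using mem(2)[OF i] mem(2)[OF j] unfolding tangent_def by (simp_all add: dist_commute)
        ultimately show False using posr[OF D] by simp
      qed
      then have "gap a ?n i < pi" using gle[OF i] by simp
      then have "0 < sin (gap a ?n i)" using gpos[OF i] by (intro sin_gt_zero) auto
      then show "0 < cross (fst D) (fst ?E) (fst ?F)" unfolding cr_Arg(1) using sin_gap[OF i, of a] nz[OF i] nz[OF j] unfolding a_def by simp
    qed
  qed
qed

text \<open>The pair is ordered: exchanging \<open>D\<close> and \<open>E\<close> gives the disc on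
  the other side.\<close>

definition left_closed :: "disc set \<Rightarrow> bool" where
  "left_closed S \<longleftrightarrow> (\<forall>D\<in>S. \<forall>E\<in>S. tangent D E \<longrightarrow>
     (\<exists>F\<in>S. tangent D F \<and> tangent E F \<and> 0 < cross (fst D) (fst E) (fst F)))"

lemma compact_left_closed:
  assumes "compact_packing S"
  shows "left_closed S"
  unfolding left_closed_def
proof (intro ballI impI)
  fix D E assume D: "D \<in> S" and E: "E \<in> S" and t: "tangent D E"
  have P: "packing S" and s: "surrounded S D" using assms D unfolding compact_packing_def by auto
  obtain Ds where Ds: "set Ds = {E \<in> S. tangent D E}" "Ds \<noteq> []"
    "\<forall>i<length Ds. tangent (Ds ! i) (Ds ! (Suc i mod length Ds))"
    "\<forall>i<length Ds. 0 < cross (fst D) (fst (Ds ! i)) (fst (Ds ! (Suc i mod length Ds)))"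
    "(\<Sum>i<length Ds. dangle D (Ds ! i) (Ds ! (Suc i mod length Ds))) = 2 * pi"
    by (rule surrounded_corona[OF P D s])
  have "E \<in> set Ds" using Ds(1) E t by simp
  then obtain i where i: "i < length Ds" "E = Ds ! i" by (auto simp: in_set_conv_nth)
  have "Ds ! (Suc i mod length Ds) \<in> set Ds" using Ds(2) by (intro nth_mem) simp
  then show "\<exists>F\<in>S. tangent D F \<and> tangent E F \<and> 0 < cross (fst D) (fst E) (fst F)"
    using Ds(1) Ds(3,4) i by auto
qed

section \<open>Recovering the cyclic list of neighbours from the left-hand condition\<close>

lemma angle_eq_gap:
  assumes "u \<noteq> 0" "v \<noteq> 0" "0 \<le> x" "x \<le> pi" "x = Arg v - Arg u \<or> x = Arg v - Arg u + 2 * pi"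
  shows "angle u v = x"
proof -
  have "cos (Arg v - Arg u) = cos x" using assms(5) by (auto simp: cos_periodic)
  then show ?thesis using assms by (simp add: angle_Arg arccos_cos)
qed

context ratio begin

lemma K_values:
  "corona_cos 1 1 1 = 1/2" "corona_cos 1 1 r = cos (alpha' r)" "corona_cos 1 r 1 = cos (alpha' r)" "corona_cos 1 r r = cos (beta r)"
  "corona_cos r r r = 1/2" "corona_cos r r 1 = cos gamma" "corona_cos r 1 r = cos gamma" "corona_cos r 1 1 = cos (pi - 2 * alpha' r)"
proof -
  have r1: "1 + r \<noteq> 0" "r + 1 \<noteq> 0" "r \<noteq> 0" using r_gt by auto
  show "corona_cos 1 1 1 = 1/2" "corona_cos r r r = 1/2" unfolding corona_cos_def using r1 by (simp_all add: power2_eq_square)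
  show "corona_cos 1 1 r = cos (alpha' r)" "corona_cos 1 r 1 = cos (alpha' r)"
  proof -
    have "4 / (4 + 4 * r) = 1 / (1 + r)" using r_gt by (subst frac_eq_eq) auto
    then show "corona_cos 1 1 r = cos (alpha' r)" "corona_cos 1 r 1 = cos (alpha' r)"
      unfolding corona_cos_def cos_alpha' by (simp_all add: add.commute)
  qed
  show "corona_cos r r 1 = cos gamma" "corona_cos r 1 r = cos gamma"
  proof -
    have "4 * r / (4 + 4 * r) = r / (1 + r)" using r_gt by (subst frac_eq_eq) (auto simp: algebra_simps)
    then show "corona_cos r r 1 = cos gamma" "corona_cos r 1 r = cos gamma"
      unfolding corona_cos_def cos_gam using r1 by (simp_all add: add.commute power2_eq_square)
  qed
  have "cos (beta r) = 1 - 2 * (r / (1 + r))^2"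
    unfolding beta_gam by (simp add: cos_diff cos_double_cos cos_gam)
  moreover have "corona_cos 1 r r = (2 * (1 + r)^2 - 4 * r^2) / (2 * (1 + r)^2)"
    unfolding corona_cos_def by (simp add: power2_eq_square mult.assoc)
  ultimately show "corona_cos 1 r r = cos (beta r)"
    using r1 by (simp add: diff_divide_distrib power_divide)
  have "cos (pi - 2 * alpha' r) = 1 - 2 / (1 + r)^2"
    by (simp add: cos_diff cos_even)
  moreover have "corona_cos r 1 1 = (2 * (1 + r)^2 - 4) / (2 * (1 + r)^2)"
    unfolding corona_cos_def by (simp add: power2_eq_square mult.assoc add.commute)
  ultimately show "corona_cos r 1 1 = cos (pi - 2 * alpha' r)"
    using r1 by (simp add: diff_divide_distrib)
qed

lemma th_values:
  "corona_angle 1 1 1 = pi/3" "corona_angle 1 1 r = alpha' r" "corona_angle 1 r 1 = alpha' r" "corona_angle 1 r r = beta r"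
  "corona_angle r r r = pi/3" "corona_angle r r 1 = gamma" "corona_angle r 1 r = gamma" "corona_angle r 1 1 = pi - 2 * alpha' r"
proof -
  have "arccos (1/2) = pi/3" using arccos_cos[of "pi / 3"] cos_60 by simp
  then show "corona_angle 1 1 1 = pi/3" "corona_angle r r r = pi/3" unfolding corona_angle_def K_values by auto
  show "corona_angle 1 1 r = alpha' r" "corona_angle 1 r 1 = alpha' r"
    unfolding corona_angle_def K_values by (rule arccos_cos; use alpha'_bounds in linarith)+
  show "corona_angle r r 1 = gamma" "corona_angle r 1 r = gamma"
    unfolding corona_angle_def K_values by (rule arccos_cos; use gam_bounds pi_gt_zero in linarith)+
  show "corona_angle 1 r r = beta r"
    unfolding corona_angle_def K_values by (rule arccos_cos; use beta_gam gam_bounds pi_gt_zero in linarith)+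
  show "corona_angle r 1 1 = pi - 2 * alpha' r"
    unfolding corona_angle_def K_values by (rule arccos_cos; use alpha'_bounds in linarith)+
qed

lemma th_bounds:
  assumes "d \<in> {1, r}" "p \<in> {1, r}" "q \<in> {1, r}"
  shows "corona_cos d p q \<le> 1" "d = 1 \<Longrightarrow> pi / 6 < corona_angle d p q \<and> corona_angle d p q \<le> pi / 3"
    "d = r \<Longrightarrow> pi / 3 \<le> corona_angle d p q \<and> corona_angle d p q < pi / 2"
proof -
  show "corona_cos d p q \<le> 1" using assms K_values by auto
  have a: "pi / 4 < alpha' r" "alpha' r < 5 * pi / 18" and b: "2 * pi / 9 < beta r" "beta r < pi / 3"
    using alpha'_gam gam_bounds gam_7 beta_gam by linarith+
  show "pi / 6 < corona_angle d p q \<and> corona_angle d p q \<le> pi / 3" if "d = 1"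
    using assms(2,3) a b pi_gt_zero unfolding that by (elim insertE emptyE; simp add: th_values)
  show "pi / 3 \<le> corona_angle d p q \<and> corona_angle d p q < pi / 2" if "d = r"
    using assms(2,3) a gam_bounds pi_gt_zero unfolding that by (elim insertE emptyE; simp add: th_values)
qed

text \<open>By \<open>th_bounds\<close> the angles at one disc lie in (pi/6, pi/3] or in [pi/3,
  pi/2), so two of them always exceed a third.\<close>

lemma th_triangle:
  assumes "d \<in> {1, r}" "p \<in> {1, r}" "q \<in> {1, r}" "x \<in> {1, r}"
  shows "corona_angle d p q < corona_angle d p x + corona_angle d x q"
  using th_bounds[OF assms(1,2,3)] th_bounds[OF assms(1,2,4)] th_bounds[OF assms(1,4,3)] assms(1) pi_gt_zero
  by (elim insertE emptyE) auto

text \<open>The disc on the left of a neighbour must be its successor in the order of arguments: a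
  further neighbour in between would have to fit into a single angle, against
  \<open>th_triangle\<close>. So successive neighbours touch, each angle equals its gap, and the
  gaps add up to 2 * pi.\<close>

lemma surroundedI:
  assumes P: "packing S" and rad: "snd ` S \<subseteq> {1, r}" and D: "D \<in> S"
    and ne: "E0 \<in> S" "tangent D E0"
    and left: "\<And>E. E \<in> S \<Longrightarrow> tangent D E \<Longrightarrow> \<exists>F\<in>S. tangent D F \<and> tangent E F \<and> 0 < cross (fst D) (fst E) (fst F)"
  shows "surrounded S D"
proof -
  let ?N = "{E \<in> S. tangent D E}"
  define f where "f E = Arg (fst E - fst D)" for E :: disc
  have rd: "snd E \<in> {1, r}" if "E \<in> S" for E using rad that by blast
  have posr: "0 < snd E" if "E \<in> S" for E using P that unfolding packing_iff by blast
  have rge: "1/2 < snd E" "snd E \<le> 1" if "E \<in> S" for E using rd[OF that] r_gt r_lt by auto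
  have apart: "snd E + snd F \<le> dist (fst E) (fst F)" if "E \<in> S" "F \<in> S" "E \<noteq> F" for E F
    using P that unfolding packing_iff by blast
  have ge: "corona_angle (snd D) (snd E) (snd F) \<le> dangle D E F" if "E \<in> ?N" "F \<in> ?N" "E \<noteq> F" for E F
    using that D apart posr by (intro dangle_ge th_bounds(1) rd) auto
  have thpos: "0 < corona_angle (snd D) (snd E) (snd F)" if "E \<in> ?N" "F \<in> ?N" for E F
    using th_bounds(2,3)[of "snd D" "snd E" "snd F"] rd[OF D] rd[of E] rd[of F] that pi_gt_zero by fastforce
  have nz: "fst E - fst D \<noteq> 0" if "E \<in> ?N" for E
    using that posr[of E] posr[OF D] unfolding tangent_def by auto
  have dang: "dangle D E F = x" if "E \<in> ?N" "F \<in> ?N" "0 \<le> x" "x \<le> pi" "x = f F - f E \<or> x = f F - f E + 2 * pi" for E F x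
    unfolding dangle_def using that by (intro angle_eq_gap nz) (auto simp: f_def)
  \<comment> \<open>Two neighbours in the same direction would subtend the angle 0, below the
    positive minimum for distinct ones.\<close>
  have inj: "inj_on f ?N"
  proof (rule inj_onI, rule ccontr)
    fix E F assume EF: "E \<in> ?N" "F \<in> ?N" "f E = f F" "E \<noteq> F"
    then have "dangle D E F = 0" by (intro dang) auto
    then show False using ge[OF EF(1,2,4)] thpos[OF EF(1,2)] by simp
  qed
  have finc: "finite (fst ` ?N)"
  proof (rule separated_finite[of _ 1])
    show "1 \<le> dist x y" if xy: "x \<in> fst ` ?N" "y \<in> fst ` ?N" "x \<noteq> y" for x y
    proof -
      obtain E F where "E \<in> S" "F \<in> S" "x = fst E" "y = fst F" using xy by blast
      then show ?thesis using apart[of E F] rge[of E] rge[of F] xy(3) by force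
    qed
    have "fst E \<in> cball (fst D) 2" if "E \<in> ?N" for E
      using that rge(2)[of E] rge(2)[OF D] unfolding tangent_def by simp
    then have "fst ` ?N \<subseteq> cball (fst D) 2" by (rule image_subsetI)
    then show "bounded (fst ` ?N)" by (rule bounded_subset[OF bounded_cball])
  qed simp
  moreover have "inj_on fst ?N"
  proof (rule inj_onI, rule ccontr)
    fix E F :: disc assume EF: "E \<in> ?N" "F \<in> ?N" "fst E = fst F" "E \<noteq> F"
    then show False using apart[of E F] posr[of E] posr[of F] by simp
  qed
  ultimately have fin: "finite ?N" by (rule finite_imageD)
  define Ds where "Ds = map (inv_into ?N f) (sorted_list_of_set (f ` ?N))"
  let ?n = "length Ds"
  define a where "a i = f (Ds ! i)" for i
  have set: "set Ds = ?N" unfolding Ds_def using fin inj by (auto simp: image_image inv_into_into)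
  have fD: "map f Ds = sorted_list_of_set (f ` ?N)"
    unfolding Ds_def map_map by (rule map_idI) (use fin in \<open>simp add: f_inv_into_f\<close>)
  have "sorted_wrt (<) (map f Ds)" unfolding fD strict_sorted_iff by simp
  then have sorted: "sorted_wrt (\<lambda>E F. f E < f F) Ds" by (simp add: sorted_wrt_map)
  then have mono: "a i < a j" if "i < j" "j < ?n" for i j
    using that unfolding sorted_wrt_iff_nth_less a_def by blast
  have mem: "Ds ! i \<in> ?N" if "i < ?n" for i using set that nth_mem by blast
  have n: "0 < ?n" using set ne by (metis (mono_tags, lifting) empty_iff length_greater_0_conv list.set(1) mem_Collect_eq)
  have bnd: "- pi < a i" "a i \<le> pi" for i unfolding a_def f_def using Arg_bounded by auto
  have sinpos: "x < pi" if "0 < sin x" "0 < x" "x < 2 * pi" for x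
    using that sin_le_zero[of x] by (meson not_le)
  \<comment> \<open>Neighbour \<open>j\<close> strictly between the touching neighbours
    \<open>i\<close> and \<open>k\<close>: the partial angles \<open>x\<close> and \<open>y\<close>
    are at least their values under tangency, and these together exceed x + y.\<close>
  have between: False if ijk: "i < ?n" "j < ?n" "k < ?n" "tangent (Ds ! i) (Ds ! k)" "i \<noteq> j" "j \<noteq> k"
      and x: "0 < x" "x = a j - a i \<or> x = a j - a i + 2 * pi"
      and y: "0 < y" "y = a k - a j \<or> y = a k - a j + 2 * pi"
      and xy: "x + y < pi" "x + y = a k - a i \<or> x + y = a k - a i + 2 * pi" for i j k x y
  proof -
    have ne: "Ds ! i \<noteq> Ds ! j" "Ds ! j \<noteq> Ds ! k"
      using ijk mono[of i j] mono[of j i] mono[of j k] mono[of k j] unfolding a_def by (metis linorder_neqE_nat less_irrefl)+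
    have "dangle D (Ds ! i) (Ds ! j) = x" "dangle D (Ds ! j) (Ds ! k) = y" "dangle D (Ds ! i) (Ds ! k) = x + y"
      using ijk x y xy mem unfolding a_def by (intro dang; simp)+
    moreover have "dangle D (Ds ! i) (Ds ! k) = corona_angle (snd D) (snd (Ds ! i)) (snd (Ds ! k))"
      using mem ijk posr D by (intro dangle_th) auto
    moreover have "corona_angle (snd D) (snd (Ds ! i)) (snd (Ds ! k)) <
        corona_angle (snd D) (snd (Ds ! i)) (snd (Ds ! j)) + corona_angle (snd D) (snd (Ds ! j)) (snd (Ds ! k))"
      using mem ijk D by (intro th_triangle rd) auto
    ultimately show False
      using ge[OF mem[OF ijk(1)] mem[OF ijk(2)] ne(1)] ge[OF mem[OF ijk(2)] mem[OF ijk(3)] ne(2)] by linarith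
  qed
  have step: "tangent (Ds ! i) (Ds ! (Suc i mod ?n)) \<and> 0 < gap a ?n i \<and> gap a ?n i < pi" if i: "i < ?n" for i
  proof -
    obtain F where F: "F \<in> S" "tangent D F" "tangent (Ds ! i) F" "0 < cross (fst D) (fst (Ds ! i)) (fst F)"
      using left mem[OF i] by blast
    have "F \<in> set Ds" using set F by blast
    then obtain j where j: "j < ?n" "F = Ds ! j" by (auto simp: in_set_conv_nth)
    have "0 < norm (fst (Ds ! i) - fst D) * norm (fst (Ds ! j) - fst D)"
      using nz[OF mem[OF i]] nz[OF mem[OF j(1)]] by simp
    then have "0 < sin (a j - a i)"
      using F(4) zero_less_mult_pos unfolding cr_Arg(1) j(2) a_def f_def by blast
    then have s: "0 < sin (a j - a i)" "0 < sin (a j - a i + 2 * pi)" by (simp_all add: sin_periodic)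
    have "i \<noteq> j" using s by auto
    \<comment> \<open>In the first and fourth case \<open>j\<close> is the cyclic successor of
      \<open>i\<close>. In the others a neighbour is skipped, namely \<open>Suc i\<close>, or 0 when
      \<open>i\<close> is the last index; in the third and fifth the angle from \<open>i\<close> to
      \<open>j\<close> crosses the cut.\<close>
    then consider "Suc i = j" | "Suc i < j" | "j < i" "Suc i < ?n" | "Suc i = ?n" "j = 0" | "Suc i = ?n" "0 < j" "j < i"
      using i j(1) by linarith
    then show ?thesis
    proof cases
      case 1
      have "a j - a i < pi" using mono[of i j] bnd[of i] bnd[of j] 1 j by (intro sinpos[OF s(1)]) auto
      then show ?thesis using 1 F(3) j mono[of i j] unfolding gap_def by auto
    next
      case 2
      have "a j - a i < pi" using mono[of i j] bnd[of i] bnd[of j] 2 j by (intro sinpos[OF s(1)]) auto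
      then have False
        using 2 i j F(3) mono[of i "Suc i"] mono[of "Suc i" j]
        by (intro between[of i "Suc i" j "a (Suc i) - a i" "a j - a (Suc i)"]) auto
      then show ?thesis ..
    next
      case 3
      have "a j - a i + 2 * pi < pi" using mono[of j i] bnd[of i] bnd[of j] 3 i by (intro sinpos[OF s(2)]) auto
      then have False
        using 3 i j F(3) mono[of i "Suc i"] bnd[of "Suc i"] bnd[of j]
        by (intro between[of i "Suc i" j "a (Suc i) - a i" "a j - a (Suc i) + 2 * pi"]) auto
      then show ?thesis ..
    next
      case 4
      have "a 0 - a i + 2 * pi < pi" using \<open>i \<noteq> j\<close> mono[of 0 i] bnd[of i] bnd[of 0] 4 i s by (intro sinpos) auto
      then show ?thesis using 4 F(3) j bnd[of i] bnd[of 0] unfolding gap_def by auto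
    next
      case 5
      have "a j - a i + 2 * pi < pi" using mono[of j i] bnd[of i] bnd[of j] 5 i by (intro sinpos[OF s(2)]) auto
      then have False
        using 5 i j F(3) mono[of 0 j] bnd[of 0] bnd[of i]
        by (intro between[of i 0 j "a 0 - a i + 2 * pi" "a j - a 0"]) auto
      then show ?thesis ..
    qed
  qed
  have "(\<Sum>i<?n. dangle D (Ds ! i) (Ds ! (Suc i mod ?n))) = (\<Sum>i<?n. gap a ?n i)"
  proof (rule sum.cong)
    fix i assume "i \<in> {..<?n}"
    then have i: "i < ?n" by simp
    have "gap a ?n i = a (Suc i mod ?n) - a i \<or> gap a ?n i = a (Suc i mod ?n) - a i + 2 * pi"
      using i unfolding gap_def by (cases "Suc i = ?n") auto
    then show "dangle D (Ds ! i) (Ds ! (Suc i mod ?n)) = gap a ?n i"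
      using step[OF i] mem[OF i] mem[of "Suc i mod ?n"] n unfolding a_def by (intro dang) auto
  qed simp
  also have "\<dots> = 2 * pi" by (rule sum_gap[OF n])
  finally show ?thesis unfolding surrounded_def
    using set sorted step unfolding f_def dangle_def by blast
qed

text \<open>\<open>left_closed\<close> is vacuous at a disc without neighbours, while
  \<open>surrounded\<close> fails there; hence the assumption \<open>ne\<close>.\<close>

lemma compactI:
  assumes P: "packing S" and rad: "snd ` S \<subseteq> {1, r}" and l: "left_closed S"
    and ne: "\<And>D. D \<in> S \<Longrightarrow> \<exists>E\<in>S. tangent D E"
  shows "compact_packing S"
  unfolding compact_packing_def
proof (intro conjI ballI)
  fix D assume D: "D \<in> S"
  obtain E where "E \<in> S" "tangent D E" using ne[OF D] by blast
  then show "surrounded S D"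
    using l D unfolding left_closed_def by (intro surroundedI[OF P rad D]) blast+
qed (rule P)

end

section \<open>Coronas of small discs\<close>

lemma tri_ext: "norm w = 1 \<Longrightarrow> v extreme_point_of triangle a w \<longleftrightarrow> (\<exists>i<3. v = motion a w (triv ! i))"
  unfolding tri_hull ext_eq[OF good_mv[OF good_triv]]
  by (auto simp: in_set_conv_nth image_iff) (metis length_triv nth_mem)

lemma tri_side: "norm w = 1 \<Longrightarrow> side (triangle a w) x y \<longleftrightarrow> (\<exists>i<3. x = motion a w (triv ! i) \<and> y = motion a w (triv ! (Suc i mod 3)))"
  unfolding tri_hull side_iff[OF good_mv[OF good_triv]] by (auto simp: succ_vertex_def)

lemma card_ext: "good_polygon vs \<Longrightarrow> card {v. v extreme_point_of convex hull set vs} = length vs"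
  using good_convex_polygon[of vs] unfolding convex_polygon_def by (simp add: distinct_card)

definition cis60 :: complex where "cis60 = Complex (1/2) (sqrt 3/2)"

lemma norm_cis60: "norm cis60 = 1"
  by (simp add: cis60_def cmod_def power_divide)

context ratio begin

lemma r_neq_1: "r \<noteq> 1" "1 \<noteq> r" using r_lt by auto

text \<open>Each term is pi/3, \<open>gamma\<close> or 5 * pi / 6 - \<open>gamma\<close>. For the
  cyclic shifts of r, r, 1, 1, 1 the \<open>gamma\<close> cancels and the sum is 2 * pi; for all
  other patterns the bounds on \<open>gamma\<close> exclude this value.\<close>

lemma corona_radii:
  assumes "p0 \<in> {1, r}" "p1 \<in> {1, r}" "p2 \<in> {1, r}" "p3 \<in> {1, r}" "p4 \<in> {1, r}"
    and s: "corona_angle r p0 p1 + corona_angle r p1 p2 + corona_angle r p2 p3 + corona_angle r p3 p4 + corona_angle r p4 p0 = 2 * pi"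
  shows "(p0, p1, p2, p3, p4) \<in> {(r, r, 1, 1, 1), (1, r, r, 1, 1), (1, 1, r, r, 1), (1, 1, 1, r, r), (r, 1, 1, 1, r)}"
proof -
  have b: "pi / 3 < gamma" "gamma < 7 * pi / 18" using gam_bounds gam_7 by auto
  have t: "corona_angle r r r = pi/3" "corona_angle r r 1 = gamma" "corona_angle r 1 r = gamma" "corona_angle r 1 1 = 5 * pi / 6 - gamma"
    using th_values alpha'_gam by auto
  show ?thesis using assms(1-5)
  proof (elim insertE emptyE, goal_cases)
  qed (use s b in \<open>simp_all add: t r_neq_1; linarith\<close>)+
qed

text \<open>Angles at a small disc lie in [pi/3, pi/2), so there are five or six neighbours. Six
  would force every angle to be pi/3, impossible next to a unit disc; five are settled by
  \<open>corona_radii\<close>, up to rotation of the list.\<close>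

lemma corona:
  assumes P: "packing S" and rad: "snd ` S \<subseteq> {1, r}" and D: "D \<in> S" "snd D = r" and sur: "surrounded S D"
    and big: "X \<in> S" "tangent D X" "snd X = 1"
  obtains R1 R2 A B C where "R1 \<in> S" "R2 \<in> S" "A \<in> S" "B \<in> S" "C \<in> S"
    "{E \<in> S. tangent D E} = {R1, R2, A, B, C}" "snd R1 = r" "snd R2 = r" "snd A = 1" "snd B = 1" "snd C = 1"
    "tangent R1 R2" "tangent R2 A" "tangent A B" "tangent B C"
    "0 < cross (fst D) (fst R1) (fst R2)" "0 < cross (fst D) (fst R2) (fst A)" "0 < cross (fst D) (fst A) (fst B)"
    "0 < cross (fst D) (fst B) (fst C)"
proof -
  obtain Ds where Ds: "set Ds = {E \<in> S. tangent D E}" "Ds \<noteq> []"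
    and tg: "\<forall>i<length Ds. tangent (Ds ! i) (Ds ! (Suc i mod length Ds))"
    and lf: "\<forall>i<length Ds. 0 < cross (fst D) (fst (Ds ! i)) (fst (Ds ! (Suc i mod length Ds)))"
    and sum: "(\<Sum>i<length Ds. dangle D (Ds ! i) (Ds ! (Suc i mod length Ds))) = 2 * pi"
    by (rule surrounded_corona[OF P D(1) sur])
  define n where "n = length Ds"
  define p where "p i = snd (Ds ! i)" for i
  have n0: "0 < n" using Ds(2) unfolding n_def by simp
  have mem: "Ds ! i \<in> S" "tangent D (Ds ! i)" if "i < n" for i
    using Ds(1) that nth_mem unfolding n_def by blast+
  have rd: "p i \<in> {1, r}" if "i < n" for i using mem(1)[OF that] rad unfolding p_def by blast
  have posr: "0 < snd E" if "E \<in> S" for E using P that unfolding packing_iff by blast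
  have m: "Suc i mod n < n" for i using n0 by simp
  have da: "dangle D (Ds ! i) (Ds ! (Suc i mod n)) = corona_angle r (p i) (p (Suc i mod n))" if i: "i < n" for i
    using dangle_th[OF mem(2)[OF i] mem(2)[OF m]] tg i posr[OF D(1)] posr[OF mem(1)[OF i]] posr[OF mem(1)[OF m]] D(2)
    unfolding p_def n_def by simp
  have bnd: "pi / 3 \<le> corona_angle r (p i) (p (Suc i mod n))" "corona_angle r (p i) (p (Suc i mod n)) < pi / 2" if "i < n" for i
    using th_bounds(3)[OF _ rd[OF that] rd[OF m], of r] by auto
  have sum': "(\<Sum>i<n. corona_angle r (p i) (p (Suc i mod n))) = 2 * pi"
    using sum da unfolding n_def by simp
  have "(\<Sum>i<n. pi / 3) \<le> (\<Sum>i<n. corona_angle r (p i) (p (Suc i mod n)))" using bnd by (intro sum_mono) auto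
  then have "real n * (pi / 3) \<le> 6 * (pi / 3)" unfolding sum' by simp
  then have n6: "n \<le> 6" using pi_gt_zero by (simp only: mult_le_cancel_right_pos) 
  have "(\<Sum>i<n. corona_angle r (p i) (p (Suc i mod n))) < (\<Sum>i<n. pi / 2)" using bnd n0 by (intro sum_strict_mono) auto
  then have "4 * (pi / 2) < real n * (pi / 2)" unfolding sum' by simp
  then have n4: "4 < n" using pi_gt_zero by (simp only: mult_less_cancel_right_pos) 
  have "n \<noteq> 6"
  proof
    assume n: "n = 6"
    have "X \<in> set Ds" using Ds(1) big by blast
    then obtain i where i: "i < n" "X = Ds ! i" unfolding n_def by (auto simp: in_set_conv_nth)
    have "(\<Sum>i<n. corona_angle r (p i) (p (Suc i mod n)) - pi / 3) = 0" using sum' n by (simp add: sum_subtractf)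
    then have "corona_angle r (p i) (p (Suc i mod n)) - pi / 3 = 0"
      by (rule sum_nonneg_0[rotated 2]) (use bnd i in auto)
    moreover have "p i = 1" using i big unfolding p_def by simp
    ultimately show False using rd[OF m, of i] th_values alpha'_gam gam_bounds by auto
  qed
  then have n5: "n = 5" using n4 n6 by simp
  have "corona_angle r (p 0) (p 1) + corona_angle r (p 1) (p 2) + corona_angle r (p 2) (p 3) + corona_angle r (p 3) (p 4) + corona_angle r (p 4) (p 0) = 2 * pi"
  proof -
    have "(\<Sum>i<(5::nat). g i) = g 0 + g 1 + g 2 + g 3 + g 4" for g :: "nat \<Rightarrow> real"
      by (simp add: eval_nat_numeral)
    then show ?thesis using sum' unfolding n5 by (simp add: numeral_2_eq_2)
  qed
  then have pat: "(p 0, p 1, p 2, p 3, p 4) \<in> {(r, r, 1, 1, 1), (1, r, r, 1, 1), (1, 1, r, r, 1), (1, 1, 1, r, r), (r, 1, 1, 1, r)}"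
    using rd n5 by (intro corona_radii) auto
  have setDs: "{E \<in> S. tangent D E} = {Ds ! 0, Ds ! 1, Ds ! 2, Ds ! 3, Ds ! 4}"
  proof -
    have "Ds = [Ds ! 0, Ds ! 1, Ds ! 2, Ds ! 3, Ds ! 4]"
      using n5 unfolding n_def by (intro nth_equalityI) (auto simp: less_Suc_eq eval_nat_numeral)
    then have "set Ds = {Ds ! 0, Ds ! 1, Ds ! 2, Ds ! 3, Ds ! 4}" by (metis list.set(1) list.simps(15))
    then show ?thesis using Ds(1) by simp
  qed
  have tg5: "tangent (Ds ! i) (Ds ! (Suc i mod 5))" if "i < 5" for i
    using tg that n5 unfolding n_def by simp
  have lf5: "0 < cross (fst D) (fst (Ds ! i)) (fst (Ds ! (Suc i mod 5)))" if "i < 5" for i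
    using lf that n5 unfolding n_def by simp
  have T: "tangent (Ds ! 0) (Ds ! 1)" "tangent (Ds ! 1) (Ds ! 2)" "tangent (Ds ! 2) (Ds ! 3)" "tangent (Ds ! 3) (Ds ! 4)" "tangent (Ds ! 4) (Ds ! 0)"
    subgoal using tg5[of 0] by simp
    subgoal using tg5[of 1] by (simp add: numeral_2_eq_2)
    subgoal using tg5[of 2] by simp
    subgoal using tg5[of 3] by simp
    subgoal using tg5[of 4] by simp
    done
  have L: "0 < cross (fst D) (fst (Ds ! 0)) (fst (Ds ! 1))" "0 < cross (fst D) (fst (Ds ! 1)) (fst (Ds ! 2))"
    "0 < cross (fst D) (fst (Ds ! 2)) (fst (Ds ! 3))" "0 < cross (fst D) (fst (Ds ! 3)) (fst (Ds ! 4))" "0 < cross (fst D) (fst (Ds ! 4)) (fst (Ds ! 0))"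
    subgoal using lf5[of 0] by simp
    subgoal using lf5[of 1] by (simp add: numeral_2_eq_2)
    subgoal using lf5[of 2] by simp
    subgoal using lf5[of 3] by simp
    subgoal using lf5[of 4] by simp
    done
  have M: "Ds ! 0 \<in> S" "Ds ! 1 \<in> S" "Ds ! 2 \<in> S" "Ds ! 3 \<in> S" "Ds ! 4 \<in> S" using mem n5 by simp_all
  have p: "snd (Ds ! i) = p i" for i unfolding p_def ..
  consider "p 0 = r" "p 1 = r" "p 2 = 1" "p 3 = 1" "p 4 = 1" | "p 0 = 1" "p 1 = r" "p 2 = r" "p 3 = 1" "p 4 = 1"
    | "p 0 = 1" "p 1 = 1" "p 2 = r" "p 3 = r" "p 4 = 1" | "p 0 = 1" "p 1 = 1" "p 2 = 1" "p 3 = r" "p 4 = r"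
    | "p 0 = r" "p 1 = 1" "p 2 = 1" "p 3 = 1" "p 4 = r"
    using pat by auto
  then show thesis
  proof cases
    case 1
    show ?thesis by (rule that[of "Ds ! 0" "Ds ! 1" "Ds ! 2" "Ds ! 3" "Ds ! 4"]) (use 1 M setDs T L in \<open>simp_all only: p\<close>)
  next
    case 2
    have s: "{E \<in> S. tangent D E} = {Ds ! 1, Ds ! 2, Ds ! 3, Ds ! 4, Ds ! 0}" using setDs by blast
    show ?thesis by (rule that[of "Ds ! 1" "Ds ! 2" "Ds ! 3" "Ds ! 4" "Ds ! 0"]) (use 2 M s T L in \<open>simp_all only: p\<close>)
  next
    case 3
    have s: "{E \<in> S. tangent D E} = {Ds ! 2, Ds ! 3, Ds ! 4, Ds ! 0, Ds ! 1}" using setDs by blast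
    show ?thesis by (rule that[of "Ds ! 2" "Ds ! 3" "Ds ! 4" "Ds ! 0" "Ds ! 1"]) (use 3 M s T L in \<open>simp_all only: p\<close>)
  next
    case 4
    have s: "{E \<in> S. tangent D E} = {Ds ! 3, Ds ! 4, Ds ! 0, Ds ! 1, Ds ! 2}" using setDs by blast
    show ?thesis by (rule that[of "Ds ! 3" "Ds ! 4" "Ds ! 0" "Ds ! 1" "Ds ! 2"]) (use 4 M s T L in \<open>simp_all only: p\<close>)
  next
    case 5
    have s: "{E \<in> S. tangent D E} = {Ds ! 4, Ds ! 0, Ds ! 1, Ds ! 2, Ds ! 3}" using setDs by blast
    show ?thesis by (rule that[of "Ds ! 4" "Ds ! 0" "Ds ! 1" "Ds ! 2" "Ds ! 3"]) (use 5 M s T L in \<open>simp_all only: p\<close>)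
  qed
qed

lemma corona_two_small:
  assumes P: "packing S" and rad: "snd ` S \<subseteq> {1, r}" and D: "D \<in> S" "snd D = r" and sur: "surrounded S D"
    and big: "X \<in> S" "tangent D X" "snd X = 1"
  shows "\<exists>R1 R2. \<forall>Z\<in>S. tangent D Z \<longrightarrow> snd Z = r \<longrightarrow> Z = R1 \<or> Z = R2"
proof (rule corona[OF assms])
  fix R1 R2 A B C
  assume N: "{E \<in> S. tangent D E} = {R1, R2, A, B, C}" and s: "snd A = 1" "snd B = 1" "snd C = 1"
  have "Z = R1 \<or> Z = R2" if "Z \<in> S" "tangent D Z" "snd Z = r" for Z
  proof -
    have "Z \<in> {R1, R2, A, B, C}" using that N by blast
    then show ?thesis using that s r_neq_1 by auto
  qed
  then show ?thesis by blast
qed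

section \<open>Excluding the triangular lattice of small discs\<close>

lemma hexagonal_step:
  assumes "dist X Y = 2 * r" "dist X Z = 2 * r" "dist Y Z = 2 * r" "0 < cross X Y Z"
  shows "Z = X + cis60 * (Y - X)"
proof (rule left_unique[of X _ _ Y])
  have Y: "norm (Y - X) = 2 * r" using assms(1) by (simp add: dist_norm norm_minus_commute)
  show "dist X Z = dist X (X + cis60 * (Y - X))"
    using assms(2) Y by (simp add: dist_norm norm_mult norm_cis60)
  have "Y - (X + cis60 * (Y - X)) = (1 - cis60) * (Y - X)" by (simp add: algebra_simps)
  moreover have "norm (1 - cis60) = 1" by (simp add: cis60_def cmod_def power_divide)
  ultimately show "dist Y Z = dist Y (X + cis60 * (Y - X))"
    using assms(3) Y by (simp add: dist_norm norm_mult)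
  show "0 < cross X Y Z" by fact
  have "cross X Y (X + cis60 * (Y - X)) = sqrt 3 / 2 * ((Re Y - Re X)^2 + (Im Y - Im X)^2)"
    unfolding cross_def cis60_def by (simp add: field_simps power2_eq_square)
  also have "(Re Y - Re X)^2 + (Im Y - Im X)^2 = (2 * r)^2" using dist_sq[of Y X] assms(1) by (simp add: dist_commute)
  finally show "0 < cross X Y (X + cis60 * (Y - X))" using r_gt by simp
qed

text \<open>The hypotheses say that \<open>v\<close> is at least as near to 0 as to six lattice
  points around it. The squares of its inner products with unit vectors in three directions at
  angles of pi/3 add up to 3/2 of its squared length, which bounds \<open>norm v\<close>.\<close>

lemma hexagonal_norm:
  assumes u: "norm u = 2 * r" and b: "\<bar>v \<bullet> u\<bar> \<le> 2 * r^2" "\<bar>v \<bullet> (cis60 * u)\<bar> \<le> 2 * r^2" "\<bar>v \<bullet> (cis60 * (cis60 * u))\<bar> \<le> 2 * r^2"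
  shows "(norm v)^2 \<le> 2 * r^2"
proof -
  define x y z where "x = v \<bullet> u" "y = v \<bullet> (cis60 * u)" "z = v \<bullet> (cis60 * (cis60 * u))"
  have "cis60 * (cis60 * u) = cis60 * u - u"
    by (simp add: cis60_def complex_eq_iff field_simps)
  then have z: "z = y - x" unfolding x_y_z_def by (simp add: inner_diff_right)
  have sq: "t^2 \<le> (2 * r^2)^2" if "\<bar>t\<bar> \<le> 2 * r^2" for t using power_mono[OF that, of 2] by simp
  have "3 * ((norm v)^2 * (norm u)^2) = 2 * (x^2 + y^2 + z^2)"
    unfolding z cmod_power2 unfolding x_y_z_def inner_complex_def cis60_def
    by (simp add: power2_eq_square field_simps)
  also have "\<dots> \<le> 2 * ((2 * r^2)^2 + (2 * r^2)^2 + (2 * r^2)^2)"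
    using sq b unfolding x_y_z_def by (intro mult_left_mono add_mono) auto
  finally have "(norm v)^2 * (12 * r^2) \<le> (2 * r^2) * (12 * r^2)" unfolding u by (simp add: power2_eq_square algebra_simps)
  then show ?thesis using r_gt by (simp only: mult_le_cancel_right) auto
qed

text \<open>Otherwise the small discs with only small neighbours would form a whole triangular lattice;
  among them, the one nearest to a fixed unit disc has a neighbour still nearer.\<close>

lemma has_big_neighbour:
  assumes S: "S \<in> compact_packings_1 r" and D: "D \<in> S" "snd D = r"
  shows "\<exists>X\<in>S. tangent D X \<and> snd X = 1"
proof (rule ccontr)
  assume no: "\<not> (\<exists>X\<in>S. tangent D X \<and> snd X = 1)"
  have cp: "compact_packing S" and rad: "snd ` S = {1, r}" using S unfolding compact_packings_1_def by auto
  have P: "packing S" and sur: "\<And>D. D \<in> S \<Longrightarrow> surrounded S D" using cp unfolding compact_packing_def by auto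
  have lc: "left_closed S" by (rule compact_left_closed[OF cp])
  have rd: "snd E \<in> {1, r}" if "E \<in> S" for E using rad that by blast
  have apart: "snd E + snd F \<le> dist (fst E) (fst F)" if "E \<in> S" "F \<in> S" "E \<noteq> F" for E F
    using P that unfolding packing_iff by blast
  define W where "W = {D \<in> S. snd D = r \<and> (\<forall>E\<in>S. tangent D E \<longrightarrow> snd E = r)}"
  have DW: "D \<in> W" unfolding W_def using D no rd by blast
  \<comment> \<open>If \<open>E\<close> had a unit neighbour, only two of its neighbours would be
    small; but \<open>X\<close> and the discs on both sides of the pair \<open>X\<close>,
    \<open>E\<close> are three.\<close>
  have closed: "E \<in> W" if X: "X \<in> W" and E: "E \<in> S" "tangent X E" for X E
  proof (rule ccontr)
    have X': "X \<in> S" "snd X = r" "snd E = r" using X E unfolding W_def by auto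
    assume "E \<notin> W"
    then obtain Y where Y: "Y \<in> S" "tangent E Y" "snd Y = 1" unfolding W_def using E X' rd by blast
    obtain F where F: "F \<in> S" "tangent X F" "tangent E F" "0 < cross (fst X) (fst E) (fst F)"
      using lc X' E unfolding left_closed_def by blast
    obtain G where G: "G \<in> S" "tangent E G" "tangent X G" "0 < cross (fst E) (fst X) (fst G)"
      using lc X' E tangent_sym[of X E] unfolding left_closed_def by blast
    have sm: "snd F = r" "snd G = r" using X F G unfolding W_def by auto
    have dist: "F \<noteq> G" "X \<noteq> F" "X \<noteq> G" using F(4) G(4) cr_swap(1)[of "fst E" "fst X" "fst G"] by auto
    obtain R1 R2 where "\<And>Z. Z \<in> S \<Longrightarrow> tangent E Z \<Longrightarrow> snd Z = r \<Longrightarrow> Z = R1 \<or> Z = R2"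
      using corona_two_small[OF P _ E(1) X'(3) sur[OF E(1)] Y] rad by blast
    from this[of X] this[of F] this[of G] show False using dist sm X' E(2) tangent_sym[of X E] F(1,3) G(1,2) by auto
  qed
  obtain c where c: "c \<in> S" "snd c = 1" using rad by (metis image_iff insertI1)
  define f where "f X = dist (fst c) (fst X)" for X :: disc
  let ?B = "{X \<in> W. f X \<le> f D}"
  have "finite (fst ` ?B)"
  proof (rule separated_finite[of _ 1])
    show "1 \<le> dist x y" if xy: "x \<in> fst ` ?B" "y \<in> fst ` ?B" "x \<noteq> y" for x y
    proof -
      obtain E F where "E \<in> S" "F \<in> S" "x = fst E" "y = fst F" "snd E = r" "snd F = r" using xy unfolding W_def by blast
      then show ?thesis using apart[of E F] xy(3) r_gt by force
    qed
    have "fst ` ?B \<subseteq> cball (fst c) (f D)" unfolding f_def by auto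
    then show "bounded (fst ` ?B)" by (rule bounded_subset[OF bounded_cball])
  qed simp
  moreover have "inj_on fst ?B" unfolding W_def by (rule inj_onI) (auto simp: prod_eq_iff)
  ultimately have fin: "finite ?B" by (rule finite_imageD)
  then obtain X where X: "X \<in> ?B" "\<And>Y. Y \<in> ?B \<Longrightarrow> f X \<le> f Y"
    using DW ex_min_if_finite[of "f ` ?B"] by (metis (mono_tags, lifting) arg_min_if_finite(1) arg_min_least empty_iff mem_Collect_eq order_refl)
  have XW: "X \<in> W" using X by simp
  have min: "f X \<le> f Y" if "Y \<in> W" for Y using X that by (cases "f Y \<le> f D") auto
  have XS: "X \<in> S" "snd X = r" using XW unfolding W_def by auto
  \<comment> \<open>The disc to the left of \<open>X\<close> and a small neighbour is that neighbour
    turned by pi/3 about \<open>X\<close>; six such turns close up around \<open>X\<close>.\<close>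
  have step: "(fst X + cis60 * u, r) \<in> W" if u: "norm u = 2 * r" "(fst X + u, r) \<in> W" for u
  proof -
    let ?E = "(fst X + u, r)"
    have E: "?E \<in> S" "tangent X ?E" using u XS unfolding W_def tangent_def by (simp_all add: dist_norm)
    obtain F where F: "F \<in> S" "tangent X F" "tangent ?E F" "0 < cross (fst X) (fst ?E) (fst F)"
      using lc XS E unfolding left_closed_def by blast
    have FW: "F \<in> W" using closed[OF XW F(1,2)] .
    then have "snd F = r" unfolding W_def by simp
    then have "fst F = fst X + cis60 * (fst ?E - fst X)"
      using E(2) F(2-4) XS by (intro hexagonal_step) (simp_all add: tangent_def)
    then have "F = (fst X + cis60 * u, r)" using \<open>snd F = r\<close> by (simp add: prod_eq_iff)
    then show ?thesis using FW by simp
  qed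
  obtain Ds where "set Ds = {E \<in> S. tangent X E}" "Ds \<noteq> []"
    using surrounded_corona[OF P XS(1) sur[OF XS(1)]] by metis
  then obtain E where E: "E \<in> S" "tangent X E" by (metis (mono_tags, lifting) list.set_intros(1) mem_Collect_eq neq_Nil_conv)
  define u where "u = fst E - fst X"
  have EW: "E \<in> W" using closed[OF XW E] .
  then have "snd E = r" unfolding W_def by simp
  then have u: "norm u = 2 * r" "(fst X + u, r) \<in> W"
    using E(2) EW XS unfolding u_def tangent_def by (simp_all add: dist_norm norm_minus_commute prod_eq_iff) (metis prod.collapse)
  define v where "v = fst c - fst X"
  \<comment> \<open>Minimality of \<open>X\<close>: the unit centre is at least as near to
    \<open>X\<close> as to each lattice neighbour.\<close>
  have half: "v \<bullet> u \<le> 2 * r^2" if u: "norm u = 2 * r" "(fst X + u, r) \<in> W" for u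
  proof -
    have "dist (fst c) (fst X) \<le> dist (fst c) (fst X + u)" using min[OF u(2)] unfolding f_def by simp
    then have "norm v \<le> norm (v - u)" unfolding v_def dist_norm by (simp add: algebra_simps)
    then have "(norm v)^2 \<le> (norm (v - u))^2" by (intro power_mono) auto
    then show ?thesis using u(1) dot_norm_neg[of v u] by (simp add: power2_eq_square)
  qed
  have n: "norm (cis60 * w) = norm w" for w by (simp add: norm_mult norm_cis60)
  have c3: "cis60 * (cis60 * (cis60 * w)) = - w" for w
    by (simp add: cis60_def complex_eq_iff field_simps)
  have u1: "(fst X + cis60 * u, r) \<in> W" using step u by blast
  then have u2: "(fst X + cis60 * (cis60 * u), r) \<in> W" using step[of "cis60 * u"] u n by simp
  then have u3: "(fst X + - u, r) \<in> W" using step[of "cis60 * (cis60 * u)"] u n c3 by simp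
  then have u4: "(fst X + - (cis60 * u), r) \<in> W" using step[of "- u"] u by simp
  then have u5: "(fst X + - (cis60 * (cis60 * u)), r) \<in> W" using step[of "- (cis60 * u)"] u n by simp
  have abs: "\<bar>v \<bullet> w\<bar> \<le> 2 * r^2" if "norm w = 2 * r" "(fst X + w, r) \<in> W" "(fst X + - w, r) \<in> W" for w
    using half[OF that(1,2)] half[of "- w"] that by (simp add: abs_le_iff)
  have "(norm v)^2 \<le> 2 * r^2"
    using hexagonal_norm[OF u(1)] abs u u1 u2 u3 u4 u5 n by simp
  \<comment> \<open>A unit disc cannot be so close, as (1 + r)^2 exceeds 2 * r^2.\<close>
  moreover have "1 + r \<le> norm v"
    using apart[of c X] c XS r_neq_1 unfolding v_def by (auto simp: dist_norm)
  then have "(1 + r)^2 \<le> (norm v)^2" using r_gt by (intro power_mono) auto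
  moreover have "(1 + r)^2 = 2 * r^2 + 1 + r * (2 - r)" by (simp add: power2_eq_square algebra_simps)
  moreover have "0 < r * (2 - r)" using r_gt r_lt by simp
  ultimately show False by linarith
qed

end

section \<open>From packings to tilings\<close>

context ratio begin

lemma sv2_hexv5: "dist (sv ! 2) (hexv ! 5) = 1 + r"
proof (subst dist_eq_iff_sq)
  have "(Re (sv ! 2) - Re (hexv ! 5))^2 + (Im (sv ! 2) - Im (hexv ! 5))^2 = hm^2 - hm * hs + hs^2"
    by (simp add: sv_alt hexv_def power2_eq_square field_simps)
  then show "(Re (sv ! 2) - Re (hexv ! 5))^2 + (Im (sv ! 2) - Im (hexv ! 5))^2 = (1 + r)^2"
    unfolding hm_hs .
qed (use r_gt in simp)

lemma hexv_dist: "dist (hexv ! 5) (hexv ! 0) = 2" "dist (hexv ! 0) (hexv ! 1) = 2" "2 < dist (hexv ! 5) (hexv ! 1)"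
proof -
  show "dist (hexv ! 5) (hexv ! 0) = 2" "dist (hexv ! 0) (hexv ! 1) = 2"
    using side_len[OF good_hexv, of 5] side_len[OF good_hexv, of 0] by (simp_all add: succ_vertex_def)
  have "2 \<le> dist (hexv ! 5) (hexv ! 1)" "dist (hexv ! 5) (hexv ! 1) \<noteq> 2"
    using sep(1)[OF good_hexv, of 5 1] sep(2)[OF good_hexv, of 5 1] by auto
  then show "2 < dist (hexv ! 5) (hexv ! 1)" by simp
qed

text \<open>\<open>corona\<close> leaves two small neighbours, which must be the other discs of the
  trio, in the order dictated by orientation; the three unit discs are then placed one after another
  by \<open>mv_step\<close>.\<close>

lemma trio_corona:
  assumes S: "S \<in> compact_packings_1 r" and w: "norm w = 1"
    and t: "(motion a w (sv ! 0), r) \<in> S" "(motion a w (sv ! 1), r) \<in> S" "(motion a w (sv ! 2), r) \<in> S"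
  shows "(motion a w (hexv ! 5), 1) \<in> S" "(motion a w (hexv ! 0), 1) \<in> S" "(motion a w (hexv ! 1), 1) \<in> S"
    "\<And>X. X \<in> S \<Longrightarrow> tangent (motion a w (sv ! 0), r) X \<Longrightarrow> snd X = 1 \<Longrightarrow>
       fst X \<in> {motion a w (hexv ! 5), motion a w (hexv ! 0), motion a w (hexv ! 1)}"
proof -
  let ?D = "(motion a w (sv ! 0), r)" and ?E = "(motion a w (sv ! 1), r)" and ?F = "(motion a w (sv ! 2), r)"
  have cp: "compact_packing S" and rad: "snd ` S = {1, r}" using S unfolding compact_packings_1_def by auto
  have P: "packing S" and sur: "surrounded S ?D" using cp t unfolding compact_packing_def by auto
  obtain X where X: "X \<in> S" "tangent ?D X" "snd X = 1" using has_big_neighbour[OF S t(1)] by auto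
  have "(motion a w (hexv ! 5), 1) \<in> S \<and> (motion a w (hexv ! 0), 1) \<in> S \<and> (motion a w (hexv ! 1), 1) \<in> S \<and>
    (\<forall>X\<in>S. tangent ?D X \<longrightarrow> snd X = 1 \<longrightarrow> fst X \<in> {motion a w (hexv ! 5), motion a w (hexv ! 0), motion a w (hexv ! 1)})"
  proof (rule corona[OF P _ t(1) _ sur X])
    fix R1 R2 A B C
    assume in_S: "R1 \<in> S" "R2 \<in> S" "A \<in> S" "B \<in> S" "C \<in> S"
      and N: "{E \<in> S. tangent ?D E} = {R1, R2, A, B, C}"
      and rr: "snd R1 = r" "snd R2 = r" "snd A = 1" "snd B = 1" "snd C = 1"
      and tg: "tangent R1 R2" "tangent R2 A" "tangent A B" "tangent B C"
      and c: "0 < cross (fst ?D) (fst R1) (fst R2)" "0 < cross (fst ?D) (fst R2) (fst A)" "0 < cross (fst ?D) (fst A) (fst B)"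
        "0 < cross (fst ?D) (fst B) (fst C)"
    have tD: "tangent ?D A" "tangent ?D B" "tangent ?D C" using N by blast+
    have small: "Z = R1 \<or> Z = R2" if "Z \<in> S" "tangent ?D Z" "snd Z = r" for Z
    proof -
      have "Z \<in> {R1, R2, A, B, C}" using that N by blast
      then show ?thesis using that rr r_neq_1 by auto
    qed
    have "tangent ?D ?E" "tangent ?D ?F" unfolding tangent_def by (simp_all add: dist_mv[OF w] sv_dist sv_dist[unfolded One_nat_def])
    then have EF: "?E = R1 \<or> ?E = R2" "?F = R1 \<or> ?F = R2" using small[OF t(2)] small[OF t(3)] by simp_all
    have cEF: "0 < cross (motion a w (sv ! 0)) (motion a w (sv ! 1)) (motion a w (sv ! 2))" unfolding cr_mv[OF w] by (rule sv_cr)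
    have F: "fst R2 = motion a w (sv ! 2)"
    proof (rule ccontr)
      assume ne: "fst R2 \<noteq> motion a w (sv ! 2)"
      then have "?F = R1" using EF(2) by (metis fst_conv)
      moreover have "?E \<noteq> ?F" using cEF by auto
      ultimately have "?E = R2" using EF(1) by metis
      then show False using c(1) cEF \<open>?F = R1\<close> cr_swap(2)[of "motion a w (sv ! 0)" "motion a w (sv ! 1)" "motion a w (sv ! 2)"]
        by (metis fst_conv less_imp_not_less neg_0_less_iff_less)
    qed
    have A: "fst A = motion a w (hexv ! 5)"
      by (rule mv_step[OF w refl[of "motion a w (sv ! 0)"] F])
        (use tD(1) tg(2) c(2) rr sv_hexv_dist sv2_hexv5 sv_cr in \<open>simp_all add: tangent_def dist_commute add.commute\<close>)
    have B: "fst B = motion a w (hexv ! 0)"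
      by (rule mv_step[OF w refl[of "motion a w (sv ! 0)"] A])
        (use tD(2) tg(3) c(3) rr sv_hexv_dist hexv_dist sv_cr in \<open>simp_all add: tangent_def dist_commute add.commute\<close>)
    have C: "fst C = motion a w (hexv ! 1)"
      by (rule mv_step[OF w refl[of "motion a w (sv ! 0)"] B])
        (use tD(3) tg(4) c(4) rr sv_hexv_dist hexv_dist sv_cr in \<open>simp_all add: tangent_def dist_commute add.commute\<close>)
    have "A = (motion a w (hexv ! 5), 1)" "B = (motion a w (hexv ! 0), 1)" "C = (motion a w (hexv ! 1), 1)"
      using A B C rr by (simp_all add: prod_eq_iff)
    moreover have "fst X \<in> {fst A, fst B, fst C}" if "X \<in> S" "tangent ?D X" "snd X = 1" for X
    proof -
      have "X \<in> {R1, R2, A, B, C}" using that N by blast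
      then show ?thesis using that rr r_neq_1 by auto
    qed
    ultimately show ?thesis using in_S by auto
  qed (use rad in auto)
  then show "(motion a w (hexv ! 5), 1) \<in> S" "(motion a w (hexv ! 0), 1) \<in> S" "(motion a w (hexv ! 1), 1) \<in> S"
    "\<And>X. X \<in> S \<Longrightarrow> tangent ?D X \<Longrightarrow> snd X = 1 \<Longrightarrow>
       fst X \<in> {motion a w (hexv ! 5), motion a w (hexv ! 0), motion a w (hexv ! 1)}"
    by blast+
qed

text \<open>The two small neighbours touch each other and complete a trio;
  \<open>trio_corona\<close>, applied to each of its discs after a rotation, yields all six
  vertices.\<close>

lemma small_in_hexagon:
  assumes S: "S \<in> compact_packings_1 r" and D: "D \<in> S" "snd D = r"
  obtains a w where "norm w = 1" "D = (motion a w (sv ! 0), r)" "trio a w \<subseteq> S"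
    "\<And>i. i < 6 \<Longrightarrow> (motion a w (hexv ! i), 1) \<in> S"
proof -
  have cp: "compact_packing S" and rad: "snd ` S = {1, r}" using S unfolding compact_packings_1_def by auto
  have P: "packing S" and sur: "surrounded S D" using cp D unfolding compact_packing_def by auto
  obtain X where X: "X \<in> S" "tangent D X" "snd X = 1" using has_big_neighbour[OF S D] by auto
  obtain E F where EF: "E \<in> S" "F \<in> S" "tangent D E" "tangent D F" "tangent E F" "snd E = r" "snd F = r"
    "0 < cross (fst D) (fst E) (fst F)"
  proof (rule corona[OF P _ D sur X])
    fix R1 R2 A B C
    assume "R1 \<in> S" "R2 \<in> S" "{E \<in> S. tangent D E} = {R1, R2, A, B, C}" "snd R1 = r" "snd R2 = r"
      "tangent R1 R2" "0 < cross (fst D) (fst R1) (fst R2)"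
    then show thesis using that[of R1 R2] by blast
  qed (use rad in auto)
  have "sv ! 0 \<noteq> sv ! 1" using sv_dist(1) r_gt by auto
  moreover have "dist (fst D) (fst E) = dist (sv ! 0) (sv ! 1)" using EF(3,6) D(2) sv_dist(1) unfolding tangent_def by simp
  ultimately obtain a w where w: "norm w = 1" and De: "fst D = motion a w (sv ! 0)" "fst E = motion a w (sv ! 1)"
    using mv_frame by metis
  have Fe: "fst F = motion a w (sv ! 2)"
    by (rule mv_step[OF w De])
      (use EF D sv_dist sv_cr in \<open>simp_all add: tangent_def dist_commute\<close>)
  have DEF: "D = (motion a w (sv ! 0), r)" "E = (motion a w (sv ! 1), r)" "F = (motion a w (sv ! 2), r)"
    using De Fe EF D by (simp_all add: prod_eq_iff)
  have trio: "trio a w \<subseteq> S" unfolding trio_def set_sv using DEF D EF by simp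
  have hex: "(motion a w (hexv ! ((2 * i + 5) mod 6)), 1) \<in> S" "(motion a w (hexv ! ((2 * i) mod 6)), 1) \<in> S" "(motion a w (hexv ! ((2 * i + 1) mod 6)), 1) \<in> S"
    if i: "i < 3" for i
  proof -
    obtain w' where w': "norm w' = 1" "trio a w' = trio a w"
      "\<And>j. j < 6 \<Longrightarrow> motion a w' (hexv ! j) = motion a w (hexv ! ((j + 2 * i) mod 6))"
      using frame_shift[OF w i] by metis
    have "trio a w' \<subseteq> S" using trio w'(2) by simp
    then have "(motion a w' (sv ! 0), r) \<in> S" "(motion a w' (sv ! 1), r) \<in> S" "(motion a w' (sv ! 2), r) \<in> S"
      unfolding trio_def set_sv by auto
    then have "(motion a w' (hexv ! 5), 1) \<in> S" "(motion a w' (hexv ! 0), 1) \<in> S" "(motion a w' (hexv ! 1), 1) \<in> S"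
      by (rule trio_corona[OF S w'(1)])+
    then show "(motion a w (hexv ! ((2 * i + 5) mod 6)), 1) \<in> S" "(motion a w (hexv ! ((2 * i) mod 6)), 1) \<in> S" "(motion a w (hexv ! ((2 * i + 1) mod 6)), 1) \<in> S"
      using w'(3)[of 5] w'(3)[of 0] w'(3)[of 1] by (simp_all add: add.commute)
  qed
  have "(motion a w (hexv ! i), 1) \<in> S" if "i < 6" for i
  proof (cases "even i")
    case True
    then obtain k where "i = 2 * k" by blast
    then show ?thesis using hex(2)[of k] that by simp
  next
    case False
    then obtain k where "i = 2 * k + 1" using oddE by blast
    then show ?thesis using hex(3)[of k] that by simp
  qed
  then show thesis using that w DEF(1) trio by blast
qed

section \<open>Triangles and hexagons spanned by the unit centres\<close>

definition cells :: "complex set set" where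
  "cells = {t. \<exists>a w. norm w = 1 \<and> (t = hexagon a w \<or> t = triangle a w)}"

definition centres :: "disc set \<Rightarrow> complex set" where
  "centres S = {c. (c, 1) \<in> S}"

lemma cells_tile: "t \<in> cells \<Longrightarrow> tile t"
  unfolding cells_def using tile_hx tile_tri by blast

lemma cells_intros: "norm w = 1 \<Longrightarrow> hexagon a w \<in> cells" "norm w = 1 \<Longrightarrow> triangle a w \<in> cells"
  unfolding cells_def by blast+

lemma hx_neq_tri: "norm w = 1 \<Longrightarrow> norm v = 1 \<Longrightarrow> hexagon a w \<noteq> triangle b v"
  using card_ext[OF good_mv[OF good_hexv]] card_ext[OF good_mv[OF good_triv]]
  unfolding hx_hull tri_hull by (metis length_hexv length_map length_triv numeral_eq_iff semiring_norm(89) num.distinct)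

lemma unit_centres_packing: "packing S \<Longrightarrow> unit_centres (centres S) cells"
proof
  show "2 \<le> dist x y" if "packing S" "x \<in> centres S" "y \<in> centres S" "x \<noteq> y" for x y
    using that unfolding centres_def packing_iff by fastforce
qed (rule cells_tile)

text \<open>The disc to the left of the pair decides. A unit disc completes a triangle. A small one
  has its unit neighbours at the indices 5, 0, 1 of its hexagon, and distance 2 together with
  orientation leaves only the sides from 5 to 0 and from 0 to 1.\<close>

lemma unit_edge_cell:
  assumes S: "S \<in> compact_packings_1 r" and ab: "a \<in> centres S" "b \<in> centres S" "dist a b = 2"
  obtains t where "t \<in> unit_centres.unit_tiles (centres S) cells" "side t a b"
    "(\<exists>m w. norm w = 1 \<and> t = triangle m w) \<or> (\<exists>m w. norm w = 1 \<and> t = hexagon m w \<and> trio m w \<subseteq> S)"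
proof -
  have cp: "compact_packing S" and rad: "snd ` S = {1, r}" using S unfolding compact_packings_1_def by auto
  then have P: "packing S" unfolding compact_packing_def by auto
  interpret uc: unit_centres "centres S" cells by (rule unit_centres_packing[OF P])
  have "tangent (a, 1) (b, 1)" using ab(3) unfolding tangent_def by simp
  then obtain F where F: "F \<in> S" "tangent (a, 1) F" "tangent (b, 1) F" "0 < cross a b (fst F)"
    using compact_left_closed[OF cp] ab(1,2) unfolding left_closed_def centres_def by fastforce
  have "snd F \<in> {1, r}" using F rad by blast
  then consider "snd F = 1" | "snd F = r" by auto
  then show thesis
  proof cases
    case 1
    then have "dist b (fst F) = 2" "dist (fst F) a = 2" using F(2,3) unfolding tangent_def by (simp_all add: dist_commute)
    then obtain m w where w: "norm w = 1" and e: "a = motion m w (triv ! 0)" "b = motion m w (triv ! 1)" "fst F = motion m w (triv ! 2)"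
      using equilateral_frame[OF ab(3) _ _ F(4)] by metis
    have "fst F \<in> centres S" using F(1) 1 unfolding centres_def by (metis mem_Collect_eq prod.collapse)
    then have "v \<in> centres S" if "v extreme_point_of triangle m w" for v
      using that ab e unfolding tri_ext[OF w] all_lt_3 by auto
    then have "triangle m w \<in> uc.unit_tiles" unfolding uc.unit_tiles_def using cells_intros(2)[OF w] by blast
    moreover have "side (triangle m w) a b" unfolding tri_side[OF w] using e by (intro exI[of _ 0]) simp
    ultimately show thesis using that w by blast
  next
    case 2
    obtain m w where w: "norm w = 1" and Fe: "F = (motion m w (sv ! 0), r)" and tr: "trio m w \<subseteq> S"
      and hex: "\<And>i. i < 6 \<Longrightarrow> (motion m w (hexv ! i), 1) \<in> S"
      using small_in_hexagon[OF S F(1) 2] by metis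
    have t: "(motion m w (sv ! 0), r) \<in> S" "(motion m w (sv ! 1), r) \<in> S" "(motion m w (sv ! 2), r) \<in> S"
      using tr unfolding trio_def set_sv by auto
    have near: "x \<in> {motion m w (hexv ! 5), motion m w (hexv ! 0), motion m w (hexv ! 1)}" if "x \<in> centres S" "tangent (x, 1) F" for x
      using trio_corona(4)[OF S w t, of "(x, 1)"] that tangent_sym[of "(x, 1)" F] unfolding Fe centres_def by simp
    have c: "0 < cross (motion m w (sv ! 0)) a b" using F(4) unfolding Fe by (simp add: cr_rotate)
    have nc: "\<not> 0 < cross (sv ! 0) (hexv ! 0) (hexv ! 5)" "\<not> 0 < cross (sv ! 0) (hexv ! 1) (hexv ! 0)"
      using sv_cr cr_swap(2)[of "sv ! 0" "hexv ! 0" "hexv ! 5"] cr_swap(2)[of "sv ! 0" "hexv ! 1" "hexv ! 0"] by linarith+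
    have "a = motion m w (hexv ! 5) \<and> b = motion m w (hexv ! 0) \<or> a = motion m w (hexv ! 0) \<and> b = motion m w (hexv ! 1)"
      using near[OF ab(1) F(2)] near[OF ab(2) F(3)] ab(3) c nc hexv_dist(3) dist_commute[of "hexv ! 1" "hexv ! 5"]
      by (auto simp: dist_mv[OF w] cr_mv[OF w] simp del: One_nat_def)
    then have "side (hexagon m w) a b"
    proof
      assume "a = motion m w (hexv ! 5) \<and> b = motion m w (hexv ! 0)"
      then show ?thesis unfolding hx_side[OF w] by (intro exI[of _ 5]) simp
    next
      assume "a = motion m w (hexv ! 0) \<and> b = motion m w (hexv ! 1)"
      then show ?thesis unfolding hx_side[OF w] by (intro exI[of _ 0]) simp
    qed
    moreover have "v \<in> centres S" if "v extreme_point_of hexagon m w" for v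
      using that hex unfolding hx_ext[OF w] centres_def by auto
    then have "hexagon m w \<in> uc.unit_tiles" unfolding uc.unit_tiles_def using cells_intros(1)[OF w] by blast
    ultimately show thesis using that w tr by blast
  qed
qed

lemma packing_to_tiling:
  assumes hP: "is_hexagon_P r P" and S: "S \<in> compact_packings_1 r"
  shows "tiling_of_packing S = unit_centres.unit_tiles (centres S) cells" "tiling_of_packing S \<in> tilings_by P"
    "packing_of_tiling r P (tiling_of_packing S) = S"
proof -
  have cp: "compact_packing S" and rad: "snd ` S = {1, r}" using S unfolding compact_packings_1_def by auto
  then have Pk: "packing S" unfolding compact_packing_def by auto
  interpret uc: unit_centres "centres S" cells by (rule unit_centres_packing[OF Pk])
  have opp: "\<exists>t'\<in>uc.unit_tiles. side t' b a" if "t \<in> uc.unit_tiles" "side t a b" for t a b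
  proof -
    have "a \<in> centres S" "b \<in> centres S" "dist b a = 2"
      using uc.TT_side[OF that] side_dist[OF that(2)] by (auto simp: dist_commute)
    then show ?thesis using unit_edge_cell[OF S, of b a] by metis
  qed
  have in_TT: "hexagon m w \<in> uc.unit_tiles" if w: "norm w = 1" and hex: "\<And>i. i < 6 \<Longrightarrow> (motion m w (hexv ! i), 1) \<in> S" for m w
  proof -
    have "v \<in> centres S" if v: "v extreme_point_of hexagon m w" for v
      using v hex unfolding hx_ext[OF w] centres_def by auto
    then show ?thesis unfolding uc.unit_tiles_def using cells_intros(1)[OF w] by blast
  qed
  obtain D where D: "D \<in> S" "snd D = r" using rad by (metis imageE insertI1 insert_commute)
  obtain a w where aw: "norm w = 1" "\<And>i. i < 6 \<Longrightarrow> (motion a w (hexv ! i), 1) \<in> S"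
    using small_in_hexagon[OF S D] by metis
  have hexTT: "hexagon a w \<in> uc.unit_tiles" using in_TT[OF aw] .
  then have ne: "uc.unit_tiles \<noteq> {}" by blast
  have segs: "\<Union>{closed_segment c d | c d. (c, 1) \<in> S \<and> (d, 1) \<in> S \<and> tangent (c, 1) (d, 1)} = uc.segs"
    unfolding uc.segs_def tangent_def by (simp add: centres_def)
  show tt: "tiling_of_packing S = uc.unit_tiles"
    unfolding tiling_of_packing_def segs by (rule uc.components_TT[OF ne opp])
  have ue: "\<exists>t\<in>uc.unit_tiles. u extreme_point_of t" if u: "u \<in> centres S" for u
  proof (rule uc.U_extreme[OF ne _ u])
    show "\<exists>t'\<in>uc.unit_tiles. side t' b a" if "t \<in> uc.unit_tiles" "side t a b" for t a b by (rule opp[OF that])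
    show ?thesis if "t \<in> uc.unit_tiles" "u extreme_point_of t" for t using that by blast
  qed
  have cell: "congruent_to P t \<or> equilateral_triangle 2 t" if "t \<in> cells" for t
    using that unfolding cells_def congruent_iff[OF hP] equilateral_triangle_iff by blast
  show "tiling_of_packing S \<in> tilings_by P" unfolding tt tilings_by_def
  proof (intro CollectI conjI ballI)
    show "tiling uc.unit_tiles" by (rule uc.TT_tiling[OF ne opp])
    show "edge_to_edge uc.unit_tiles" by (rule uc.TT_edge_to_edge)
    show "congruent_to P t \<or> equilateral_triangle 2 t" if "t \<in> uc.unit_tiles" for t
      using that cell unfolding uc.unit_tiles_def by blast
    show "\<exists>t\<in>uc.unit_tiles. congruent_to P t" using hexTT aw(1) unfolding congruent_iff[OF hP] by blast
  qed
  have the: "(THE K. inscribed_trio r (hexagon m v) K) = trio m v" if "norm v = 1" for m v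
    using trio_inscribed[OF that] inscribed_trio_unique[OF that] by (intro the_equality)
  have "(D \<in> {(v, 1) | v. \<exists>t\<in>uc.unit_tiles. v extreme_point_of t} \<union>
     (\<Union>H\<in>{H \<in> uc.unit_tiles. congruent_to P H}. THE K. inscribed_trio r H K)) \<longleftrightarrow> D \<in> S" for D
  proof
    assume "D \<in> {(v, 1) | v. \<exists>t\<in>uc.unit_tiles. v extreme_point_of t} \<union>
     (\<Union>H\<in>{H \<in> uc.unit_tiles. congruent_to P H}. THE K. inscribed_trio r H K)"
    then show "D \<in> S"
    proof
      assume "D \<in> {(v, 1) | v. \<exists>t\<in>uc.unit_tiles. v extreme_point_of t}"
      then obtain v t where "D = (v, 1)" "t \<in> uc.unit_tiles" "v extreme_point_of t" by blast
      then have "v \<in> centres S" unfolding uc.unit_tiles_def by blast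
      then show ?thesis using \<open>D = (v, 1)\<close> unfolding centres_def by simp
    next
      assume "D \<in> (\<Union>H\<in>{H \<in> uc.unit_tiles. congruent_to P H}. THE K. inscribed_trio r H K)"
      then obtain m v where v: "norm v = 1" and H: "hexagon m v \<in> uc.unit_tiles" and DK: "D \<in> (THE K. inscribed_trio r (hexagon m v) K)"
        unfolding congruent_iff[OF hP] by blast
      \<comment> \<open>A priori, a hexagon spanned by unit centres need not contain small discs of
        \<open>S\<close>. The tile that \<open>unit_edge_cell\<close> provides on one of its sides
        is a triangle or carries its trio; sharing the directed side, it is this hexagon.\<close>
      have s: "side (hexagon m v) (motion m v (hexv ! 0)) (motion m v (hexv ! 1))"
        unfolding hx_side[OF v] by (intro exI[of _ 0]) simp
      obtain t where t: "t \<in> uc.unit_tiles" "side t (motion m v (hexv ! 0)) (motion m v (hexv ! 1))"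
        and tk: "(\<exists>m w. norm w = 1 \<and> t = triangle m w) \<or> (\<exists>m w. norm w = 1 \<and> t = hexagon m w \<and> trio m w \<subseteq> S)"
        using unit_edge_cell[OF S uc.TT_side[OF H s] side_dist[OF s]] by metis
      have "t = hexagon m v"
        using same_side_eq[OF uc.TT_nonoverlapping t(1) H uc.TT_tile[OF t(1)] uc.TT_tile[OF H] t(2) s] .
      then obtain m' w' where "norm w' = 1" "hexagon m v = hexagon m' w'" "trio m' w' \<subseteq> S"
        using tk hx_neq_tri[OF v] by metis
      then show ?thesis using DK the by auto
    qed
  next
    assume D: "D \<in> S"
    then have "snd D \<in> {1, r}" using rad by blast
    then consider "snd D = 1" | "snd D = r" by auto
    then show "D \<in> {(v, 1) | v. \<exists>t\<in>uc.unit_tiles. v extreme_point_of t} \<union>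
     (\<Union>H\<in>{H \<in> uc.unit_tiles. congruent_to P H}. THE K. inscribed_trio r H K)"
    proof cases
      case 1
      then have "fst D \<in> centres S" using D unfolding centres_def by (metis mem_Collect_eq prod.collapse)
      then obtain t where "t \<in> uc.unit_tiles" "fst D extreme_point_of t" using ue by blast
      then show ?thesis using 1 by (auto simp: prod_eq_iff)
    next
      case 2
      obtain m v where v: "norm v = 1" and Dm: "D = (motion m v (sv ! 0), r)" and h: "\<And>i. i < 6 \<Longrightarrow> (motion m v (hexv ! i), 1) \<in> S"
        using small_in_hexagon[OF S D 2] by metis
      have "hexagon m v \<in> {H \<in> uc.unit_tiles. congruent_to P H}" using in_TT[OF v h] v unfolding congruent_iff[OF hP] by blast
      moreover have "D \<in> (THE K. inscribed_trio r (hexagon m v) K)" unfolding the[OF v] Dm trio_def set_sv by simp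
      ultimately show ?thesis by blast
    qed
  qed
  then show "packing_of_tiling r P (tiling_of_packing S) = S"
    unfolding tt packing_of_tiling_def by blast
qed

end

section \<open>From tilings to packings\<close>

text \<open>Sides at \<open>v\<close> bound a cone with apex \<open>v\<close>, which scaling
  preserves; all other side lines are at distance at least 6/5 from \<open>v\<close>.\<close>

lemma tile_ray:
  assumes t: "tile t" and v: "v extreme_point_of t" and x: "x \<in> t" and m: "0 \<le> m" "m * dist v x \<le> 6/5"
  shows "v + m *\<^sub>R (x - v) \<in> t"
  unfolding tile_mem_iff[OF t]
proof (intro allI impI)
  fix a b assume s: "side t a b"
  have e: "cross a b (v + m *\<^sub>R (x - v)) = cross a b v + m * (cross a b x - cross a b v)"
    unfolding cross_def by (simp add: algebra_simps)
  show "0 \<le> cross a b (v + m *\<^sub>R (x - v))"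
  proof (cases "v = a \<or> v = b")
    case True
    then have "cross a b v = 0" by auto
    then show ?thesis unfolding e using side_cr[OF s x] m(1) by simp
  next
    case False
    then have "12/5 \<le> cross a b v" using side_far[OF t s v] by blast
    moreover have "\<bar>cross a b (v + m *\<^sub>R (x - v)) - cross a b v\<bar> \<le> 2 * (m * dist v x)"
      using cr_lipschitz[of a b "v + m *\<^sub>R (x - v)" v] side_dist[OF s] m(1)
      by (simp add: dist_norm norm_minus_commute)
    ultimately show ?thesis using m(2) by linarith
  qed
qed

lemma centre_balls_disjoint:
  assumes "cball c d \<subseteq> interior s" "cball c' d \<subseteq> interior t" "interior s \<inter> interior t = {}"
  shows "2 * d < dist c (c'::complex)"
proof (rule ccontr)
  assume "\<not> 2 * d < dist c c'"
  then have "midpoint c c' \<in> cball c d" "midpoint c c' \<in> cball c' d" by (auto simp: dist_midpoint)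
  then show False using assms by blast
qed

locale hexagon_tiling = ratio +
  fixes P :: "complex set" and T :: "complex set set"
  assumes hP: "is_hexagon_P r P" and T: "T \<in> tilings_by P"
begin

definition V :: "complex set" where
  "V = {v. \<exists>t\<in>T. v extreme_point_of t}"

lemma T_cell: "t \<in> T \<Longrightarrow> t \<in> cells"
  using T unfolding tilings_by_def congruent_iff[OF hP] equilateral_triangle_iff cells_def by blast

lemma T_tile: "t \<in> T \<Longrightarrow> tile t"
  using T_cell cells_tile by blast

lemma T_cover: "\<Union>T = UNIV" and T_nonoverlapping: "nonoverlapping T" and T_edges: "edge_to_edge T"
  using T unfolding tilings_by_def tiling_def by blast+

lemma V_mem: "t \<in> T \<Longrightarrow> v extreme_point_of t \<Longrightarrow> v \<in> V"
  unfolding V_def by blast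

lemma T_meet:
  assumes "s \<in> T" "t \<in> T" "s \<noteq> t" "x \<in> s" "x \<in> t"
  shows "(x extreme_point_of s \<and> x extreme_point_of t \<and> s \<inter> t = {x}) \<or> (s \<inter> t edge_of s \<and> s \<inter> t edge_of t)"
proof -
  have x: "x \<in> s \<inter> t" using assms by blast
  then have "s \<inter> t \<noteq> {}" by blast
  from T_edges[unfolded edge_to_edge_def, rule_format, OF assms(1-3) this] show ?thesis
  proof
    assume "\<exists>v. v extreme_point_of s \<and> v extreme_point_of t \<and> s \<inter> t = {v}"
    then obtain v where v: "v extreme_point_of s" "v extreme_point_of t" "s \<inter> t = {v}" by blast
    then have "v = x" using x by simp
    then show ?thesis using v by simp
  next
    assume "\<exists>e. e edge_of s \<and> e edge_of t \<and> s \<inter> t = e"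
    then show ?thesis by metis
  qed
qed

text \<open>Another tile at \<open>v\<close> meets \<open>t\<close> in this vertex alone or in a
  common edge, of which \<open>v\<close> is an end. So no vertex lies inside a side of another
  tile.\<close>

lemma V_extreme:
  assumes v: "v \<in> V" and t: "t \<in> T" "v \<in> t"
  shows "v extreme_point_of t"
proof -
  obtain s where s: "s \<in> T" "v extreme_point_of s" using v unfolding V_def by blast
  show ?thesis
  proof (cases "s = t")
    case False
    have vs: "v \<in> s" using s(2) unfolding extreme_point_of_def by blast
    show ?thesis using T_meet[OF s(1) t(1) False vs t(2)]
    proof
      assume e: "s \<inter> t edge_of s \<and> s \<inter> t edge_of t"
      then have f: "s \<inter> t face_of t" unfolding edge_of_def by blast
      have "v extreme_point_of s \<inter> t" using s(2) t(2) unfolding extreme_point_of_def by blast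
      then show ?thesis using extreme_point_of_face[OF f] by blast
    qed blast
  qed (use s in simp)
qed

text \<open>Points of the segment close to \<open>v\<close> are covered by tiles; by local
  finiteness one of these also contains \<open>v\<close>, as a vertex, and \<open>tile_ray\<close>
  extends it as far as \<open>z\<close>.\<close>

lemma sector:
  assumes v: "v \<in> V" and z: "dist v z \<le> 6/5"
  obtains t where "t \<in> T" "v extreme_point_of t" "z \<in> t"
proof -
  define A where "A = (\<lambda>e. v + e *\<^sub>R (z - v)) ` {0<..1::real}"
  have "v \<in> closure A" unfolding closure_approachable
  proof (intro allI impI)
    fix d :: real assume d: "0 < d"
    define e where "e = min 1 (d / (2 * (norm (z - v) + 1)))"
    have n: "0 < norm (z - v) + 1" by (simp add: add_nonneg_pos)
    have e: "0 < e" "e \<le> 1" "e \<le> d / (2 * (norm (z - v) + 1))" using d n unfolding e_def by auto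
    have "e * norm (z - v) \<le> e * (norm (z - v) + 1)" using e by (intro mult_left_mono) auto
    also have "\<dots> \<le> d / (2 * (norm (z - v) + 1)) * (norm (z - v) + 1)" using e n by (intro mult_right_mono) auto
    also have "\<dots> = d / 2" using n by (simp add: field_simps)
    finally have "dist (v + e *\<^sub>R (z - v)) v < d" using d e by (simp add: dist_norm)
    then show "\<exists>y\<in>A. dist y v < d" unfolding A_def using e by auto
  qed
  then obtain t where t: "t \<in> T" "v \<in> t" "A \<inter> t \<noteq> {}"
    using nonoverlapping_accumulation[OF T_tile T_nonoverlapping, of A v] T_cover by blast
  obtain e where e: "0 < e" "e \<le> 1" "v + e *\<^sub>R (z - v) \<in> t" using t(3) unfolding A_def by auto
  have ext: "v extreme_point_of t" by (rule V_extreme[OF v t(1,2)])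
  have "v + (1 / e) *\<^sub>R ((v + e *\<^sub>R (z - v)) - v) \<in> t"
    using e z by (intro tile_ray[OF T_tile[OF t(1)] ext e(3)]) (simp_all add: dist_norm norm_minus_commute)
  then have "z \<in> t" using e by simp
  then show thesis using that t ext by blast
qed

text \<open>The sectors at \<open>v\<close> and \<open>w\<close> overlap along the segment, since
  6/5 + 6/5 exceeds 2; the points \<open>z\<close> and \<open>z'\<close> at 3/5 of the way from
  either end lie in both tiles. If these tiles differ they share an edge through \<open>z\<close>
  and \<open>z'\<close>, and the face property extends it back to \<open>v\<close>.\<close>

lemma common_tile:
  assumes v: "v \<in> V" and w: "w \<in> V" and ne: "v \<noteq> w" and d: "dist v w \<le> 2"
  obtains t where "t \<in> T" "v extreme_point_of t" "w extreme_point_of t"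
proof -
  define z z' where "z = v + (3/5) *\<^sub>R (w - v)" and "z' = w + (3/5) *\<^sub>R (v - w)"
  have "dist v z \<le> 6/5" "dist w z' \<le> 6/5" using d unfolding z_def z'_def by (simp_all add: dist_norm norm_minus_commute)
  then obtain t t' where t: "t \<in> T" "v extreme_point_of t" "z \<in> t" and t': "t' \<in> T" "w extreme_point_of t'" "z' \<in> t'"
    using sector[OF v] sector[OF w] by metis
  show thesis
  proof (cases "t = t'")
    case True
    then show ?thesis using that t t' by blast
  next
    case False
    have vt: "v \<in> t" "w \<in> t'" using t(2) t'(2) unfolding extreme_point_of_def by auto
    have zz': "z' = (1 - 2/3) *\<^sub>R v + (2/3) *\<^sub>R z" "z = (1 - 2/3) *\<^sub>R w + (2/3) *\<^sub>R z'"
      unfolding z_def z'_def by (simp_all add: complex_eq_iff field_simps)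
    have z't: "z' \<in> t" unfolding zz'(1) using convexD_alt[OF tile_convex[OF T_tile[OF t(1)]] vt(1) t(3), of "2/3"] by simp
    have zt': "z \<in> t'" unfolding zz'(2) using convexD_alt[OF tile_convex[OF T_tile[OF t'(1)]] vt(2) t'(3), of "2/3"] by simp
    have "z - v = (3/5) *\<^sub>R (w - v)" "z - z' = (1/5) *\<^sub>R (w - v)"
      unfolding z_def z'_def by (simp_all add: complex_eq_iff field_simps)
    then have vz: "v \<noteq> z" "z \<noteq> z'" using ne by auto
    have "t \<inter> t' \<noteq> {z}" using z't t'(3) vz(2) by (metis IntI singletonD)
    then have "t \<inter> t' face_of t"
      using T_meet[OF t(1) t'(1) False t(3) zt'] unfolding edge_of_def by blast
    moreover have "z' \<in> open_segment v z" unfolding in_segment using vz(1) zz'(1) by (intro conjI exI[of _ "2/3"]) simp_all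
    ultimately have "v \<in> t'" using vt(1) t(3) z't t'(3) unfolding face_of_def by blast
    then show ?thesis using that t' V_extreme[OF v t'(1)] by blast
  qed
qed

lemma V_sep: "v \<in> V \<Longrightarrow> w \<in> V \<Longrightarrow> v \<noteq> w \<Longrightarrow> 2 \<le> dist v w"
proof (rule ccontr)
  assume vw: "v \<in> V" "w \<in> V" "v \<noteq> w" "\<not> 2 \<le> dist v w"
  obtain t where "t \<in> T" "v extreme_point_of t" "w extreme_point_of t"
    using common_tile[OF vw(1-3)] vw(4) by auto
  then show False using tile_sep[OF T_tile] vw by blast
qed

text \<open>Some tile accumulates at the midpoint of the side from the other half plane. It shares
  with \<open>t\<close> an edge through that midpoint, which is the given side by
  \<open>side_strict\<close>; if it had the side in the same direction it would be
  \<open>t\<close>.\<close>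

lemma opposite_side:
  assumes t: "t \<in> T" and s: "side t w v"
  obtains t' where "t' \<in> T" "side t' v w"
proof -
  let ?m = "midpoint w v"
  have ne: "v \<noteq> w" using side_neq[OF s] by simp
  have m: "?m \<in> open_segment w v" using ne by simp
  have m0: "cross v w ?m = 0" using cr_midpoint[of v w] by (simp add: midpoint_sym)
  have mt: "?m \<in> t" using m tile_side_subset[OF T_tile[OF t] s] open_closed_segment by blast
  have "?m \<in> closure {y. 0 < cross v w y}" unfolding closure_approachable
  proof (intro allI impI)
    fix e :: real assume "0 < e"
    then obtain z where "dist ?m z < e" "cross v w ?m < cross v w z" using left_point[OF ne] by blast
    then show "\<exists>y\<in>{y. 0 < cross v w y}. dist y ?m < e" using m0 by (auto simp: dist_commute)
  qed
  then obtain t' where t': "t' \<in> T" "?m \<in> t'" "{y. 0 < cross v w y} \<inter> t' \<noteq> {}"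
    using nonoverlapping_accumulation[OF T_tile T_nonoverlapping, of "{y. 0 < cross v w y}" ?m] T_cover by blast
  have tt': "t \<noteq> t'"
  proof
    assume "t = t'"
    then obtain y where "y \<in> t" "0 < cross v w y" using t'(3) by blast
    then show False using side_cr[OF s] cr_swap(1)[of v w y] by force
  qed
  have "\<not> ?m extreme_point_of t"
    using m side_mem[OF s] unfolding extreme_point_of_def by blast
  then have e: "t \<inter> t' edge_of t" "t \<inter> t' edge_of t'" using T_meet[OF t t'(1) tt' mt t'(2)] by auto
  obtain c d where cd: "side t c d" "t \<inter> t' = closed_segment c d" using edge_imp_side[OF T_tile[OF t] e(1)] by metis
  obtain a b where ab: "side t' a b" "t \<inter> t' = closed_segment a b" using edge_imp_side[OF T_tile[OF t'(1)] e(2)] by metis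
  have "(c, d) = (w, v)"
  proof (rule ccontr)
    assume "(c, d) \<noteq> (w, v)"
    then have "0 < cross c d ?m" using side_strict[OF T_tile[OF t] s cd(1) _ m] by blast
    moreover have "?m \<in> closed_segment c d" using mt t'(2) cd(2) by blast
    then have "cross c d ?m = 0" by (rule closed_segmentE) (simp add: cr_affine)
    ultimately show False by simp
  qed
  then have "closed_segment a b = closed_segment w v" using ab(2) cd(2) by simp
  then have "{a, b} = {w, v}" by (simp add: closed_segment_eq)
  then consider "a = v" "b = w" | "a = w" "b = v" by (auto simp: doubleton_eq_iff)
  then show thesis
  proof cases
    case 1
    then show ?thesis using that t'(1) ab(1) by simp
  next
    case 2
    then have "t = t'" using same_side_eq[OF T_nonoverlapping t t'(1) T_tile[OF t] T_tile[OF t'(1)] s] ab(1) by simp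
    then show ?thesis using tt' by simp
  qed
qed

section \<open>The discs belonging to a tiling\<close>

definition S :: "disc set" where "S = packing_of_tiling r P T"

lemma S_iff: "D \<in> S \<longleftrightarrow> (fst D \<in> V \<and> snd D = 1) \<or> (\<exists>a w. norm w = 1 \<and> hexagon a w \<in> T \<and> D \<in> trio a w)"
proof -
  have the: "(THE K. inscribed_trio r (hexagon m v) K) = trio m v" if "norm v = 1" for m v
    using trio_inscribed[OF that] inscribed_trio_unique[OF that] by (intro the_equality)
  have "D \<in> (\<Union>H\<in>{H \<in> T. congruent_to P H}. THE K. inscribed_trio r H K) \<longleftrightarrow>
      (\<exists>a w. norm w = 1 \<and> hexagon a w \<in> T \<and> D \<in> trio a w)"
    unfolding congruent_iff[OF hP] using the by auto blast+
  moreover have "D \<in> {(v, 1) | v. \<exists>t\<in>T. v extreme_point_of t} \<longleftrightarrow> fst D \<in> V \<and> snd D = 1"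
    unfolding V_def by (auto simp: prod_eq_iff)
  ultimately show ?thesis unfolding S_def packing_of_tiling_def by blast
qed

lemma vertex_in_S: "v \<in> V \<Longrightarrow> (v, 1) \<in> S"
  unfolding S_iff by simp

lemma trio_in_S: "norm w = 1 \<Longrightarrow> hexagon a w \<in> T \<Longrightarrow> D \<in> trio a w \<Longrightarrow> D \<in> S"
  unfolding S_iff by blast

lemma S_cases:
  assumes "D \<in> S"
  obtains (vertex) v where "v \<in> V" "D = (v, 1)"
  | (small) a w where "norm w = 1" "hexagon a w \<in> T" "trio a w \<subseteq> S" "D = (motion a w (sv ! 0), r)"
proof -
  have "(fst D \<in> V \<and> snd D = 1) \<or> (\<exists>a w. norm w = 1 \<and> hexagon a w \<in> T \<and> D \<in> trio a w)" using assms S_iff by simp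
  then show thesis
  proof
    assume "fst D \<in> V \<and> snd D = 1"
    then show thesis using vertex[of "fst D"] by (simp add: prod_eq_iff)
  next
    assume "\<exists>a w. norm w = 1 \<and> hexagon a w \<in> T \<and> D \<in> trio a w"
    then obtain a w where w: "norm w = 1" "hexagon a w \<in> T" "D \<in> trio a w" by blast
    obtain w' where "norm w' = 1" "hexagon a w' = hexagon a w" "D = (motion a w' (sv ! 0), r)" using trio_frame[OF w(1,3)] by metis
    moreover from this have "trio a w' \<subseteq> S" using w(2) trio_in_S[of w' a] by auto
    ultimately show thesis using small[of w' a] w(2) by simp
  qed
qed

text \<open>Some point \<open>z\<close> is within 6/5 of \<open>v\<close> and within
  \<open>r\<close> of the small centre, hence interior to the hexagon. The tile that
  \<open>sector\<close> yields at \<open>v\<close> for \<open>z\<close> must then be this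
  hexagon.\<close>

lemma vertex_near_small:
  assumes w: "norm w = 1" "hexagon a w \<in> T" "D \<in> trio a w" and v: "v \<in> V" and d: "dist (fst D) v \<le> 1 + r"
  shows "v extreme_point_of hexagon a w"
proof -
  let ?c = "fst D"
  define l where "l = dist ?c v"
  obtain z where z: "dist v z \<le> 6/5" "dist ?c z \<le> r"
  proof (cases "l \<le> 1")
    case True
    then show thesis using that[of ?c] r_gt unfolding l_def by (simp add: dist_commute)
  next
    case False
    then have l: "1 < l" by simp
    \<comment> \<open>At distance 1 from \<open>v\<close>; the rest of the segment has length
      \<open>l - 1\<close>, at most \<open>r\<close>.\<close>
    define z where "z = v + (1 / l) *\<^sub>R (?c - v)"
    have "dist v z = (1 / l) * l" using l unfolding z_def l_def by (simp add: dist_norm)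
    moreover have "?c - z = (1 - 1 / l) *\<^sub>R (?c - v)" unfolding z_def by (simp add: algebra_simps)
    then have "dist ?c z = \<bar>1 - 1 / l\<bar> * l" by (simp add: dist_norm l_def)
    then have "dist ?c z = (1 - 1 / l) * l" using l by simp
    then have "dist ?c z = l - 1" using l by (simp add: left_diff_distrib)
    ultimately show thesis using that[of z] d l unfolding l_def by simp
  qed
  obtain t where t: "t \<in> T" "v extreme_point_of t" "z \<in> t" using sector[OF v z(1)] .
  have "z \<in> interior (hexagon a w)" using trio_ball[OF w(1,3)] z(2) by auto
  then have "hexagon a w = t" using nonoverlapping_interior_eq[OF T_nonoverlapping w(2) t(1) T_tile[OF t(1)]] t(3) by blast
  then show ?thesis using t(2) by simp
qed

lemma trio_eq: "norm w = 1 \<Longrightarrow> norm v = 1 \<Longrightarrow> hexagon a w = hexagon b v \<Longrightarrow> trio a w = trio b v"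
  using trio_inscribed[of w a] inscribed_trio_unique[of v b "trio a w"] by simp

text \<open>Small discs of different hexagons are compact subsets of disjoint interiors, so they
  cannot even touch.\<close>

lemma small_small:
  assumes w: "norm w = 1" "hexagon a w \<in> T" "D \<in> trio a w" and v: "norm v = 1" "hexagon b v \<in> T" "E \<in> trio b v"
    and d: "dist (fst D) (fst E) \<le> 2 * r"
  shows "E \<in> trio a w"
proof (cases "hexagon a w = hexagon b v")
  case True
  then show ?thesis using trio_eq[OF w(1) v(1) True] v(3) by simp
next
  case False
  then have "interior (hexagon a w) \<inter> interior (hexagon b v) = {}" using T_nonoverlapping w(2) v(2) unfolding pairwise_def by blast
  then have "2 * r < dist (fst D) (fst E)" by (rule centre_balls_disjoint[OF trio_ball[OF w(1,3)] trio_ball[OF v(1,3)]])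
  then show ?thesis using d by simp
qed

lemma hexv_apart: "i < 6 \<Longrightarrow> 1 + r \<le> dist (sv ! 0) (hexv ! i)"
  using sv_hexv_dist unfolding all_lt_6 by (elim disjE) auto

lemma small_big_apart:
  assumes w: "norm w = 1" "hexagon a w \<in> T" and v: "v \<in> V"
  shows "1 + r \<le> dist (motion a w (sv ! 0)) v"
proof (rule ccontr)
  assume *: "\<not> 1 + r \<le> dist (motion a w (sv ! 0)) v"
  have "(motion a w (sv ! 0), r) \<in> trio a w" unfolding trio_def set_sv by simp
  then have "v extreme_point_of hexagon a w" using vertex_near_small[OF w _ v] * by simp
  then obtain i where "i < 6" "v = motion a w (hexv ! i)" unfolding hx_ext[OF w(1)] by blast
  then show False using * hexv_apart[of i] by (simp add: dist_mv[OF w(1)])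
qed

lemma packing_S: "packing S"
  unfolding packing_iff
proof (intro conjI ballI impI)
  fix D assume "D \<in> S"
  then show "0 < snd D" using r_gt by (cases rule: S_cases) auto
next
  fix D E assume D: "D \<in> S" and E: "E \<in> S" and ne: "D \<noteq> E"
  show "snd D + snd E \<le> dist (fst D) (fst E)"
    using D
  proof (cases rule: S_cases)
    case (vertex v)
    note D = vertex
    show ?thesis using E
    proof (cases rule: S_cases)
      case (vertex w)
      then show ?thesis using D ne V_sep[of v w] by auto
    next
      case (small a w)
      then show ?thesis using D small_big_apart[of w a v] by (simp add: dist_commute)
    qed
  next
    case (small a w)
    note D = small
    have Dt: "D \<in> trio a w" unfolding D trio_def set_sv by simp
    show ?thesis using E
    proof (cases rule: S_cases)
      case (vertex v)
      then show ?thesis using D small_big_apart[of w a v] by (simp add: add.commute)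
    next
      case (small b v)
      have Et: "E \<in> trio b v" unfolding small trio_def set_sv by simp
      show ?thesis
      proof (cases "dist (fst D) (fst E) \<le> 2 * r")
        case True
        have "E \<in> trio a w" by (rule small_small[OF D(1,2) Dt small(1,2) Et True])
        then have "tangent D E" using trio_tangent[OF D(1)] Dt ne unfolding pairwise_def by blast
        then show ?thesis unfolding tangent_def by simp
      qed (use D small in simp)
    qed
  qed
qed

text \<open>Every side of a hexagon joins an even to an odd vertex, and the small disc at the even
  one touches both unit discs; in a triangle the third vertex serves.\<close>

lemma side_left:
  assumes t: "t \<in> T" and s: "side t v w"
  shows "\<exists>F\<in>S. tangent (v, 1) F \<and> tangent (w, 1) F \<and> 0 < cross v w (fst F)"
proof -
  obtain a u where u: "norm u = 1" and tt: "t = hexagon a u \<or> t = triangle a u" using T_cell[OF t] unfolding cells_def by blast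
  from tt show ?thesis
  proof
    assume h: "t = hexagon a u"
    obtain i where i: "i < 6" "v = motion a u (hexv ! i)" "w = motion a u (hexv ! (Suc i mod 6))"
      using s unfolding h hx_side[OF u] by blast
    have fin: ?thesis if u': "norm u' = 1" "hexagon a u' = hexagon a u" and
      vw: "v = motion a u' (hexv ! 0) \<and> w = motion a u' (hexv ! 1) \<or> v = motion a u' (hexv ! 5) \<and> w = motion a u' (hexv ! 0)" for u'
    proof -
      let ?F = "(motion a u' (sv ! 0), r)"
      have "?F \<in> S" using u' t h unfolding S_iff trio_def set_sv by (intro disjI2 exI[of _ a] exI[of _ u']) simp
      moreover have "tangent (v, 1) ?F" "tangent (w, 1) ?F" "0 < cross v w (fst ?F)"
        using vw sv_hexv_dist sv_hexv_dist[unfolded One_nat_def] sv_cr sv_cr[unfolded One_nat_def]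
        by (auto simp: tangent_def dist_mv[OF u'(1)] cr_mv[OF u'(1)] dist_commute cr_rotate)
      ultimately show ?thesis by blast
    qed
    show ?thesis
    proof (cases "even i")
      case True
      then obtain k where k: "i = 2 * k" "k < 3" using i(1) by auto
      obtain u' where u': "norm u' = 1" "hexagon a u' = hexagon a u"
        "\<And>j. j < 6 \<Longrightarrow> motion a u' (hexv ! j) = motion a u (hexv ! ((j + 2 * k) mod 6))" using frame_shift[OF u k(2)] by metis
      show ?thesis using u'(3)[of 0] u'(3)[of 1] i k by (intro fin[OF u'(1,2)]) simp
    next
      case False
      \<comment> \<open>A side with odd \<open>i\<close> ends in an even vertex; the shift by 2 * k,
        congruent to \<open>Suc i\<close> modulo 6, turns it into the side from 5 to 0.\<close>
      define k where "k = Suc i div 2 mod 3"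
      have k: "k < 3" unfolding k_def by simp
      obtain u' where u': "norm u' = 1" "hexagon a u' = hexagon a u"
        "\<And>j. j < 6 \<Longrightarrow> motion a u' (hexv ! j) = motion a u (hexv ! ((j + 2 * k) mod 6))" using frame_shift[OF u k] by metis
      have "(5 + 2 * k) mod 6 = i" "(0 + 2 * k) mod 6 = Suc i mod 6"
        using False i(1) unfolding k_def all_lt_6 by auto
      then show ?thesis using u'(3)[of 5] u'(3)[of 0] i by (intro fin[OF u'(1,2)]) simp
    qed
  next
    assume h: "t = triangle a u"
    obtain i where i: "i < 3" "v = motion a u (triv ! i)" "w = motion a u (triv ! (Suc i mod 3))"
      using s unfolding h tri_side[OF u] by blast
    let ?j = "Suc (Suc i) mod 3"
    let ?f = "motion a u (triv ! ?j)"
    have fe: "?f extreme_point_of t" unfolding h tri_ext[OF u] by (intro exI[of _ ?j]) simp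
    have inj: "motion a u (triv ! x) = motion a u (triv ! y) \<longleftrightarrow> x = y" if "x < 3" "y < 3" for x y
      using nth_inj[OF good_triv] that unfolding mv_inj[OF u] by auto
    have "?f \<noteq> v" "?f \<noteq> w" unfolding i by (subst inj; use i(1) in presburger)+
    then have "12/5 \<le> cross v w ?f" using side_far[OF T_tile[OF t] s fe] by blast
    moreover have "side t w ?f" "side t ?f v" unfolding h tri_side[OF u]
      subgoal using i by (intro exI[of _ "Suc i mod 3"]) (simp add: mod_Suc_eq)
      subgoal using i by (intro exI[of _ "Suc (Suc i) mod 3"]) (simp add: mod_Suc_eq)
      done
    then have "dist w ?f = 2" "dist ?f v = 2" by (simp_all add: side_dist)
    ultimately show ?thesis using vertex_in_S[OF V_mem[OF t fe]]
      by (intro bexI[of _ "(?f, 1)"]) (simp_all add: tangent_def dist_commute)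
  qed
qed

text \<open>The neighbours of a small disc are just the five of the model corona:
  \<open>vertex_near_small\<close> and \<open>small_small\<close> exclude discs from elsewhere. Each
  neighbour has its successor on one side and its predecessor on the other.\<close>

lemma small_left:
  assumes w: "norm w = 1" "hexagon a w \<in> T" and D: "D \<in> S" "tangent (motion a w (sv ! 0), r) D"
  shows "\<exists>F\<in>S. tangent (motion a w (sv ! 0), r) F \<and> tangent D F \<and> 0 < cross (motion a w (sv ! 0)) (fst D) (fst F)"
    "\<exists>F\<in>S. tangent (motion a w (sv ! 0), r) F \<and> tangent D F \<and> 0 < cross (fst D) (motion a w (sv ! 0)) (fst F)"
proof -
  let ?E = "(motion a w (sv ! 0), r)"
  have Et: "?E \<in> trio a w" unfolding trio_def set_sv by simp
  have h: "(motion a w (hexv ! i), 1) \<in> S" if "i < 6" for i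
    using that w by (intro vertex_in_S V_mem[OF w(2)]) (auto simp: hx_ext)
  have s: "(motion a w (sv ! 1), r) \<in> S" "(motion a w (sv ! 2), r) \<in> S"
    by (rule trio_in_S[OF w], simp add: trio_def set_sv)+
  \<comment> \<open>The rotation taking \<open>sv ! 0\<close> to \<open>sv ! 1\<close> takes
    \<open>hexv ! 5\<close> to \<open>hexv ! 1\<close>.\<close>
  have s1h1: "dist (sv ! 1) (hexv ! 1) = 1 + r"
  proof -
    obtain w' where w': "norm w' = 1" "\<And>j. j < 6 \<Longrightarrow> motion 0 w' (hexv ! j) = motion 0 1 (hexv ! ((j + 2 * 1) mod 6))"
      "\<And>j. j < 3 \<Longrightarrow> motion 0 w' (sv ! j) = motion 0 1 (sv ! ((j + 1) mod 3))" using frame_shift[of 1 1 0] by (metis norm_one one_less_numeral_iff semiring_norm(77))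
    have "dist (motion 0 w' (sv ! 0)) (motion 0 w' (hexv ! 5)) = 1 + r" unfolding dist_mv[OF w'(1)] by (rule sv_hexv_dist)
    then show ?thesis using w'(2)[of 5] w'(3)[of 0] by (simp add: motion_def)
  qed
  have cyc: "(\<exists>F\<in>S. tangent ?E F \<and> tangent D F \<and> 0 < cross (motion a w (sv ! 0)) (fst D) (fst F)) \<and>
      (\<exists>F\<in>S. tangent ?E F \<and> tangent D F \<and> 0 < cross (fst D) (motion a w (sv ! 0)) (fst F))"
    if "D \<in> {(motion a w (hexv ! 0), 1), (motion a w (hexv ! 1), 1), (motion a w (sv ! 1), r), (motion a w (sv ! 2), r), (motion a w (hexv ! 5), 1)}"
  proof -
    have next_prev: "(\<exists>F\<in>S. tangent ?E F \<and> tangent (motion a w y, q) F \<and> 0 < cross (motion a w (sv ! 0)) (motion a w y) (fst F)) \<and>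
      (\<exists>F\<in>S. tangent ?E F \<and> tangent (motion a w y, q) F \<and> 0 < cross (motion a w y) (motion a w (sv ! 0)) (fst F))"
      if "(motion a w x, p) \<in> S" "(motion a w z, l) \<in> S" "dist (sv ! 0) x = r + p" "dist (sv ! 0) z = r + l"
        "dist y x = q + p" "dist y z = q + l" "0 < cross (sv ! 0) x y" "0 < cross (sv ! 0) y z" for x y z p q l
    proof (rule conjI)
      show "\<exists>F\<in>S. tangent ?E F \<and> tangent (motion a w y, q) F \<and> 0 < cross (motion a w (sv ! 0)) (motion a w y) (fst F)"
        using that by (intro bexI[of _ "(motion a w z, l)"]) (simp_all add: tangent_def dist_mv[OF w(1)] cr_mv[OF w(1)])
      show "\<exists>F\<in>S. tangent ?E F \<and> tangent (motion a w y, q) F \<and> 0 < cross (motion a w y) (motion a w (sv ! 0)) (fst F)"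
        using that cr_rotate(2)[of y "sv ! 0" x]
        by (intro bexI[of _ "(motion a w x, p)"]) (simp_all add: tangent_def dist_mv[OF w(1)] cr_mv[OF w(1)])
    qed
    have d: "dist (sv ! 0) (hexv ! 0) = r + 1" "dist (sv ! 0) (hexv ! 1) = r + 1" "dist (sv ! 0) (hexv ! 5) = r + 1"
      "dist (sv ! 0) (sv ! 1) = r + r" "dist (sv ! 0) (sv ! 2) = r + r"
      "dist (hexv ! 0) (hexv ! 5) = 1 + 1" "dist (hexv ! 0) (hexv ! 1) = 1 + 1"
      "dist (hexv ! 1) (hexv ! 0) = 1 + 1" "dist (hexv ! 5) (hexv ! 0) = 1 + 1"
      "dist (hexv ! 1) (sv ! 1) = 1 + r" "dist (sv ! 1) (hexv ! 1) = r + 1"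
      "dist (hexv ! 5) (sv ! 2) = 1 + r" "dist (sv ! 2) (hexv ! 5) = r + 1"
      "dist (sv ! 2) (sv ! 1) = r + r" "dist (sv ! 1) (sv ! 2) = r + r"
      using sv_hexv_dist(1-3) hexv_dist(1,2) s1h1 sv2_hexv5 sv_dist
        dist_commute[of "hexv ! 0" "hexv ! 5"] dist_commute[of "hexv ! 1" "hexv ! 0"]
        dist_commute[of "hexv ! 1" "sv ! 1"] dist_commute[of "hexv ! 5" "sv ! 2"] dist_commute[of "sv ! 2" "sv ! 1"]
      by linarith+
    from that show ?thesis
      apply (elim insertE emptyE; simp only: fst_conv)
      subgoal by (rule next_prev[of "hexv ! 5" 1 "hexv ! 1" 1]; (rule d s sv_cr | (rule h, simp)))
      subgoal by (rule next_prev[of "hexv ! 0" 1 "sv ! 1" r]; (rule d s sv_cr | (rule h, simp)))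
      subgoal by (rule next_prev[of "hexv ! 1" 1 "sv ! 2" r]; (rule d s sv_cr | (rule h, simp)))
      subgoal by (rule next_prev[of "sv ! 1" r "hexv ! 5" 1]; (rule d s sv_cr | (rule h, simp)))
      subgoal by (rule next_prev[of "sv ! 2" r "hexv ! 0" 1]; (rule d s sv_cr | (rule h, simp)))
      done
  qed
  have "D \<in> {(motion a w (hexv ! 0), 1), (motion a w (hexv ! 1), 1), (motion a w (sv ! 1), r), (motion a w (sv ! 2), r), (motion a w (hexv ! 5), 1)}"
    using D(1)
  proof (cases rule: S_cases)
    case (vertex v)
    have dv: "dist (motion a w (sv ! 0)) v = 1 + r" using D(2) unfolding vertex tangent_def by simp
    then have "v extreme_point_of hexagon a w" using vertex_near_small[OF w Et vertex(1)] by simp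
    then obtain i where i: "i < 6" "v = motion a w (hexv ! i)" unfolding hx_ext[OF w(1)] by blast
    then have "dist (sv ! 0) (hexv ! i) = 1 + r" using dv by (simp add: dist_mv[OF w(1)])
    then have "i \<noteq> 2" "i \<noteq> 3" "i \<noteq> 4" using sv_hexv_dist(4-6) by auto
    then have "i = 0 \<or> i = 1 \<or> i = 5" using i(1) by linarith
    then show ?thesis using vertex i by auto
  next
    case (small b v)
    have "D \<in> trio b v" unfolding small trio_def set_sv by simp
    moreover have "dist (fst ?E) (fst D) \<le> 2 * r" using D(2) unfolding small tangent_def by simp
    ultimately have "D \<in> trio a w" by (intro small_small[OF w Et small(1,2)])
    moreover have "D \<noteq> ?E" using D(2) r_gt unfolding tangent_def by auto
    ultimately show ?thesis unfolding trio_def set_sv by auto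
  qed
  then show "\<exists>F\<in>S. tangent (motion a w (sv ! 0), r) F \<and> tangent D F \<and> 0 < cross (motion a w (sv ! 0)) (fst D) (fst F)"
    "\<exists>F\<in>S. tangent (motion a w (sv ! 0), r) F \<and> tangent D F \<and> 0 < cross (fst D) (motion a w (sv ! 0)) (fst F)"
    using cyc by blast+
qed

text \<open>If one disc is small, \<open>small_left\<close> applies. Two touching unit discs are
  vertices of a common tile, which has their segment as a side; this tile or the one across the side
  lies to the left of the pair and provides the third disc.\<close>

lemma left_closed_S: "left_closed S"
  unfolding left_closed_def
proof (intro ballI impI)
  fix D E assume D: "D \<in> S" and E: "E \<in> S" and t: "tangent D E"
  show "\<exists>F\<in>S. tangent D F \<and> tangent E F \<and> 0 < cross (fst D) (fst E) (fst F)"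
    using D
  proof (cases rule: S_cases)
    case (small a w)
    then show ?thesis using small_left(1)[OF small(1,2) E] t by simp
  next
    case (vertex v)
    note D' = vertex
    show ?thesis using E
    proof (cases rule: S_cases)
      case (small a w)
      have "tangent (motion a w (sv ! 0), r) D" using t small(4) tangent_sym by metis
      then have "\<exists>F\<in>S. tangent (motion a w (sv ! 0), r) F \<and> tangent D F \<and> 0 < cross (fst D) (motion a w (sv ! 0)) (fst F)"
        by (rule small_left(2)[OF small(1,2) D])
      then show ?thesis unfolding small(4) by auto
    next
      case (vertex w)
      have d: "dist v w = 2" using t unfolding vertex D' tangent_def by simp
      then have "v \<noteq> w" by auto
      obtain t where t: "t \<in> T" "v extreme_point_of t" "w extreme_point_of t"
        using common_tile[OF D'(1) vertex(1) \<open>v \<noteq> w\<close>] d by auto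
      obtain t' where "t' \<in> T" "side t' v w"
        using tile_adj[OF T_tile[OF t(1)] t(2,3) d] t(1) opposite_side by metis
      then show ?thesis using side_left unfolding vertex D' by auto
    qed
  qed
qed

lemma S_radii: "snd ` S = {1, r}"
proof
  show "snd ` S \<subseteq> {1, r}" by (auto elim!: S_cases)
  obtain a w where w: "norm w = 1" "hexagon a w \<in> T" using T unfolding tilings_by_def congruent_iff[OF hP] by blast
  have "motion a w (hexv ! 0) extreme_point_of hexagon a w" unfolding hx_ext[OF w(1)] by (intro exI[of _ 0]) simp
  then have "(motion a w (hexv ! 0), 1) \<in> S" by (intro vertex_in_S V_mem[OF w(2)])
  moreover have "(motion a w (sv ! 0), r) \<in> S" by (rule trio_in_S[OF w]) (simp add: trio_def set_sv)
  ultimately show "{1, r} \<subseteq> snd ` S" by force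
qed

lemma S_neighbour: "D \<in> S \<Longrightarrow> \<exists>E\<in>S. tangent D E"
proof -
  assume "D \<in> S"
  then show ?thesis
  proof (cases rule: S_cases)
    case (vertex v)
    obtain t where t: "t \<in> T" "v extreme_point_of t" using vertex unfolding V_def by blast
    obtain b where b: "side t v b" using tile_side_out[OF T_tile[OF t(1)] t(2)] by blast
    have "(b, 1) \<in> S" using side_ext(2)[OF b] V_mem[OF t(1)] vertex_in_S by blast
    then show ?thesis using side_dist[OF b] unfolding vertex by (intro bexI) (simp_all add: tangent_def)
  next
    case (small a w)
    have "(motion a w (sv ! 1), r) \<in> S" by (rule trio_in_S[OF small(1,2)]) (simp add: trio_def set_sv)
    then show ?thesis using sv_dist(1) unfolding small
      by (intro bexI[of _ "(motion a w (sv ! 1), r)"]) (simp_all add: tangent_def dist_mv[OF small(1)])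
  qed
qed

lemma S_compact: "S \<in> compact_packings_1 r"
  unfolding compact_packings_1_def
  using compactI[OF packing_S _ left_closed_S S_neighbour] S_radii by simp

text \<open>\<open>T\<close> is a subfamily of the nonoverlapping \<open>unit_tiles\<close> and
  already covers the plane, so no further tile has room.\<close>

lemma tiling_of_S: "tiling_of_packing S = T"
proof -
  interpret uc: unit_centres "centres S" cells by (rule unit_centres_packing[OF packing_S])
  have "x \<in> V" if x: "x \<in> centres S" for x
  proof -
    have "(x, 1) \<in> S" using x unfolding centres_def by simp
    then show ?thesis using r_neq_1 by (cases rule: S_cases) auto
  qed
  have "t \<in> uc.unit_tiles" if t: "t \<in> T" for t
    unfolding uc.unit_tiles_def using T_cell[OF t] V_mem[OF t] vertex_in_S unfolding centres_def[of S] by blast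
  then have sub: "T \<subseteq> uc.unit_tiles" by blast
  moreover have "t \<in> T" if t: "t \<in> uc.unit_tiles" for t
  proof -
    obtain x where x: "x \<in> interior t" using tile_interior_nonempty[OF uc.TT_tile[OF t]] by blast
    obtain s where s: "s \<in> T" "x \<in> s" using T_cover by blast
    have "t = s" using nonoverlapping_interior_eq[OF uc.TT_nonoverlapping t _ T_tile[OF s(1)] x s(2)] sub s(1) by blast
    then show ?thesis using s by simp
  qed
  ultimately have "uc.unit_tiles = T" by blast
  then show ?thesis using packing_to_tiling(1)[OF hP S_compact] by simp
qed

end

section \<open>The two directions combined\<close>

lemma (in ratio) tiling_to_packing:
  assumes "is_hexagon_P r P" "T \<in> tilings_by P"
  shows "packing_of_tiling r P T \<in> compact_packings_1 r" "tiling_of_packing (packing_of_tiling r P T) = T"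
proof -
  interpret hexagon_tiling r P T by unfold_locales (use assms in auto)
  show "packing_of_tiling r P T \<in> compact_packings_1 r" "tiling_of_packing (packing_of_tiling r P T) = T"
    using S_compact tiling_of_S unfolding S_def by auto
qed

theorem mainTheorem8:
  shows "(\<exists>!r. 1/2 < r \<and> r < 3/5 \<and> quartic r = 0) \<and>
    (\<forall>r. 1/2 < r \<and> r < 3/5 \<and> quartic r = 0 \<longrightarrow>
      \<bar>r - 0.5451510421\<bar> < 1 / 10^10 \<and>
      (\<exists>P. is_hexagon_P r P) \<and>
      (\<forall>P. is_hexagon_P r P \<longrightarrow>
        (\<forall>H. congruent_to P H \<longrightarrow> (\<exists>!K. inscribed_trio r H K)) \<and>
        bij_betw tiling_of_packing (compact_packings_1 r) (tilings_by P) \<and>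
        (\<forall>T\<in>tilings_by P.
          inv_into (compact_packings_1 r) tiling_of_packing T = packing_of_tiling r P T)))"
proof (intro conjI allI impI)
  show "\<exists>!r. 1/2 < r \<and> r < 3/5 \<and> quartic r = 0" by (rule quartic_root_ex1)
next
  fix r :: real assume r: "1/2 < r \<and> r < 3/5 \<and> quartic r = 0"
  show "\<bar>r - 0.5451510421\<bar> < 1 / 10^10"
  proof -
    have "r - 0.5451510421 < 1 / 10^10" "- (r - 0.5451510421) < 1 / 10^10"
      using quartic_root_bounds[of r] r by simp_all
    then show ?thesis by (simp only: abs_less_iff)
  qed
  interpret ratio r by unfold_locales (use r in auto)
  show "\<exists>P. is_hexagon_P r P" using hexagon_exists by blast
  fix P assume P: "is_hexagon_P r P"
  show "\<exists>!K. inscribed_trio r H K" if "congruent_to P H" for H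
    using that trio_inscribed inscribed_trio_unique unfolding congruent_iff[OF P] by blast
  note fwd = packing_to_tiling(2,3)[OF P] and bwd = tiling_to_packing[OF P]
  show bij: "bij_betw tiling_of_packing (compact_packings_1 r) (tilings_by P)"
    by (rule bij_betw_byWitness[of _ "packing_of_tiling r P"]) (use fwd bwd in auto)
  show "\<forall>T\<in>tilings_by P. inv_into (compact_packings_1 r) tiling_of_packing T = packing_of_tiling r P T"
    by (intro ballI inv_into_f_eq[OF bij_betw_imp_inj_on[OF bij]] bwd)
qed

end
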